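(* Let $\mathcal F$ be an admissible sequence of polynomials, and let $\boldsymbol{x}=(x_1,\dots,x_n)$ and $\boldsymbol{y}=(y_1,\dots,y_n)$ be two sets of indeterminates. Then $$\sum_\lambda P^{\mathcal F}_\lambda(\boldsymbol{x})\,\widehat{P}^{\mathcal F}_\lambda(\boldsymbol{y})=\prod_{i,j=1}^n\frac{1+x_iy_j}{1-x_iy_j},$$ where $\lambda$ runs over all strict partitions.
   Context: $K$ is a field of characteristic $0$. A sequence $\mathcal F=\{f_d\}_{d=0}^\infty$ of polynomials $f_d(u)\in K[u]$ is admissible if $f_0=1$ and $\deg f_d=d$ for all $d\ge 1$. The dual of $\mathcal F$ is the unique sequence $\{\widehat f_d\}_{d=0}^\infty$ of formal power series $\widehat f_d(v)\in K[[v]]$ such that $\widehat f_d$ has order exactly $d$ (its lowest nonzero term is in degree $d$) and $\sum_{k=0}^\infty f_k(u)\widehat f_k(v)=\frac{1+uv}{1-uv}$. A strict partition of length $l$ is a strictly decreasing sequence $\lambda=(\lambda_1>\dots>\lambda_l)$ of positive integers (the empty sequence $\emptyset$ has length $0$). ${}^tM$ denotes the transpose of $M$, $O$ a zero matrix, and $\mathrm{Pf}$ the Pfaffian (the empty Pfaffian is $1$). For indeterminates $\boldsymbol{x}=(x_1,\dots,x_n)$ put $A(\boldsymbol{x})=\left(\frac{x_j-x_i}{x_j+x_i}\right)_{1\le i,j\le n}$ and $\Delta(\boldsymbol{x})=\prod_{1\le i<j\le n}\frac{x_j-x_i}{x_j+x_i}$. For a sequence $\alpha=(\alpha_1,\dots,\alpha_r)$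 of nonnegative integers let $V^{\mathcal F}_\alpha(\boldsymbol{x})=(f_{\alpha_j}(x_i))_{1\le i\le n,\,1\le j\le r}$ and $\widehat V^{\mathcal F}_\alpha(\boldsymbol{x})=(\widehat f_{\alpha_j}(x_i))_{1\le i\le n,\,1\le j\le r}$. For a strict partition $\lambda$ of length $l$, put $\lambda^*=\lambda$ if $n+l$ is even and $\lambda^*=(\lambda_1,\dots,\lambda_l,0)$ if $n+l$ is odd. The generalized $P$-function and generalized dual $P$-function are $$P^{\mathcal F}_\lambda(\boldsymbol{x})=\frac{1}{\Delta(\boldsymbol{x})}\mathrm{Pf}\begin{pmatrix}A(\boldsymbol{x})&V^{\mathcal F}_{\lambda^*}(\boldsymbol{x})\\-{}^tV^{\mathcal F}_{\lambda^*}(\boldsymbol{x})&O\end{pmatrix},\qquad \widehat P^{\mathcal F}_\lambda(\boldsymbol{x})=\frac{1}{\Delta(\boldsymbol{x})}\mathrm{Pf}\begin{pmatrix}A(\boldsymbol{x})&\widehat V^{\mathcal F}_{\lambda^*}(\boldsymbol{x})\\-{}^t\widehat V^{\mathcal F}_{\lambda^*}(\boldsymbol{x})&O\end{pmatrix}.$$ $P^{\mathcal F}_\lambda(\boldsymbol{x})$ is a polynomial in $\boldsymbol x$ and $\widehat P^{\mathcal F}_\lambda(\boldsymbol{y})$ is a formal power series in $\boldsymbol y$; the identity is an identity of formal power series in $y_1,\dots,y_n$ with coefficients in $K[x_1,\dots,x_n]$. *)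

theory Defs
  imports
    "HOL-Library.Poly_Mapping"
    "HOL-Combinatorics.Permutations"
    "HOL-Computational_Algebra.Formal_Power_Series"
    "HOL-Computational_Algebra.Polynomial_Factorial"
    "HOL-Analysis.Infinite_Sum"
    "Jordan_Normal_Form.Matrix"
begin

section \<open>Multivariate polynomials and formal power series\<close>

text \<open>
  Indeterminates are numbered \<open>0, 1, 2, \<dots>\<close>, and a monomial is a finitely supported exponent
  function. The \<open>n\<close> indeterminates of a statement are those with number \<open>< n\<close>; the remaining
  ones simply do not occur.
\<close>

type_synonym monomial = "nat \<Rightarrow>\<^sub>0 nat"

abbreviation expo :: "monomial \<Rightarrow> nat \<Rightarrow> nat" where
  "expo \<equiv> Poly_Mapping.lookup"

abbreviation vars :: "monomial \<Rightarrow> nat set" where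
  "vars \<equiv> Poly_Mapping.keys"

type_synonym 'a mpoly = "monomial \<Rightarrow>\<^sub>0 'a"

definition mpoly_const :: "'a::comm_ring_1 \<Rightarrow> 'a mpoly" where
  "mpoly_const c = Poly_Mapping.single 0 c"

definition mpoly_var :: "nat \<Rightarrow> 'a::comm_ring_1 mpoly" where
  "mpoly_var i = Poly_Mapping.single (Poly_Mapping.single i 1) 1"

typedef 'a mfps = "UNIV :: (monomial \<Rightarrow> 'a) set"
  morphisms mfps_coeff Abs_mfps by simp

lemma mfps_coeff_Abs [simp]: "mfps_coeff (Abs_mfps f) = f"
  by (simp add: Abs_mfps_inverse)

lemma mfps_eqI: "(\<And>m. mfps_coeff f m = mfps_coeff g m) \<Longrightarrow> f = g"
  by (metis ext mfps_coeff_inject)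

lemma mfps_eq_iff: "f = g \<longleftrightarrow> (\<forall>m. mfps_coeff f m = mfps_coeff g m)"
  by (metis mfps_eqI)

definition splittings :: "monomial \<Rightarrow> (monomial \<times> monomial) set" where
  "splittings m = {(a, b). a + b = m}"

lemma finite_splittings [simp]: "finite (splittings m)"
proof -
  define B where "B = Max (insert 0 (expo m ` vars m))"
  let ?F = "{f. \<forall>k. (k \<in> vars m \<longrightarrow> f k \<in> {..B}) \<and> (k \<notin> vars m \<longrightarrow> f k = (0::nat))}"
  have "expo a \<in> ?F" if "a + b = m" for a b
  proof -
    have le: "expo a k \<le> expo m k" for k
      using that by (auto simp: lookup_add)
    have "expo m k \<le> B" if "k \<in> vars m" for k
      unfolding B_def using that by (intro Max_ge) auto
    then show ?thesis
      using le by (auto simp: in_keys_iff) (metis le_trans, metis le_zero_eq)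
  qed
  then have "expo ` (fst ` splittings m) \<subseteq> ?F"
    by (auto simp: splittings_def)
  moreover have "finite ?F" by (rule finite_set_of_finite_funs) auto
  ultimately have "finite (expo ` (fst ` splittings m))"
    by (rule finite_subset)
  then have "finite (fst ` splittings m)"
    by (rule finite_imageD) (simp add: inj_on_def)
  then show ?thesis
    by (rule finite_imageD) (auto simp: inj_on_def splittings_def)
qed

instantiation mfps :: (comm_ring_1) comm_ring_1
begin

definition "0 = Abs_mfps (\<lambda>m. 0)"
definition "1 = Abs_mfps (\<lambda>m. if m = 0 then 1 else 0)"
definition "f + g = Abs_mfps (\<lambda>m. mfps_coeff f m + mfps_coeff g m)"
definition "f - g = Abs_mfps (\<lambda>m. mfps_coeff f m - mfps_coeff g m)"
definition "- f = Abs_mfps (\<lambda>m. - mfps_coeff f m)"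
definition "f * g = Abs_mfps (\<lambda>m. \<Sum>(a, b)\<in>splittings m. mfps_coeff f a * mfps_coeff g b)"

instance
proof
  fix f g h :: "'a mfps"
  note defs = zero_mfps_def one_mfps_def plus_mfps_def minus_mfps_def uminus_mfps_def times_mfps_def
  show "f + g + h = f + (g + h)" "f + g = g + f" "0 + f = f" "- f + f = 0" "f - g = f + - g"
    by (simp_all add: defs mfps_eq_iff algebra_simps)
  show "(f + g) * h = f * h + g * h"
    by (simp add: defs mfps_eq_iff algebra_simps sum.distrib split_beta)
  show "f * g = g * f"
  proof (rule mfps_eqI)
    fix m
    have "(\<Sum>(a, b)\<in>splittings m. mfps_coeff f a * mfps_coeff g b)
        = (\<Sum>(a, b)\<in>splittings m. mfps_coeff g a * mfps_coeff f b)"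
      by (rule sum.reindex_bij_witness[of _ "\<lambda>(a, b). (b, a)" "\<lambda>(a, b). (b, a)"])
         (auto simp: splittings_def add.commute mult.commute)
    then show "mfps_coeff (f * g) m = mfps_coeff (g * f) m" by (simp add: defs)
  qed
  show "1 * f = f"
  proof (rule mfps_eqI)
    fix m
    have "mfps_coeff (1 * f) m
        = (\<Sum>p\<in>splittings m. if p = (0, m) then mfps_coeff f m else 0)"
      by (auto simp: defs splittings_def split_beta intro!: sum.cong)
    also have "\<dots> = mfps_coeff f m"
      using finite_splittings by (simp, simp add: splittings_def)
    finally show "mfps_coeff (1 * f) m = mfps_coeff f m" .
  qed
  show "f * g * h = f * (g * h)"
  proof (rule mfps_eqI)
    fix m
    let ?c = mfps_coeff
    have "?c (f * g * h) m = (\<Sum>p\<in>splittings m. \<Sum>q\<in>splittings (fst p). ?c f (fst q) * ?c g (snd q) * ?c h (snd p))"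
      by (simp add: defs split_beta sum_distrib_right)
    also have "\<dots> = (\<Sum>(p, q)\<in>Sigma (splittings m) (\<lambda>p. splittings (fst p)). ?c f (fst q) * ?c g (snd q) * ?c h (snd p))"
      by (rule sum.Sigma) auto
    also have "\<dots> = (\<Sum>(p, q)\<in>Sigma (splittings m) (\<lambda>p. splittings (snd p)). ?c f (fst p) * (?c g (fst q) * ?c h (snd q)))"
      by (rule sum.reindex_bij_witness[of _
            "\<lambda>((a, bc), (b, c)). ((a + b, c), (a, b))" "\<lambda>((ab, c), (a, b)). ((a, b + c), (b, c))"])
         (auto simp: splittings_def add.assoc mult.assoc)
    also have "\<dots> = (\<Sum>p\<in>splittings m. \<Sum>q\<in>splittings (snd p). ?c f (fst p) * (?c g (fst q) * ?c h (snd q)))"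
      by (rule sum.Sigma[symmetric]) auto
    also have "\<dots> = ?c (f * (g * h)) m"
      by (simp add: defs split_beta sum_distrib_left)
    finally show "?c (f * g * h) m = ?c (f * (g * h)) m" .
  qed
  show "(0::'a mfps) \<noteq> 1"
    by (auto simp: defs mfps_eq_iff)
qed

end

lemma mfps_coeff_0 [simp]: "mfps_coeff 0 m = 0"
  and mfps_coeff_1: "mfps_coeff 1 m = (if m = 0 then 1 else 0)"
  and mfps_coeff_add [simp]: "mfps_coeff (f + g) m = mfps_coeff f m + mfps_coeff g m"
  and mfps_coeff_diff [simp]: "mfps_coeff (f - g) m = mfps_coeff f m - mfps_coeff g m"
  and mfps_coeff_uminus [simp]: "mfps_coeff (- f) m = - mfps_coeff f m"
  and mfps_coeff_mult:
    "mfps_coeff (f * g) m = (\<Sum>(a, b)\<in>splittings m. mfps_coeff f a * mfps_coeff g b)"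
  by (simp_all add: zero_mfps_def one_mfps_def plus_mfps_def minus_mfps_def uminus_mfps_def
      times_mfps_def)

lemma mfps_coeff_sum: "mfps_coeff (sum F A) m = (\<Sum>a\<in>A. mfps_coeff (F a) m)"
  by (induction A rule: infinite_finite_induct) auto

lemma less_monom_iff:
  "(a::monomial) < b \<longleftrightarrow> (\<exists>k. expo a k < expo b k \<and> (\<forall>j<k. expo a j = expo b j))"
  by (simp add: less_poly_mapping.rep_eq less_fun_def)

lemma monom_add_less_le: "(a::monomial) < c \<Longrightarrow> b \<le> d \<Longrightarrow> a + b < c + d"
  by (rule add_less_le_mono)

text \<open>The order on monomials is not well-founded, but it is on those in boundedly many variables.\<close>

lemma monom_bounded_min:
  assumes "T \<noteq> {}" "\<And>a. a \<in> T \<Longrightarrow> vars a \<subseteq> {..<N}"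
  obtains a :: monomial where "a \<in> T" "\<And>b. b \<in> T \<Longrightarrow> a \<le> b"
proof -
  let ?l = "\<lambda>a::monomial. map (expo a) [0..<N]"
  have "wf (inv_image (lex less_than) ?l)"
    by (intro wf_inv_image wf_lex wf_less_than)
  then obtain a where a: "a \<in> T" "\<And>b. (b, a) \<in> inv_image (lex less_than) ?l \<Longrightarrow> b \<notin> T"
    using assms(1) by (metis all_not_in_conv wf_eq_minimal)
  have "a \<le> b" if "b \<in> T" for b
  proof (rule ccontr)
    assume "\<not> a \<le> b"
    then have "b < a" by simp
    then obtain k where k: "expo b k < expo a k" "\<forall>j<k. expo b j = expo a j"
      by (auto simp: less_monom_iff)
    have "k \<in> vars a" using k(1) by (auto simp: in_keys_iff)
    then have kN: "k < N" using assms(2)[OF a(1)] by auto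
    have split: "?l c = map (expo c) [0..<k] @ expo c k # map (expo c) [Suc k..<N]" for c :: monomial
    proof -
      have "[0..<N] = [0..<k] @ k # [Suc k..<N]"
        using kN upt_add_eq_append[of 0 k "N - k"] upt_conv_Cons[of k N] by simp
      then show ?thesis by simp
    qed
    have "map (expo b) [0..<k] = map (expo a) [0..<k]" using k(2) by simp
    moreover have "length (map (expo b) [Suc k..<N]) = length (map (expo a) [Suc k..<N])" by simp
    ultimately have "(?l b, ?l a) \<in> lex less_than"
      using k(1) unfolding split[of a] split[of b] lex_conv
      by (auto intro!: exI[of _ "map (expo a) [0..<k]"])
    then show False using a(2)[of b] that by simp
  qed
  then show ?thesis using a(1) that by blast
qed

instance mfps :: (idom) idom
proof
  fix f g :: "'a mfps"
  assume "f \<noteq> 0" "g \<noteq> 0"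
  then obtain a0 b0 where ab0: "mfps_coeff f a0 \<noteq> 0" "mfps_coeff g b0 \<noteq> 0"
    by (auto simp: mfps_eq_iff)
  have "finite (vars a0 \<union> vars b0)" by simp
  then obtain N where N: "vars a0 \<union> vars b0 \<subseteq> {..<N}"
    using finite_nat_iff_bounded by blast
  have min: "\<exists>a. mfps_coeff h a \<noteq> 0 \<and> vars a \<subseteq> {..<N} \<and>
      (\<forall>c. mfps_coeff h c \<noteq> 0 \<and> vars c \<subseteq> {..<N} \<longrightarrow> a \<le> c)"
    if "mfps_coeff h a0 \<noteq> 0" "vars a0 \<subseteq> {..<N}" for h :: "'a mfps" and a0
  proof -
    let ?T = "{c. mfps_coeff h c \<noteq> 0 \<and> vars c \<subseteq> {..<N}}"
    have "a0 \<in> ?T" using that by blast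
    then have "?T \<noteq> {}" by blast
    then obtain a where "a \<in> ?T" "\<And>b. b \<in> ?T \<Longrightarrow> a \<le> b"
      by (rule monom_bounded_min[of ?T N]) blast+
    then show ?thesis by blast
  qed
  obtain a where a: "mfps_coeff f a \<noteq> 0" "vars a \<subseteq> {..<N}"
      "\<And>c. mfps_coeff f c \<noteq> 0 \<Longrightarrow> vars c \<subseteq> {..<N} \<Longrightarrow> a \<le> c"
    using min[OF ab0(1)] N by blast
  obtain b where b: "mfps_coeff g b \<noteq> 0" "vars b \<subseteq> {..<N}"
      "\<And>c. mfps_coeff g c \<noteq> 0 \<Longrightarrow> vars c \<subseteq> {..<N} \<Longrightarrow> b \<le> c"
    using min[OF ab0(2)] N by blast
  have zero: "mfps_coeff f c * mfps_coeff g d = 0" if cd: "c + d = a + b" "(c, d) \<noteq> (a, b)" for c d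
  proof (rule ccontr)
    assume nz: "mfps_coeff f c * mfps_coeff g d \<noteq> 0"
    have k: "vars c \<subseteq> {..<N}" "vars d \<subseteq> {..<N}"
    proof -
      have "vars c \<union> vars d \<subseteq> vars a \<union> vars b"
      proof
        fix k assume "k \<in> vars c \<union> vars d"
        moreover have "expo c k + expo d k = expo a k + expo b k"
          using cd(1) by (metis lookup_add)
        ultimately show "k \<in> vars a \<union> vars b" by (auto simp: in_keys_iff)
      qed
      then show "vars c \<subseteq> {..<N}" "vars d \<subseteq> {..<N}" using a(2) b(2) by auto
    qed
    have "a \<le> c" using a(3)[OF _ k(1)] nz by fastforce
    moreover have "b \<le> d" using b(3)[OF _ k(2)] nz by fastforce
    ultimately have "a + b < c + d"
      using cd(2) monom_add_less_le[of a c b d] add_le_less_mono[of a c b d]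
      by (cases "a = c") (simp_all add: order.strict_iff_order)
    then show False using cd(1) by simp
  qed
  have "mfps_coeff (f * g) (a + b)
      = (\<Sum>p\<in>splittings (a + b). if p = (a, b) then mfps_coeff f a * mfps_coeff g b else 0)"
    unfolding mfps_coeff_mult
  proof (intro sum.cong refl)
    fix p assume "p \<in> splittings (a + b)"
    moreover obtain c d where "p = (c, d)" by (cases p)
    ultimately show "(case p of (c, d) \<Rightarrow> mfps_coeff f c * mfps_coeff g d)
        = (if p = (a, b) then mfps_coeff f a * mfps_coeff g b else 0)"
      using zero[of c d] by (simp add: splittings_def split: if_splits)
  qed
  also have "\<dots> = mfps_coeff f a * mfps_coeff g b"
    using finite_splittings by (simp, simp add: splittings_def)
  finally show "f * g \<noteq> 0" using a(1) b(1) by auto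
qed

text \<open>The topology of coefficientwise stabilisation (a net converges iff each of its coefficients
  is eventually constant), with respect to which infinite sums of power series are taken.\<close>

instantiation mfps :: (type) topological_space
begin

definition open_mfps :: "'a mfps set \<Rightarrow> bool" where
  "open_mfps U \<longleftrightarrow>
     (\<forall>f\<in>U. \<exists>S. finite S \<and> {g. \<forall>m\<in>S. mfps_coeff g m = mfps_coeff f m} \<subseteq> U)"

instance
proof
  show "open (UNIV :: 'a mfps set)" by (auto simp: open_mfps_def)
next
  fix U V :: "'a mfps set"
  assume U: "open U" and V: "open V"
  show "open (U \<inter> V)"
    unfolding open_mfps_def
  proof
    fix f assume f: "f \<in> U \<inter> V"
    obtain S where S: "finite S" "{g. \<forall>m\<in>S. mfps_coeff g m = mfps_coeff f m} \<subseteq> U"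
      using U[unfolded open_mfps_def, rule_format, OF IntD1[OF f]] by auto
    obtain T where T: "finite T" "{g. \<forall>m\<in>T. mfps_coeff g m = mfps_coeff f m} \<subseteq> V"
      using V[unfolded open_mfps_def, rule_format, OF IntD2[OF f]] by auto
    show "\<exists>S. finite S \<and> {g. \<forall>m\<in>S. mfps_coeff g m = mfps_coeff f m} \<subseteq> U \<inter> V"
      using S T by (intro exI[of _ "S \<union> T"]) auto
  qed
next
  fix K :: "'a mfps set set"
  assume K: "\<forall>U\<in>K. open U"
  show "open (\<Union>K)"
    unfolding open_mfps_def
  proof
    fix f assume "f \<in> \<Union>K"
    then obtain U where U: "U \<in> K" "f \<in> U" by blast
    then obtain S where "finite S" "{g. \<forall>m\<in>S. mfps_coeff g m = mfps_coeff f m} \<subseteq> U"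
      using K[rule_format, OF U(1), unfolded open_mfps_def, rule_format, OF U(2)] by auto
    then show "\<exists>S. finite S \<and> {g. \<forall>m\<in>S. mfps_coeff g m = mfps_coeff f m} \<subseteq> \<Union>K"
      using U(1) by (intro exI[of _ S]) auto
  qed
qed

end

lemma tendsto_mfps_iff:
  "(F \<longlongrightarrow> s) G \<longleftrightarrow> (\<forall>m. eventually (\<lambda>x. mfps_coeff (F x) m = mfps_coeff s m) G)"
proof
  assume lim: "(F \<longlongrightarrow> s) G"
  show "\<forall>m. eventually (\<lambda>x. mfps_coeff (F x) m = mfps_coeff s m) G"
  proof
    fix m
    have "open {g. mfps_coeff g m = mfps_coeff s m}"
      unfolding open_mfps_def by (auto intro!: exI[of _ "{m}"])
    from topological_tendstoD[OF lim this]
    show "eventually (\<lambda>x. mfps_coeff (F x) m = mfps_coeff s m) G" by simp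
  qed
next
  assume ev: "\<forall>m. eventually (\<lambda>x. mfps_coeff (F x) m = mfps_coeff s m) G"
  show "(F \<longlongrightarrow> s) G"
  proof (rule topological_tendstoI)
    fix U assume "open U" "s \<in> U"
    then obtain S where S: "finite S" "{g. \<forall>m\<in>S. mfps_coeff g m = mfps_coeff s m} \<subseteq> U"
      unfolding open_mfps_def by blast
    have "eventually (\<lambda>x. \<forall>m\<in>S. mfps_coeff (F x) m = mfps_coeff s m) G"
      using S(1) ev by (simp add: eventually_ball_finite)
    then show "eventually (\<lambda>x. F x \<in> U) G"
      by (rule eventually_mono) (use S(2) in auto)
  qed
qed

lemma has_sum_mfps_iff:
  fixes F :: "'b \<Rightarrow> 'a::comm_ring_1 mfps"
  shows "(F has_sum s) A \<longleftrightarrow>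
    (\<forall>m. finite {a\<in>A. mfps_coeff (F a) m \<noteq> 0} \<and>
         (\<Sum>a | a \<in> A \<and> mfps_coeff (F a) m \<noteq> 0. mfps_coeff (F a) m) = mfps_coeff s m)"
proof -
  have "(\<forall>\<^sub>F B in finite_subsets_at_top A. (\<Sum>a\<in>B. c a) = t) \<longleftrightarrow>
      finite {a\<in>A. c a \<noteq> 0} \<and> (\<Sum>a | a \<in> A \<and> c a \<noteq> 0. c a) = t" (is "?L \<longleftrightarrow> ?R")
    for c :: "'b \<Rightarrow> 'a" and t
  proof
    assume ?L
    then obtain X where X: "finite X" "X \<subseteq> A"
      and lim: "\<forall>B. finite B \<and> X \<subseteq> B \<and> B \<subseteq> A \<longrightarrow> sum c B = t"
      unfolding eventually_finite_subsets_at_top by (elim exE conjE)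
    have sub: "{a\<in>A. c a \<noteq> 0} \<subseteq> X"
    proof
      fix a assume a: "a \<in> {a\<in>A. c a \<noteq> 0}"
      show "a \<in> X"
      proof (rule ccontr)
        assume "a \<notin> X"
        then have "sum c (insert a X) = c a + sum c X" using X(1) by simp
        moreover have "sum c (insert a X) = t"
          using X a by (intro lim[rule_format]) auto
        moreover have "sum c X = t"
          using X by (intro lim[rule_format]) auto
        ultimately show False using a by simp
      qed
    qed
    have "sum c {a\<in>A. c a \<noteq> 0} = sum c X"
      by (rule sum.mono_neutral_left) (use X sub in auto)
    moreover have "sum c X = t"
      using X by (intro lim[rule_format]) auto
    ultimately show ?R using finite_subset[OF sub X(1)] by simp
  next
    assume R: ?R
    have conv: "sum c B = t" if "finite B" "{a\<in>A. c a \<noteq> 0} \<subseteq> B" "B \<subseteq> A" for B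
    proof -
      have "sum c {a\<in>A. c a \<noteq> 0} = sum c B"
        by (rule sum.mono_neutral_left) (use that in auto)
      then show ?thesis using R by simp
    qed
    show ?L
      unfolding eventually_finite_subsets_at_top
    proof (intro exI[of _ "{a\<in>A. c a \<noteq> 0}"] conjI allI impI)
      show "finite {a\<in>A. c a \<noteq> 0}" using R by blast
    next
      fix B assume "finite B \<and> {a\<in>A. c a \<noteq> 0} \<subseteq> B \<and> B \<subseteq> A"
      then show "sum c B = t" by (intro conv) blast+
    qed blast
  qed
  then show ?thesis
    unfolding has_sum_def tendsto_mfps_iff mfps_coeff_sum by simp
qed

definition mfps_const :: "'a::comm_ring_1 \<Rightarrow> 'a mfps" where
  "mfps_const c = Abs_mfps (\<lambda>m. if m = 0 then c else 0)"

definition mfps_var :: "nat \<Rightarrow> 'a::comm_ring_1 mfps" where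
  "mfps_var i = Abs_mfps (\<lambda>m. if m = Poly_Mapping.single i 1 then 1 else 0)"

definition mfps_map :: "('a \<Rightarrow> 'b) \<Rightarrow> 'a mfps \<Rightarrow> 'b mfps" where
  "mfps_map h f = Abs_mfps (\<lambda>m. h (mfps_coeff f m))"

text \<open>\<open>g(x\<^sub>i)\<close> for a univariate polynomial, resp. formal power series, \<open>g\<close>.\<close>

definition poly_at_var :: "'a::comm_ring_1 poly \<Rightarrow> nat \<Rightarrow> 'a mpoly" where
  "poly_at_var p i = poly (map_poly mpoly_const p) (mpoly_var i)"

definition fps_at_var :: "'a::comm_ring_1 fps \<Rightarrow> nat \<Rightarrow> 'a mfps" where
  "fps_at_var g i = Abs_mfps (\<lambda>m. if vars m \<subseteq> {i} then fps_nth g (expo m i) else 0)"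

text \<open>Exact quotient in an integral domain, used only where \<open>b \<noteq> 0\<close> divides \<open>a\<close>.\<close>

definition exact_div :: "'a::idom \<Rightarrow> 'a \<Rightarrow> 'a" where
  "exact_div a b = (THE c. c * b = a)"

lemma exact_div_eqI: "b \<noteq> 0 \<Longrightarrow> c * b = a \<Longrightarrow> exact_div a b = c"
  unfolding exact_div_def by (rule the_equality) auto


section \<open>Admissible sequences and their duals\<close>

definition admissible :: "(nat \<Rightarrow> 'a::field_char_0 poly) \<Rightarrow> bool" where
  "admissible f \<longleftrightarrow> f 0 = 1 \<and> (\<forall>d\<ge>1. degree (f d) = d)"

text \<open>The identity holds in \<open>K[u][[v]]\<close>, where \<open>u = [:0, 1:]\<close> and \<open>v = fps_X\<close>.\<close>

definition is_dual :: "(nat \<Rightarrow> 'a::field_char_0 poly) \<Rightarrow> (nat \<Rightarrow> 'a fps) \<Rightarrow> bool" where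
  "is_dual f g \<longleftrightarrow>
     (\<forall>d. g d \<noteq> 0 \<and> subdegree (g d) = d) \<and>
     (\<lambda>k. fps_const (f k) * Abs_fps (\<lambda>i. [:fps_nth (g k) i:])) sums
       exact_div (1 + fps_const [:0, 1:] * fps_X) (1 - fps_const [:0, 1:] * fps_X)"

definition dual :: "(nat \<Rightarrow> 'a::field_char_0 poly) \<Rightarrow> nat \<Rightarrow> 'a fps" where
  "dual f = (THE g. is_dual f g)"

text \<open>Comparing coefficients of \<open>v\<^sup>i\<close>; existence and uniqueness of the dual follow since \<open>f\<^sub>0, \<dots>, f\<^sub>i\<close>
  is a basis of the polynomials of degree at most \<open>i\<close>.\<close>

lemma kernel_eq:
  "exact_div (1 + fps_const [:0, 1:] * fps_X) (1 - fps_const [:0, 1:] * fps_X) =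
   Abs_fps (\<lambda>i. monom (if i = 0 then 1 else 2 :: 'a::field_char_0) i)"
proof (rule exact_div_eqI)
  let ?u = "[:0, 1:] :: 'a poly"
  let ?s = "\<lambda>i. if i = 0 then 1 else 2 :: 'a"
  have "fps_nth (1 - fps_const ?u * fps_X) 0 \<noteq> 0" by simp
  then show "1 - fps_const ?u * fps_X \<noteq> 0" by force
  have expand: "S * (1 - c * x) = S - x * (c * S)" for S c x :: "'a poly fps"
    by (simp add: algebra_simps)
  show "Abs_fps (\<lambda>i. monom (?s i) i) * (1 - fps_const ?u * fps_X) = 1 + fps_const ?u * fps_X"
  proof (rule fps_ext)
    fix n
    have "fps_nth (Abs_fps (\<lambda>i. monom (?s i) i) * (1 - fps_const ?u * fps_X)) n
        = fps_nth (Abs_fps (\<lambda>i. monom (?s i) i)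
            - fps_X * (fps_const ?u * Abs_fps (\<lambda>i. monom (?s i) i))) n"
      by (simp only: expand)
    also have "\<dots> = monom (?s n) n - (if n = 0 then 0 else ?u * monom (?s (n - 1)) (n - 1))"
      by simp
    also have "\<dots> = fps_nth (1 + fps_const ?u * fps_X) n"
    proof (cases n)
      case 0
      then show ?thesis by simp
    next
      case (Suc m)
      then show ?thesis
        by (cases m) (simp_all add: monom_Suc monom_0)
    qed
    finally show "fps_nth (Abs_fps (\<lambda>i. monom (?s i) i) * (1 - fps_const ?u * fps_X)) n
        = fps_nth (1 + fps_const ?u * fps_X) n" .
  qed
qed

lemma is_dual_iff:
  "is_dual f g \<longleftrightarrow>
     (\<forall>d. g d \<noteq> 0 \<and> subdegree (g d) = d) \<and>
     (\<forall>i. (\<Sum>k\<le>i. Polynomial.smult (fps_nth (g k) i) (f k)) = monom (if i = 0 then 1 else 2) i)"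
proof -
  have "(\<lambda>k. fps_const (f k) * Abs_fps (\<lambda>i. [:fps_nth (g k) i:])) sums
          Abs_fps (\<lambda>i. monom (if i = 0 then 1 else 2) i) \<longleftrightarrow>
        (\<forall>i. (\<Sum>k\<le>i. Polynomial.smult (fps_nth (g k) i) (f k)) = monom (if i = 0 then 1 else 2) i)"
    if sub: "\<And>d. subdegree (g d) = d"
  proof -
    have part: "fps_nth (\<Sum>k<n. fps_const (f k) * Abs_fps (\<lambda>i. [:fps_nth (g k) i:])) i
        = (\<Sum>k\<le>i. Polynomial.smult (fps_nth (g k) i) (f k))" if "n > i" for n i
    proof -
      have "fps_nth (\<Sum>k<n. fps_const (f k) * Abs_fps (\<lambda>i. [:fps_nth (g k) i:])) i
          = (\<Sum>k<n. Polynomial.smult (fps_nth (g k) i) (f k))"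
        by (simp add: fps_sum_nth)
      also have "\<dots> = (\<Sum>k\<le>i. Polynomial.smult (fps_nth (g k) i) (f k))"
        using that by (intro sum.mono_neutral_right) (auto simp: sub nth_less_subdegree_zero)
      finally show ?thesis .
    qed
    have ev: "(\<forall>\<^sub>F n in sequentially. fps_nth (\<Sum>k<n. fps_const (f k) * Abs_fps (\<lambda>i. [:fps_nth (g k) i:])) i = c)
        \<longleftrightarrow> (\<Sum>k\<le>i. Polynomial.smult (fps_nth (g k) i) (f k)) = c" for i c
    proof -
      have "(\<forall>\<^sub>F n in sequentially. fps_nth (\<Sum>k<n. fps_const (f k) * Abs_fps (\<lambda>i. [:fps_nth (g k) i:])) i = c)
        \<longleftrightarrow> (\<forall>\<^sub>F n::nat in sequentially. (\<Sum>k\<le>i. Polynomial.smult (fps_nth (g k) i) (f k)) = c)"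
        by (rule eventually_cong[OF eventually_gt_at_top[of i]]) (simp add: part)
      then show ?thesis by simp
    qed
    show ?thesis
      unfolding sums_def tendsto_fps_iff ev by simp
  qed
  then show ?thesis unfolding is_dual_def kernel_eq by blast
qed

lemma admissible_nonzero: "admissible f \<Longrightarrow> f k \<noteq> 0"
  unfolding admissible_def by (cases "k = 0") (auto dest!: spec[of _ k])

lemma admissible_degree: "admissible f \<Longrightarrow> degree (f k) = k"
  unfolding admissible_def by (cases k) auto

lemma admissible_expand:
  assumes "admissible f" "degree p \<le> n"
  shows "\<exists>c. (\<Sum>k\<le>n. Polynomial.smult (c k) (f k)) = p \<and> c n = coeff p n / lead_coeff (f n)"
  using assms(2)
proof (induction n arbitrary: p)
  case 0
  then obtain a where "p = [:a:]" by (metis degree_eq_zeroE le_zero_eq)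
  then show ?case using assms(1)
    by (intro exI[of _ "\<lambda>_. a"]) (auto simp: admissible_def)
next
  case (Suc n)
  let ?a = "coeff p (Suc n) / lead_coeff (f (Suc n))"
  let ?q = "p - Polynomial.smult ?a (f (Suc n))"
  have lc: "coeff (f (Suc n)) (Suc n) \<noteq> 0"
    using admissible_degree[OF assms(1), of "Suc n"] admissible_nonzero[OF assms(1), of "Suc n"]
    by (metis leading_coeff_0_iff)
  have "degree ?q \<le> n"
  proof (rule degree_le, clarify)
    fix i assume "n < i"
    then consider "i = Suc n" | "i > Suc n" by linarith
    then show "coeff ?q i = 0"
      using Suc.prems lc admissible_degree[OF assms(1), of "Suc n"]
      by cases (auto simp: coeff_eq_0)
  qed
  from Suc.IH[OF this] obtain c where c: "(\<Sum>k\<le>n. Polynomial.smult (c k) (f k)) = ?q" by blast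
  have "(\<Sum>k\<le>n. Polynomial.smult ((c(Suc n := ?a)) k) (f k)) = (\<Sum>k\<le>n. Polynomial.smult (c k) (f k))"
    by (intro sum.cong) auto
  then show ?case using c
    by (intro exI[of _ "c(Suc n := ?a)"]) simp
qed

lemma admissible_independent:
  assumes "admissible f" "(\<Sum>k\<le>n. Polynomial.smult (c k) (f k)) = 0" "k \<le> n"
  shows "c k = 0"
  using assms(2,3)
proof (induction n)
  case 0
  then show ?case using admissible_nonzero[OF assms(1)] by auto
next
  case (Suc n)
  have "coeff (\<Sum>k\<le>n. Polynomial.smult (c k) (f k)) (Suc n) = 0"
    unfolding coeff_sum
    by (intro sum.neutral) (auto simp: coeff_eq_0 admissible_degree[OF assms(1)])
  moreover have "coeff (\<Sum>k\<le>Suc n. Polynomial.smult (c k) (f k)) (Suc n) = 0"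
    using Suc.prems(1) by simp
  ultimately have "c (Suc n) * coeff (f (Suc n)) (Suc n) = 0" by simp
  then have top: "c (Suc n) = 0"
    using admissible_degree[OF assms(1), of "Suc n"] admissible_nonzero[OF assms(1), of "Suc n"]
    by (metis leading_coeff_0_iff mult_eq_0_iff)
  then show ?case using Suc by (cases "k = Suc n") auto
qed

lemma ex1_dual:
  assumes f: "admissible f"
  shows "\<exists>!g. is_dual f g"
proof -
  let ?s = "\<lambda>i. if i = 0 then 1 else 2 :: 'a"
  have "\<exists>c. (\<Sum>k\<le>i. Polynomial.smult (c k) (f k)) = monom (?s i) i \<and> c i \<noteq> 0" for i
  proof -
    obtain c where "(\<Sum>k\<le>i. Polynomial.smult (c k) (f k)) = monom (?s i) i"
        "c i = coeff (monom (?s i) i) i / lead_coeff (f i)"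
      using admissible_expand[OF f degree_monom_le] by blast
    moreover from this(2) have "c i \<noteq> 0"
      using admissible_nonzero[OF f, of i] by simp
    ultimately show ?thesis by blast
  qed
  then obtain C where C: "(\<Sum>k\<le>i. Polynomial.smult (C i k) (f k)) = monom (?s i) i" "C i i \<noteq> 0" for i
    by metis
  let ?g = "\<lambda>k. Abs_fps (\<lambda>i. if k \<le> i then C i k else 0)"
  have "subdegree (?g d) = d" for d
    using C(2) by (intro subdegreeI) auto
  moreover have "?g d \<noteq> 0" for d
  proof -
    have "fps_nth (?g d) d \<noteq> 0" using C(2) by simp
    then show ?thesis by force
  qed
  moreover have "(\<Sum>k\<le>i. Polynomial.smult (fps_nth (?g k) i) (f k)) = monom (?s i) i" for i
    unfolding C(1)[of i, symmetric] by (intro sum.cong) auto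
  ultimately have g: "is_dual f ?g" unfolding is_dual_iff by blast
  have "h = ?g" if h: "is_dual f h" for h
  proof (intro ext fps_ext)
    fix k i
    show "fps_nth (h k) i = fps_nth (?g k) i"
    proof (cases "k \<le> i")
      case True
      have "(\<Sum>k\<le>i. Polynomial.smult (fps_nth (h k) i - C i k) (f k)) = 0"
        using h C(1)[of i] unfolding is_dual_iff by (simp add: smult_diff_left sum_subtractf)
      from admissible_independent[OF f this True] True show ?thesis by simp
    next
      case False
      moreover have "subdegree (h k) = k" using h unfolding is_dual_iff by blast
      ultimately have "fps_nth (h k) i = 0" by (intro nth_less_subdegree_zero) linarith
      with False show ?thesis by simp
    qed
  qed
  with g show ?thesis by (rule ex1I)
qed

lemma is_dual_dual: "admissible f \<Longrightarrow> is_dual f (dual f)"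
  unfolding dual_def by (rule theI'[OF ex1_dual])


section \<open>Pfaffians\<close>

text \<open>The sum over permutations with \<open>\<sigma>(2i) < \<sigma>(2i+1)\<close> and \<open>\<sigma>(0) < \<sigma>(2) < \<dots>\<close> is the sum over
  perfect matchings. Only skew-symmetric matrices are of interest.\<close>

definition pfaffian :: "'a::comm_ring_1 mat \<Rightarrow> 'a" where
  "pfaffian M =
     (if even (dim_row M) then
        (\<Sum>\<sigma> | \<sigma> permutes {..<dim_row M} \<and>
               (\<forall>i < dim_row M div 2. \<sigma> (2 * i) < \<sigma> (2 * i + 1)) \<and>
               (\<forall>i j. i < j \<and> j < dim_row M div 2 \<longrightarrow> \<sigma> (2 * i) < \<sigma> (2 * j)).
           of_int (sign \<sigma>) * (\<Prod>i < dim_row M div 2. M $$ (\<sigma> (2 * i), \<sigma> (2 * i + 1))))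
      else 0)"


section \<open>Generalized \<open>P\<close>-functions\<close>

definition strict_partition :: "nat list \<Rightarrow> bool" where
  "strict_partition l \<longleftrightarrow> sorted_wrt (>) l \<and> 0 \<notin> set l"

definition star :: "nat \<Rightarrow> nat list \<Rightarrow> nat list" where
  "star n l = (if even (n + length l) then l else l @ [0])"

definition A_mat :: "nat \<Rightarrow> (nat \<Rightarrow> 'a::field) \<Rightarrow> 'a mat" where
  "A_mat n x = mat n n (\<lambda>(i, j). (x j - x i) / (x j + x i))"

definition Delta :: "nat \<Rightarrow> (nat \<Rightarrow> 'a::field) \<Rightarrow> 'a" where
  "Delta n x = (\<Prod>(i, j) \<in> {(i, j). i < j \<and> j < n}. (x j - x i) / (x j + x i))"

definition V_mat :: "nat \<Rightarrow> (nat \<Rightarrow> nat \<Rightarrow> 'a) \<Rightarrow> nat list \<Rightarrow> 'a mat" where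
  "V_mat n F \<alpha> = mat n (length \<alpha>) (\<lambda>(i, j). F (\<alpha> ! j) i)"

text \<open>Here \<open>F d i\<close> is the value of the \<open>d\<close>-th member of the sequence at \<open>x\<^sub>i\<close>.\<close>

definition P_frac :: "nat \<Rightarrow> (nat \<Rightarrow> 'a::field) \<Rightarrow> (nat \<Rightarrow> nat \<Rightarrow> 'a) \<Rightarrow> nat list \<Rightarrow> 'a" where
  "P_frac n x F l =
     (let V = V_mat n F (star n l); r = length (star n l) in
      1 / Delta n x * pfaffian (four_block_mat (A_mat n x) V (- transpose_mat V) (0\<^sub>m r r)))"

text \<open>The quotients defining the \<open>P\<close>-functions are formed in the field of fractions of the
  polynomial, resp. power series, ring; they lie in the ring itself, and the functions are taken
  as elements of it.\<close>

definition of_fract :: "'a::idom fract \<Rightarrow> 'a" where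
  "of_fract z = (THE p. to_fract p = z)"

lemma of_fract_to_fract [simp]: "of_fract (to_fract p) = p"
  by (simp add: of_fract_def)

definition P_fun :: "(nat \<Rightarrow> 'a::field_char_0 poly) \<Rightarrow> nat \<Rightarrow> nat list \<Rightarrow> 'a mpoly" where
  "P_fun f n l = of_fract (P_frac n (\<lambda>i. to_fract (mpoly_var i))
                                    (\<lambda>d i. to_fract (poly_at_var (f d) i)) l)"

definition dual_P_fun :: "(nat \<Rightarrow> 'a::field_char_0 poly) \<Rightarrow> nat \<Rightarrow> nat list \<Rightarrow> 'a mfps" where
  "dual_P_fun f n l = of_fract (P_frac n (\<lambda>i. to_fract (mfps_var i))
                                         (\<lambda>d i. to_fract (fps_at_var (dual f d) i)) l)"

end

theory Submission
  imports Defs "HOL-Computational_Algebra.Polynomial_FPS" "Jordan_Normal_Form.Determinant"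
begin

text \<open>
  The vector \<open>\<lambda>\<^sup>*\<close> is determined by its set \<open>J\<close> of entries, and \<open>J\<close> runs over all finite sets of
  natural numbers whose cardinality has the parity of \<open>n\<close>. Up to the factor
  \<open>1 / (\<Delta>(x) \<Delta>(y))\<close> the left-hand side is therefore the sum over \<open>J\<close> of
  \<open>Pf(A(x), V\<^sub>J(x)) Pf(A(y), W\<^sub>J(y))\<close>, where \<open>Pf(A, V)\<close> denotes the Pfaffian with blocks
  \<open>A, V, -V\<^sup>T, 0\<close>. A Cauchy-Binet formula for such Pfaffians (\<open>pf_cauchy_binet\<close>) collapses
  the part of this sum with \<open>J \<subseteq> {0..N}\<close> to a single Pfaffian of size \<open>2n\<close>: its diagonal blocks are
  \<open>A(x)\<close> and \<open>A(y)\<close>, the latter with the order of the variables reversed, and its off-diagonal block has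
  the entries \<open>\<Sum>k\<le>N. f\<^sub>k(x\<^sub>i) g\<^sub>k(y\<^sub>j)\<close>, where \<open>g\<close> is the dual of \<open>f\<close>. These tend to
  \<open>(1 + x\<^sub>i y\<^sub>j) / (1 - x\<^sub>i y\<^sub>j)\<close>, by the definition of the dual. With \<open>z\<^sub>j = -1 / y\<^sub>j\<close> the limit is
  \<open>(z\<^sub>j - x\<^sub>i) / (z\<^sub>j + x\<^sub>i)\<close>, and likewise the two diagonal blocks are of this shape. So the
  limiting matrix is Schur's matrix \<open>((t\<^sub>j - t\<^sub>i) / (t\<^sub>j + t\<^sub>i))\<close> for the \<open>2n\<close> variables \<open>x\<close> and \<open>z\<close>,
  and Schur's evaluation of its Pfaffian as \<open>\<Prod>i<j. (t\<^sub>j - t\<^sub>i) / (t\<^sub>j + t\<^sub>i)\<close> (\<open>schur_pfaffian\<close>) yields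
  \<open>\<Delta>(x) \<Delta>(y)\<close> times the Cauchy product (\<open>pf_kernel\<close>).

  Two further points have to be settled. First, the \<open>P\<close>-functions are fractions, and one has to
  know that they lie in the polynomial, resp. power series, ring. The factors \<open>x\<^sub>i + x\<^sub>j\<close> of \<open>1 / \<Delta>\<close>
  cancel the denominators of the Pfaffian; the differences \<open>x\<^sub>d - x\<^sub>c\<close> divide it, since it
  vanishes for \<open>x\<^sub>c = x\<^sub>d\<close> because two of its rows become equal (\<open>P_frac_integral\<close>). Secondly, the limit
  \<open>N \<rightarrow> \<infinity>\<close> is taken inside a field of fractions, where there are no coefficients to compare. It is
  controlled by the valuation extending the order of a power series in the \<open>y\<close>-variables:
  the entries \<open>(y\<^sub>j - y\<^sub>i) / (y\<^sub>j + y\<^sub>i)\<close> and the quotient \<open>1 / \<Delta>(y)\<close> have nonnegative valuation,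
  \<open>g\<^sub>k(y\<^sub>j)\<close> has valuation at least \<open>k\<close>, and hence the sum over \<open>J \<subseteq> {0..N}\<close> differs from the product
  by something of order greater than \<open>N\<close> (\<open>partial_sum_order\<close>).
\<close>

section \<open>Pfaffians indexed by lists\<close>

definition del :: "nat \<Rightarrow> 'l list \<Rightarrow> 'l list" where
  "del i L = take i L @ drop (Suc i) L"

lemma length_del [simp]: "i < length L \<Longrightarrow> length (del i L) = length L - 1"
  by (simp add: del_def)

lemma del_Cons_0 [simp]: "del 0 (a # L) = L"
  and del_Cons_Suc [simp]: "del (Suc i) (a # L) = a # del i L"
  by (simp_all add: del_def)

text \<open>
  Expansions along a row are alternating sums over the ways of removing one entry from a
  list. They satisfy simple recursions in the list (\<open>alt_sum_Cons\<close>, \<open>alt_sum_append\<close>), which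
  replace most manipulations of positions and signs in the proofs below.
\<close>

definition alt_sum :: "('l \<Rightarrow> 'l list \<Rightarrow> 'a::comm_ring_1) \<Rightarrow> 'l list \<Rightarrow> 'a" where
  "alt_sum \<phi> L = (\<Sum>i<length L. (-1) ^ i * \<phi> (L ! i) (del i L))"

lemma alt_sum_Nil [simp]: "alt_sum \<phi> [] = 0"
  by (simp add: alt_sum_def)

lemma alt_sum_Cons [simp]: "alt_sum \<phi> (a # L) = \<phi> a L - alt_sum (\<lambda>x M. \<phi> x (a # M)) L"
  unfolding alt_sum_def length_Cons sum.lessThan_Suc_shift by (simp add: sum_negf)

lemma alt_sum_cong:
  assumes "\<And>A x B. L = A @ x # B \<Longrightarrow> \<phi> x (A @ B) = \<psi> x (A @ B)"
  shows "alt_sum \<phi> L = alt_sum \<psi> L"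
  unfolding alt_sum_def
proof (intro sum.cong refl)
  fix i assume i: "i \<in> {..<length L}"
  have "\<phi> (L ! i) (del i L) = \<psi> (L ! i) (del i L)"
    unfolding del_def using i by (intro assms) (simp add: id_take_nth_drop)
  then show "(-1) ^ i * \<phi> (L ! i) (del i L) = (-1) ^ i * \<psi> (L ! i) (del i L)" by simp
qed

lemma alt_sum_append:
  "alt_sum \<phi> (A @ B) = alt_sum (\<lambda>x M. \<phi> x (M @ B)) A + (-1) ^ length A * alt_sum (\<lambda>x M. \<phi> x (A @ M)) B"
  by (induction A arbitrary: \<phi>) (simp_all add: algebra_simps)

lemma alt_sum_scale: "alt_sum (\<lambda>x M. c * \<phi> x M) L = c * alt_sum \<phi> L"
  by (simp add: alt_sum_def sum_distrib_left mult.left_commute)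

lemma alt_sum_scale_fun: "(\<lambda>M. c * alt_sum \<phi> M) = alt_sum (\<lambda>x M. c * \<phi> x M)"
  by (intro ext) (simp only: alt_sum_scale)

lemma alt_sum_scale_right: "alt_sum (\<lambda>x M. \<phi> x M * c) L = alt_sum \<phi> L * c"
  by (simp add: alt_sum_def sum_distrib_right mult.assoc)

lemma alt_sum_minus: "alt_sum (\<lambda>x M. - \<phi> x M) L = - alt_sum \<phi> L"
  by (simp add: alt_sum_def sum_negf)

lemma alt_sum_diff: "alt_sum (\<lambda>x M. \<phi> x M - \<psi> x M) L = alt_sum \<phi> L - alt_sum \<psi> L"
  by (simp add: alt_sum_def algebra_simps sum_subtractf)

lemma alt_sum_0 [simp]: "alt_sum (\<lambda>x M. 0) L = 0"
  by (simp add: alt_sum_def)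

lemma alt_sum_sum: "alt_sum (\<lambda>x M. \<Sum>i\<in>I. \<phi> i x M) L = (\<Sum>i\<in>I. alt_sum (\<phi> i) L)"
  unfolding alt_sum_def sum_distrib_left by (rule sum.swap)

lemma alt_sum_map: "alt_sum \<phi> (map g L) = alt_sum (\<lambda>x M. \<phi> (g x) (map g M)) L"
  by (induction L arbitrary: \<phi>) simp_all

lemma alt_sum_rev:
  "alt_sum \<phi> (rev L) = - ((-1) ^ length L * alt_sum (\<lambda>x M. \<phi> x (rev M)) L)"
  by (induction L arbitrary: \<phi>) (simp_all add: alt_sum_append algebra_simps)

text \<open>
  Removing two entries one after the other in the opposite order changes the sign. This is what
  makes Pfaffians skew-symmetric.
\<close>

lemma alt_sum_antisym:
  "alt_sum (\<lambda>x. alt_sum (\<lambda>y. \<phi> x y)) L = - alt_sum (\<lambda>x. alt_sum (\<lambda>y. \<phi> y x)) L"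
proof (induction L arbitrary: \<phi>)
  case (Cons c L)
  show ?case
    using Cons.IH[of "\<lambda>x y M. \<phi> x y (c # M)"] by (simp add: alt_sum_diff)
qed simp

lemma alt_sum_symmetric_eq_0:
  assumes "\<And>x y M. \<phi> x y M = \<phi> y x M"
  shows "alt_sum (\<lambda>x. alt_sum (\<lambda>y. \<phi> x y)) L = 0"
  using assms
proof (induction L arbitrary: \<phi>)
  case (Cons c L)
  have "alt_sum (\<lambda>x. alt_sum (\<lambda>y M. \<phi> x y (c # M))) L = 0"
    by (rule Cons.IH) (rule Cons.prems)
  moreover have "\<phi> c = (\<lambda>x. \<phi> x c)" by (intro ext Cons.prems)
  ultimately show ?case by (simp add: alt_sum_diff)
qed simp

text \<open>
  The Pfaffian of the submatrix of \<open>w\<close> with rows and columns in the order given by the list, computed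
  by expansion along the first row. Lists of arbitrary labels make it possible to delete, permute and repeat
  rows without renumbering.
\<close>

fun pf :: "('l \<Rightarrow> 'l \<Rightarrow> 'a::comm_ring_1) \<Rightarrow> 'l list \<Rightarrow> 'a" where
  "pf w [] = 1"
| "pf w (a # L) = (\<Sum>i<length L. (-1) ^ i * (w a (L ! i) * pf w (del i L)))"

lemma pf_Cons: "pf w (a # L) = alt_sum (\<lambda>x M. w a x * pf w M) L"
  by (simp add: alt_sum_def)

declare pf.simps(2) [simp del]

lemma list_length_induct [case_names less]:
  assumes "\<And>L. (\<And>M. length M < length L \<Longrightarrow> P M) \<Longrightarrow> P L"
  shows "P (L :: 'l list)"
  using assms by (rule length_induct) blast

lemma pf_map: "pf w (map g L) = pf (\<lambda>x y. w (g x) (g y)) L"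
proof (induction L rule: list_length_induct)
  case (less L)
  show ?case
  proof (cases L)
    case (Cons a L')
    then show ?thesis
      unfolding Cons list.map pf_Cons alt_sum_map
      by (intro alt_sum_cong arg_cong2[of _ _ _ _ "(*)"] less.IH refl) (simp add: Cons)
  qed simp
qed

lemma pf_cong:
  assumes "\<And>x y. x \<in> set L \<Longrightarrow> y \<in> set L \<Longrightarrow> w x y = w' x y"
  shows "pf w L = pf w' L"
  using assms
proof (induction L rule: list_length_induct)
  case (less L)
  show ?case
  proof (cases L)
    case (Cons a L')
    show ?thesis
      unfolding Cons pf_Cons using less.prems
      by (intro alt_sum_cong arg_cong2[of _ _ _ _ "(*)"] less.IH) (auto simp: Cons)
  qed simp
qed

lemma pf_odd: "odd (length L) \<Longrightarrow> pf w L = 0"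
proof (induction L rule: list_length_induct)
  case (less L)
  from less.prems obtain a L' where L: "L = a # L'" by (cases L) auto
  have "alt_sum (\<lambda>x M. w a x * pf w M) L' = alt_sum (\<lambda>x M. 0) L'"
    using less.prems by (intro alt_sum_cong) (subst less.IH, simp_all add: L)
  then show ?case by (simp add: L pf_Cons)
qed

lemma (in comm_ring_hom) hom_pf: "hom (pf w L) = pf (\<lambda>x y. hom (w x y)) L"
proof (induction L rule: list_length_induct)
  case (less L)
  show ?case
    by (cases L) (simp_all add: pf.simps hom_distribs less.IH)
qed

lemma pf_scale:
  assumes "even (length L)"
  shows "pf (\<lambda>x y. c * w x y) L = c ^ (length L div 2) * pf w L"
  using assms
proof (induction L rule: list_length_induct)
  case (less L)
  show ?case
  proof (cases L)
    case (Cons a L')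
    from less.prems obtain k where k: "length L' = Suc (2 * k)" by (auto simp: Cons elim!: oddE)
    have "pf (\<lambda>x y. c * w x y) (a # L') = alt_sum (\<lambda>x M. c ^ Suc k * (w a x * pf w M)) L'"
      unfolding pf_Cons
      by (rule alt_sum_cong) (use k in \<open>simp add: less.IH Cons\<close>)
    then show ?thesis
      by (simp add: Cons pf_Cons alt_sum_scale k)
  qed simp
qed

locale skew =
  fixes w :: "'l \<Rightarrow> 'l \<Rightarrow> 'a::comm_ring_1"
  assumes skew: "w x y = - w y x" and diag: "w x x = 0"
begin

lemma pf_swap_front: "pf w (a # b # M) = - pf w (b # a # M)"
proof -
  have two: "pf w (a # b # M) =
      w a b * pf w M - alt_sum (\<lambda>x. alt_sum (\<lambda>y N. w a x * (w b y * pf w N))) M" for a b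
    by (simp add: pf_Cons alt_sum_scale_fun)
  have "w a y * (w b x * c) = w b x * (w a y * c)" for x y c
    by (rule mult.left_commute)
  then have "alt_sum (\<lambda>x. alt_sum (\<lambda>y N. w a x * (w b y * pf w N))) M
      = - alt_sum (\<lambda>x. alt_sum (\<lambda>y N. w b x * (w a y * pf w N))) M"
    by (subst alt_sum_antisym) (simp only:)
  then show ?thesis
    unfolding two[of a b] two[of b a] skew[of a b] by simp
qed

lemma pf_swap: "pf w (A @ a # b # B) = - pf w (A @ b # a # B)"
proof (induction A arbitrary: B rule: list_length_induct)
  case (less A)
  show ?case
  proof (cases A)
    case Nil
    then show ?thesis using pf_swap_front[of a b B] by simp
  next
    case (Cons c A')
    have 1: "alt_sum (\<lambda>x M. w c x * pf w (M @ a # b # B)) A' =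
        alt_sum (\<lambda>x M. - (w c x * pf w (M @ b # a # B))) A'"
      by (rule alt_sum_cong) (subst less.IH, simp_all add: Cons)
    have 2: "alt_sum (\<lambda>x M. w c x * pf w (A' @ a # b # M)) B =
        alt_sum (\<lambda>x M. - (w c x * pf w (A' @ b # a # M))) B"
      by (rule alt_sum_cong) (subst less.IH, simp_all add: Cons)
    show ?thesis
      unfolding Cons append_Cons pf_Cons alt_sum_append 1 alt_sum_Cons 2
      by (simp add: alt_sum_minus algebra_simps)
  qed
qed

lemma pf_move_front: "pf w (A @ a # B) = (-1) ^ length A * pf w (a # A @ B)"
proof (induction A arbitrary: B rule: rev_induct)
  case (snoc b A)
  have "pf w ((A @ [b]) @ a # B) = - pf w (A @ a # b # B)"
    using pf_swap[of A b a B] by simp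
  also have "\<dots> = - ((-1) ^ length A * pf w (a # A @ b # B))"
    by (simp add: snoc.IH)
  finally show ?case by simp
qed simp

lemma pf_front_pair: "pf w (a # a # M) = 0"
proof -
  have "alt_sum (\<lambda>x. alt_sum (\<lambda>y N. w a x * (w a y * pf w N))) M = 0"
    by (rule alt_sum_symmetric_eq_0) (rule mult.left_commute)
  then show ?thesis by (simp add: pf_Cons diag alt_sum_scale_fun)
qed

lemma pf_repeated: "pf w (A @ a # B @ a # C) = 0"
proof -
  have "pf w (A @ a # B @ a # C) = (-1) ^ length A * pf w ((a # A @ B) @ a # C)"
    using pf_move_front[of A a "B @ a # C"] by simp
  also have "pf w ((a # A @ B) @ a # C) = (-1) ^ length (a # A @ B) * pf w (a # (a # A @ B) @ C)"
    by (rule pf_move_front)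
  finally show ?thesis by (simp add: pf_front_pair)
qed

lemma pf_not_distinct:
  assumes "\<not> distinct L"
  shows "pf w L = 0"
proof -
  obtain A B C a where "L = A @ [a] @ B @ [a] @ C" using not_distinct_decomp[OF assms] by blast
  then show ?thesis using pf_repeated[of A a B C] by simp
qed

lemma pf_rev: "pf (\<lambda>x y. w y x) (rev L) = pf w L"
proof (induction L rule: list_length_induct)
  case (less L)
  interpret t: skew "\<lambda>x y. w y x"
    by unfold_locales (rule skew, rule diag)
  show ?case
  proof (cases L)
    case (Cons a L')
    have "alt_sum (\<lambda>x M. w x a * pf (\<lambda>x y. w y x) (rev M)) L' = alt_sum (\<lambda>x M. - (w a x * pf w M)) L'"
    proof (rule alt_sum_cong)
      fix A x B assume "L' = A @ x # B"
      then show "w x a * pf (\<lambda>x y. w y x) (rev (A @ B)) = - (w a x * pf w (A @ B))"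
        using less.IH[of "A @ B"] skew[of x a] by (simp add: Cons)
    qed
    moreover have "pf (\<lambda>x y. w y x) (rev L) = (-1) ^ length L' * pf (\<lambda>x y. w y x) (a # rev L')"
      using t.pf_move_front[of "rev L'" a "[]"] by (simp add: Cons)
    ultimately show ?thesis
      by (simp add: Cons pf_Cons alt_sum_rev alt_sum_minus flip: mult.assoc power_add)
  qed simp
qed

text \<open>
  Replacing the label \<open>d\<close> by \<open>c\<close> changes no entry of the matrix but creates a repeated label.
\<close>

lemma pf_equal_rows:
  assumes "\<And>z. w c z = w d z" "c \<noteq> d" "c \<in> set L" "d \<in> set L"
  shows "pf w L = 0"
proof -
  let ?g = "\<lambda>x. if x = d then c else x"
  have w: "w (?g x) (?g y) = w x y" for x y
    using assms(1) skew by (metis (full_types))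
  have "pf w (map ?g L) = pf w L" unfolding pf_map w ..
  moreover have "\<not> distinct (map ?g L)"
  proof -
    have "?g c = ?g d" by simp
    with assms(2-4) have "\<not> inj_on ?g (set L)" unfolding inj_on_def by blast
    then show ?thesis by (simp add: distinct_map)
  qed
  ultimately show ?thesis using pf_not_distinct by metis
qed

end

section \<open>A Cauchy-Binet formula for Pfaffians\<close>

fun block :: "('x \<Rightarrow> 'x \<Rightarrow> 'a) \<Rightarrow> ('x \<Rightarrow> 'k \<Rightarrow> 'a) \<Rightarrow> ('k \<Rightarrow> 'k \<Rightarrow> 'a) \<Rightarrow> 'x + 'k \<Rightarrow> 'x + 'k \<Rightarrow> 'a::comm_ring_1" where
  "block A V B (Inl x) (Inl y) = A x y"
| "block A V B (Inl x) (Inr k) = V x k"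
| "block A V B (Inr k) (Inl x) = - V x k"
| "block A V B (Inr k) (Inr l) = B k l"

lemma skew_block:
  assumes "skew A" "skew B"
  shows "skew (block A V B)"
proof
  fix x y
  show "block A V B x y = - block A V B y x"
    by (cases x; cases y; simp; rule skew.skew[OF assms(1)] skew.skew[OF assms(2)])
  show "block A V B x x = 0"
    by (cases x) (simp_all add: skew.diag[OF assms(1)] skew.diag[OF assms(2)])
qed

lemma skew_zero: "skew (\<lambda>x y. 0)"
  by (simp add: skew_def)

lemma distinct_del_conv_filter:
  assumes "distinct L" "i < length L"
  shows "del i L = filter (\<lambda>x. x \<noteq> L ! i) L"
proof -
  have L: "L = take i L @ L ! i # drop (Suc i) L" by (rule id_take_nth_drop[OF assms(2)])
  then have d: "distinct (take i L @ L ! i # drop (Suc i) L)" using assms(1) by simp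
  have "filter (\<lambda>x. x \<noteq> L ! i) L = filter (\<lambda>x. x \<noteq> L ! i) (take i L @ L ! i # drop (Suc i) L)"
    using L by simp
  also have "\<dots> = take i L @ drop (Suc i) L"
  proof -
    have "filter (\<lambda>x. x \<noteq> L ! i) (take i L) = take i L" "filter (\<lambda>x. x \<noteq> L ! i) (drop (Suc i) L) = drop (Suc i) L"
      using d by (auto intro!: filter_True)
    then show ?thesis by simp
  qed
  finally show ?thesis by (simp add: del_def)
qed

text \<open>
  In a product of an alternating sum and a Pfaffian over the same distinct labels, the sign of
  removing \<open>k\<close> from the first factor cancels against the sign of moving \<open>k\<close> to the front of the
  second one. So the terms no longer depend on positions, and one may sum over sets.
\<close>

lemma (in skew) alt_sum_mult_pf:
  assumes "distinct L"
  shows "alt_sum \<phi> L * pf w (Y @ map g L)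
    = (-1) ^ length Y * (\<Sum>k\<in>set L. \<phi> k (filter (\<lambda>x. x \<noteq> k) L) * pf w (g k # Y @ map g (filter (\<lambda>x. x \<noteq> k) L)))"
proof -
  have "alt_sum \<phi> L * pf w (Y @ map g L) = (\<Sum>i<length L. (-1) ^ i * \<phi> (L ! i) (del i L) * pf w (Y @ map g L))"
    by (simp add: alt_sum_def sum_distrib_right)
  also have "\<dots> = (\<Sum>i<length L. (-1) ^ length Y * (\<phi> (L ! i) (filter (\<lambda>x. x \<noteq> L ! i) L)
      * pf w (g (L ! i) # Y @ map g (filter (\<lambda>x. x \<noteq> L ! i) L))))"
  proof (intro sum.cong refl)
    fix i assume "i \<in> {..<length L}"
    then have i: "i < length L" by simp
    have "map g L = map g (take i L) @ g (L ! i) # map g (drop (Suc i) L)"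
      using arg_cong[OF id_take_nth_drop[OF i], of "map g"] by simp
    then have "pf w (Y @ map g L) = pf w ((Y @ map g (take i L)) @ g (L ! i) # map g (drop (Suc i) L))"
      by simp
    also have "\<dots> = (-1) ^ (length Y + i) * pf w (g (L ! i) # Y @ map g (del i L))"
      unfolding pf_move_front using i by (simp add: del_def)
    finally have "pf w (Y @ map g L) = (-1) ^ (length Y + i) * pf w (g (L ! i) # Y @ map g (del i L))" .
    then have "(-1) ^ i * \<phi> (L ! i) (del i L) * pf w (Y @ map g L) = (-1) ^ i * (-1) ^ i * ((-1) ^ length Y *
        (\<phi> (L ! i) (del i L) * pf w (g (L ! i) # Y @ map g (del i L))))"
      by (simp add: power_add mult_ac)
    also have "(-1) ^ i * (-1) ^ i = (1 :: 'a)"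
      by (simp flip: power_mult_distrib)
    finally show "(-1) ^ i * \<phi> (L ! i) (del i L) * pf w (Y @ map g L) = (-1) ^ length Y *
        (\<phi> (L ! i) (filter (\<lambda>x. x \<noteq> L ! i) L) * pf w (g (L ! i) # Y @ map g (filter (\<lambda>x. x \<noteq> L ! i) L)))"
      by (simp add: distinct_del_conv_filter[OF assms i])
  qed
  also have "\<dots> = (\<Sum>k\<in>set L. (-1) ^ length Y * (\<phi> k (filter (\<lambda>x. x \<noteq> k) L) * pf w (g k # Y @ map g (filter (\<lambda>x. x \<noteq> k) L))))"
    using bij_betw_nth[OF assms refl refl] by (rule sum.reindex_bij_betw)
  finally show ?thesis by (simp add: sum_distrib_left)
qed

text \<open>
  Induction on \<open>X\<close>, expanding the first factor along its first row. The terms that remove a label \<open>x'\<close> of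
  \<open>X\<close> are of the same shape with a shorter \<open>X\<close>. In the terms that remove a column label \<open>k \<in> J\<close>, this \<open>k\<close> is
  moved to the front of the second factor, which is then expanded along the row of \<open>k\<close>; as the block of
  column labels vanishes, this only removes labels \<open>y\<close> of \<open>Y\<close>, with coefficient \<open>V x k * W y k\<close>. Together these are
  the two kinds of terms in the first-row expansion of the right-hand side. The reversal of \<open>Y\<close>
  accounts for the sign of removing \<open>y\<close>. If \<open>X\<close> is empty, only \<open>J = {}\<close> contributes, and
  the claim is \<open>pf_rev\<close>: reversing the labels and transposing the matrix preserves the Pfaffian.
\<close>

theorem pf_cauchy_binet:
  fixes A :: "'x \<Rightarrow> 'x \<Rightarrow> 'a::comm_ring_1" and B :: "'y \<Rightarrow> 'y \<Rightarrow> 'a"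
    and V :: "'x \<Rightarrow> 'k \<Rightarrow> 'a" and W :: "'y \<Rightarrow> 'k \<Rightarrow> 'a"
  assumes B: "skew B" and K: "distinct K"
  defines "Z \<equiv> (\<lambda>_ _. 0)"
  shows "(\<Sum>J\<in>Pow (set K). pf (block A V Z) (map Inl X @ map Inr (filter (\<lambda>k. k \<in> J) K))
                       * pf (block B W Z) (map Inl Y @ map Inr (filter (\<lambda>k. k \<in> J) K)))
    = pf (block A (\<lambda>x y. \<Sum>k\<in>set K. V x k * W y k) (\<lambda>y z. B z y)) (map Inl X @ map Inr (rev Y))"
    (is "?F X Y = ?G X Y")
proof (induction X arbitrary: Y rule: list_length_induct)
  case (less X)
  let ?v = "block A V Z" and ?w = "block B W Z"
  let ?S = "\<lambda>x y. \<Sum>k\<in>set K. V x k * W y k"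
  let ?l = "\<lambda>J. filter (\<lambda>k. k \<in> J) K"
  interpret B: skew B by fact
  interpret w: skew ?w unfolding Z_def by (rule skew_block[OF B skew_zero])
  show ?case
  proof (cases X)
    case Nil
    have "pf ?v (map Inl X @ map Inr (?l J)) * pf ?w (map Inl Y @ map Inr (?l J)) = 0"
      if J: "J \<in> Pow (set K) - {{}}" for J
    proof -
      have "?l J \<noteq> []" using J by (auto simp: filter_empty_conv)
      then obtain k M where "?l J = k # M" by (cases "?l J") auto
      then show ?thesis by (simp add: Nil pf_Cons alt_sum_map Z_def)
    qed
    then have "?F X Y = (\<Sum>J\<in>{{}}. pf ?v (map Inl X @ map Inr (?l J)) * pf ?w (map Inl Y @ map Inr (?l J)))"
      by (intro sum.mono_neutral_right) auto
    then show ?thesis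
      by (simp add: Nil pf_map B.pf_rev)
  next
    case (Cons x X')
    let ?s = "(-1) ^ length X' :: 'a"
    let ?t = "\<lambda>k J. V x k * pf ?v (map Inl X' @ map Inr (?l J)) * pf ?w (Inr k # map Inl Y @ map Inr (?l J))"
    \<comment> \<open>first-row expansion of the first factor\<close>
    have row: "pf ?v (map Inl X @ map Inr (?l J)) * pf ?w (map Inl Y @ map Inr (?l J))
      = alt_sum (\<lambda>x' M. A x x' * (pf ?v (map Inl M @ map Inr (?l J)) * pf ?w (map Inl Y @ map Inr (?l J)))) X'
        + ?s * (-1) ^ length Y * (\<Sum>k\<in>J. ?t k (J - {k}))" if J: "J \<in> Pow (set K)" for J
    proof -
      have "alt_sum (\<lambda>k M. V x k * pf ?v (map Inl X' @ map Inr M)) (?l J) * pf ?w (map Inl Y @ map Inr (?l J))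
         = (-1) ^ length Y * (\<Sum>k\<in>set (?l J). ?t k (J - {k}))"
        unfolding w.alt_sum_mult_pf[OF distinct_filter[OF K]] length_map
        by (intro arg_cong2[of _ _ _ _ "(*)"] sum.cong refl) (simp_all add: conj_commute)
      moreover have "set (?l J) = J" using J by auto
      ultimately have "alt_sum (\<lambda>k M. V x k * pf ?v (map Inl X' @ map Inr M)) (?l J) * pf ?w (map Inl Y @ map Inr (?l J))
         = (-1) ^ length Y * (\<Sum>k\<in>J. ?t k (J - {k}))" by simp
      moreover have "pf ?v (map Inl X @ map Inr (?l J)) = alt_sum (\<lambda>x' M. A x x' * pf ?v (map Inl M @ map Inr (?l J))) X'
          + ?s * alt_sum (\<lambda>k M. V x k * pf ?v (map Inl X' @ map Inr M)) (?l J)"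
        by (simp add: Cons pf_Cons alt_sum_append alt_sum_map)
      moreover have "alt_sum (\<lambda>x' M. A x x' * pf ?v (map Inl M @ map Inr (?l J))) X' * pf ?w (map Inl Y @ map Inr (?l J))
          = alt_sum (\<lambda>x' M. A x x' * (pf ?v (map Inl M @ map Inr (?l J)) * pf ?w (map Inl Y @ map Inr (?l J)))) X'"
        unfolding alt_sum_scale_right[symmetric] mult.assoc ..
      ultimately show ?thesis
        by (simp only: distrib_right mult.assoc)
    qed
    \<comment> \<open>Because of these zeros, \<open>J - {k}\<close> with \<open>k \<in> J\<close> may be replaced by an arbitrary subset.\<close>
    have t0: "?t k J = 0" if "k \<in> J" "k \<in> set K" for k J
    proof -
      have "\<not> distinct (Inr k # map Inl Y @ map Inr (?l J))" using that by auto
      then show ?thesis using w.pf_not_distinct by (metis mult_zero_right)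
    qed
    have "(\<Sum>J\<in>Pow (set K). \<Sum>k\<in>J. ?t k (J - {k})) = (\<Sum>J\<in>Pow (set K). \<Sum>k\<in>set K. ?t k J)"
    proof -
      have "(\<Sum>J\<in>Pow (set K). \<Sum>k\<in>J. ?t k (J - {k})) = (\<Sum>(J,k)\<in>Sigma (Pow (set K)) (\<lambda>J. J). ?t k (J - {k}))"
        by (rule sum.Sigma) (auto intro: finite_subset)
      also have "\<dots> = (\<Sum>(J,k)\<in>Sigma (Pow (set K)) (\<lambda>J. set K - J). ?t k J)"
        by (rule sum.reindex_bij_witness[of _ "\<lambda>(J,k). (insert k J, k)" "\<lambda>(J,k). (J - {k}, k)"]) auto
      also have "\<dots> = (\<Sum>J\<in>Pow (set K). \<Sum>k\<in>set K - J. ?t k J)"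
        by (rule sum.Sigma[symmetric]) (auto intro: finite_subset)
      also have "\<dots> = (\<Sum>J\<in>Pow (set K). \<Sum>k\<in>set K. ?t k J)"
        by (intro sum.cong refl sum.mono_neutral_left) (auto intro: t0)
      finally show ?thesis .
    qed
    also have "\<dots> = - alt_sum (\<lambda>y M. ?S x y * ?F X' M) Y"
    proof -
      have "?t k J = - alt_sum (\<lambda>y M. V x k * W y k *
          (pf ?v (map Inl X' @ map Inr (?l J)) * pf ?w (map Inl M @ map Inr (?l J)))) Y" for k J
      proof -
        have "pf ?w (Inr k # map Inl Y @ map Inr (?l J)) = alt_sum (\<lambda>y M. - (W y k * pf ?w (map Inl M @ map Inr (?l J)))) Y"
          by (simp add: pf_Cons alt_sum_append alt_sum_map Z_def)
        then show ?thesis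
          by (simp only: alt_sum_minus alt_sum_scale mult.assoc mult_minus_right mult.left_commute[of "W _ k"])
      qed
      then have "(\<Sum>J\<in>Pow (set K). \<Sum>k\<in>set K. ?t k J) = - alt_sum (\<lambda>y M. \<Sum>J\<in>Pow (set K). \<Sum>k\<in>set K. V x k * W y k *
          (pf ?v (map Inl X' @ map Inr (?l J)) * pf ?w (map Inl M @ map Inr (?l J)))) Y"
        by (simp add: sum_negf alt_sum_sum)
      then show ?thesis
        by (simp flip: sum_distrib_right sum_distrib_left)
    qed
    finally have second: "(\<Sum>J\<in>Pow (set K). \<Sum>k\<in>J. ?t k (J - {k})) = - alt_sum (\<lambda>y M. ?S x y * ?F X' M) Y" .
    have "?F X Y = (\<Sum>J\<in>Pow (set K). alt_sum (\<lambda>x' M. A x x' * (pf ?v (map Inl M @ map Inr (?l J)) * pf ?w (map Inl Y @ map Inr (?l J)))) X'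
        + ?s * (-1) ^ length Y * (\<Sum>k\<in>J. ?t k (J - {k})))"
      by (intro sum.cong refl row)
    also have "\<dots> = alt_sum (\<lambda>x' M. A x x' * ?F M Y) X' + ?s * (-1) ^ length Y * - alt_sum (\<lambda>y M. ?S x y * ?F X' M) Y"
      unfolding sum.distrib sum_distrib_left[symmetric] second
      unfolding alt_sum_sum[symmetric] sum_distrib_left[symmetric] ..
    also have "alt_sum (\<lambda>x' M. A x x' * ?F M Y) X' = alt_sum (\<lambda>x' M. A x x' * ?G M Y) X'"
      by (intro alt_sum_cong arg_cong2[of _ _ _ _ "(*)"] less.IH refl) (simp add: Cons)
    also have "alt_sum (\<lambda>y M. ?S x y * ?F X' M) Y = alt_sum (\<lambda>y M. ?S x y * ?G X' M) Y"
      by (intro alt_sum_cong arg_cong2[of _ _ _ _ "(*)"] less.IH refl) (simp add: Cons)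
    also have "alt_sum (\<lambda>x' M. A x x' * ?G M Y) X' + ?s * (-1) ^ length Y * - alt_sum (\<lambda>y M. ?S x y * ?G X' M) Y
       = ?G X Y"
      by (simp only: Cons list.map append_Cons pf_Cons alt_sum_append alt_sum_map alt_sum_rev length_map
          block.simps mult_minus_right mult.assoc)
    finally show ?thesis .
  qed
qed

section \<open>Schur's Pfaffian\<close>

text \<open>
  The partial fraction decomposition behind Schur's Pfaffian. After multiplication by \<open>\<Prod>x. (z x + a)\<close>
  both sides are polynomials in \<open>a\<close> of degree at most \<open>m = card I\<close> that agree at the \<open>m\<close> points \<open>-z x\<close>, so their difference
  \<open>p\<close> is a constant multiple of \<open>f = \<Prod>x. (z x + a)\<close>. If \<open>C\<close> is the sum of the coefficients \<open>c x\<close>, then, as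
  \<open>m\<close> is odd, the leading coefficients give the constant \<open>C - 1\<close>, and the values
  at \<open>a = 0\<close> give \<open>1 - C\<close>. Hence \<open>C = 1\<close> and \<open>p = 0\<close>.
\<close>

lemma partial_fractions:
  fixes z :: "'l \<Rightarrow> 'f::field"
  assumes I: "finite I" "odd (card I)" and inj: "inj_on z I"
    and nz: "\<And>x y. x \<in> I \<Longrightarrow> y \<in> I \<Longrightarrow> z x + z y \<noteq> 0" "\<And>x. x \<in> I \<Longrightarrow> z x + a \<noteq> 0"
    and two: "(2::'f) \<noteq> 0"
  shows "(\<Sum>x\<in>I. (z x - a) / (z x + a) / (\<Prod>y\<in>I - {x}. (z y - z x) / (z y + z x)))
    = (\<Prod>x\<in>I. (z x - a) / (z x + a))"
proof -
  define c where "c x = 1 / (\<Prod>y\<in>I - {x}. (z y - z x) / (z y + z x))" for x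
  define m where "m = card I"
  define f where "f = (\<Prod>x\<in>I. [:z x, 1:])"
  define g where "g x = (\<Prod>y\<in>I - {x}. [:z y, 1:])" for x
  define p where "p = (\<Prod>x\<in>I. [:z x, -1:]) - (\<Sum>x\<in>I. Polynomial.smult (c x) ([:z x, -1:] * g x))"
  have z0: "z x \<noteq> 0" if "x \<in> I" for x using nz(1)[OF that that] by auto
  have f: "f = [:z x, 1:] * g x" if "x \<in> I" for x
    unfolding f_def g_def using I(1) that by (rule prod.remove)
  have lin: "degree (\<Prod>x\<in>J. [:z x, e:]) = card J \<and> coeff (\<Prod>x\<in>J. [:z x, e:]) (card J) = e ^ card J"
    if "e \<noteq> 0" "finite J" for e :: 'f and J
    using that(2)
  proof (induction J)
    case (insert x J)
    have nz: "(\<Prod>x\<in>J. [:z x, e:]) \<noteq> 0" "[:z x, e:] \<noteq> 0" using insert.hyps(1) that(1) by auto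
    have d: "degree ([:z x, e:] * (\<Prod>x\<in>J. [:z x, e:])) = Suc (card J)"
      using degree_mult_eq[OF nz(2,1)] insert.IH that(1) by simp
    have "coeff ([:z x, e:] * (\<Prod>x\<in>J. [:z x, e:])) (degree [:z x, e:] + degree (\<Prod>x\<in>J. [:z x, e:])) = e * e ^ card J"
      unfolding coeff_mult_degree_sum using insert.IH that(1) by simp
    then show ?case using insert d that(1) by simp
  qed simp
  obtain k where m: "m = Suc k" using I(2) by (cases m) (auto simp: m_def)
  have dg: "degree (g x) = k" "coeff (g x) k = 1" if "x \<in> I" for x
    using lin[of 1 "I - {x}"] I(1) that m by (simp_all add: g_def m_def)
  have cg: "coeff ([:z x, -1:] * g x) m = -1" "degree ([:z x, -1:] * g x) \<le> m" if "x \<in> I" for x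
  proof -
    have "coeff (g x) (Suc k) = 0" using dg[OF that] by (intro coeff_eq_0) simp
    then show "coeff ([:z x, -1:] * g x) m = -1" using dg[OF that] by (simp add: m)
    show "degree ([:z x, -1:] * g x) \<le> m"
      using degree_mult_le[of "[:z x, -1:]" "g x"] dg[OF that] m by simp
  qed
  have "even m \<Longrightarrow> False" using I(2) by (simp add: m_def)
  then have "(-1) ^ m = (-1 :: 'f)" by (metis neg_one_odd_power)
  then have p_top: "coeff p m = -1 + (\<Sum>x\<in>I. c x)"
    using lin[of "-1" I] I(1) by (simp add: p_def coeff_sum cg(1) sum_negf del: mult_pCons_left flip: m_def)
  have p_deg: "degree p \<le> m"
    unfolding p_def using lin[of "-1" I] I(1) cg(2)
    by (intro degree_diff_le degree_sum_le order.trans[OF degree_smult_le]) (auto simp: m_def)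
  have p_root: "poly p (- z k) = 0" if k: "k \<in> I" for k
  proof -
    have "poly (\<Sum>x\<in>I. Polynomial.smult (c x) ([:z x, -1:] * g x)) (- z k)
        = (\<Sum>x\<in>I. if x = k then c k * (2 * z k * (\<Prod>y\<in>I - {k}. z y - z k)) else 0)"
      unfolding poly_sum
    proof (intro sum.cong refl)
      fix x assume x: "x \<in> I"
      show "poly (Polynomial.smult (c x) ([:z x, -1:] * g x)) (- z k)
          = (if x = k then c k * (2 * z k * (\<Prod>y\<in>I - {k}. z y - z k)) else 0)"
      proof (cases "x = k")
        case False
        then have "k \<in> I - {x}" using k by simp
        then have "poly (g x) (- z k) = 0" using I(1) by (auto simp: g_def poly_prod)
        then show ?thesis using False by simp
      qed (simp add: g_def poly_prod)
    qed
    also have "\<dots> = c k * (2 * z k * (\<Prod>y\<in>I - {k}. z y - z k))" using I(1) k by simp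
    also have "\<dots> = 2 * z k * (\<Prod>y\<in>I - {k}. z y + z k)"
    proof -
      have "z y - z k \<noteq> 0" if "y \<in> I - {k}" for y
        using inj k that by (auto simp: inj_on_def)
      then have "(\<Prod>y\<in>I - {k}. z y - z k) \<noteq> 0" using I(1) by simp
      then show ?thesis by (simp add: c_def prod_dividef)
    qed
    also have "\<dots> = (\<Prod>y\<in>I. z y + z k)"
      using prod.remove[OF I(1) k, of "\<lambda>y. z y + z k"] by simp
    finally show ?thesis by (simp add: p_def poly_prod)
  qed
  define r where "r = p - Polynomial.smult (coeff p m) f"
  have f_top: "degree f = m" "coeff f m = 1" using lin[of 1 I] I(1) by (simp_all add: f_def m_def)
  have "r = 0"
  proof (rule ccontr)
    assume r: "r \<noteq> 0"
    have "poly r (- z k) = 0" if "k \<in> I" for k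
      using p_root[OF that] f[OF that] by (simp add: r_def)
    then have "(\<lambda>k. - z k) ` I \<subseteq> {x. poly r x = 0}" by auto
    then have "card ((\<lambda>k. - z k) ` I) \<le> card {x. poly r x = 0}"
      using r by (intro card_mono poly_roots_finite)
    also have "\<dots> \<le> degree r" using r by (rule card_poly_roots_bound)
    also have "card ((\<lambda>k. - z k) ` I) = m"
      unfolding m_def using inj by (intro card_image) (auto simp: inj_on_def)
    finally have "m \<le> degree r" .
    moreover have "degree r \<le> m"
      unfolding r_def using p_deg f_top by (intro degree_diff_le order.trans[OF degree_smult_le]) simp_all
    moreover have "coeff r m = 0" by (simp add: r_def f_top)
    ultimately show False using r by (metis eq_iff leading_coeff_0_iff)
  qed
  then have p: "p = Polynomial.smult (coeff p m) f" by (simp add: r_def)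
  have "poly p 0 = (\<Prod>x\<in>I. z x) * (1 - (\<Sum>x\<in>I. c x))"
  proof -
    have "z x * poly (g x) 0 = (\<Prod>x\<in>I. z x)" if "x \<in> I" for x
      using prod.remove[OF I(1) that, of z] by (simp add: g_def poly_prod)
    then have "(\<Sum>x\<in>I. c x * (z x * poly (g x) 0)) = (\<Sum>x\<in>I. c x) * (\<Prod>x\<in>I. z x)"
      by (simp add: sum_distrib_right)
    then show ?thesis by (simp add: p_def poly_prod poly_sum algebra_simps)
  qed
  moreover have "poly p 0 = (\<Prod>x\<in>I. z x) * (-1 + (\<Sum>x\<in>I. c x))"
    unfolding p_top[symmetric] by (subst p) (simp add: f_def poly_prod)
  ultimately have "1 - (\<Sum>x\<in>I. c x) = -1 + (\<Sum>x\<in>I. c x)" using z0 I(1) by simp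
  then have "2 * (1 - (\<Sum>x\<in>I. c x)) = 0" by (simp add: algebra_simps)
  then have "p = 0" using two p p_top by simp
  then have "poly p a = 0" by simp
  then have "(\<Prod>x\<in>I. z x - a) = (\<Sum>x\<in>I. c x * ((z x - a) * poly (g x) a))"
    by (simp add: p_def poly_prod poly_sum left_diff_distrib)
  then have "(\<Prod>x\<in>I. z x - a) / poly f a = (\<Sum>x\<in>I. c x * ((z x - a) * poly (g x) a) / poly f a)"
    by (simp add: sum_divide_distrib)
  also have "\<dots> = (\<Sum>x\<in>I. (z x - a) / (z x + a) * c x)"
  proof (intro sum.cong refl)
    fix x assume x: "x \<in> I"
    have "poly (g x) a \<noteq> 0" using nz(2) I(1) by (auto simp: g_def poly_prod)
    moreover have "poly f a = (z x + a) * poly (g x) a" using f[OF x] by (simp add: distrib_right)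
    ultimately show "c x * ((z x - a) * poly (g x) a) / poly f a = (z x - a) / (z x + a) * c x"
      by simp
  qed
  finally show ?thesis
    by (simp add: c_def f_def poly_prod prod_dividef)
qed


definition schur_weight :: "('l \<Rightarrow> 'f::field) \<Rightarrow> 'l \<Rightarrow> 'l \<Rightarrow> 'f" where
  "schur_weight z x y = (z y - z x) / (z y + z x)"

lemma skew_schur_weight: "skew (schur_weight z)"
proof
  fix x y
  have "(z y - z x) / (z y + z x) = - ((z x - z y) / (z x + z y))"
    by (metis add.commute minus_diff_eq minus_divide_left)
  then show "schur_weight z x y = - schur_weight z y x" by (simp add: schur_weight_def)
qed (simp add: schur_weight_def)

fun pair_prod :: "('l \<Rightarrow> 'l \<Rightarrow> 'a::comm_monoid_mult) \<Rightarrow> 'l list \<Rightarrow> 'a" where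
  "pair_prod w [] = 1"
| "pair_prod w (a # L) = (\<Prod>x\<leftarrow>L. w a x) * pair_prod w L"

lemma (in skew) pair_prod_move_front:
  "pair_prod w (A @ x # B) = (-1) ^ length A * ((\<Prod>y\<leftarrow>A @ B. w x y) * pair_prod w (A @ B))"
proof (induction A)
  case (Cons a A)
  then show ?case using skew[of a x] by (simp add: mult_ac)
qed simp

text \<open>
  Induction on the length, by expansion along the first row \<open>a\<close>: divided by the value for the
  remaining labels, the alternating sum of the values with one label removed is the sum
  in \<open>partial_fractions\<close>.
\<close>

theorem schur_pfaffian:
  fixes z :: "'l \<Rightarrow> 'f::field"
  assumes "even (length L)" "distinct L" "inj_on z (set L)"
    and "\<And>x y. x \<in> set L \<Longrightarrow> y \<in> set L \<Longrightarrow> z x + z y \<noteq> 0"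
  shows "pf (schur_weight z) L = pair_prod (schur_weight z) L"
  using assms
proof (induction L rule: list_length_induct)
  case (less L)
  let ?t = "schur_weight z"
  interpret skew ?t by (rule skew_schur_weight)
  show ?case
  proof (cases L)
    case (Cons a L')
    have d: "distinct L'" and inj: "inj_on z (set L')" and odd: "odd (length L')"
      using less.prems by (auto simp: Cons inj_on_def)
    have nz: "z x + z y \<noteq> 0" "z x + z a \<noteq> 0" if "x \<in> set L'" "y \<in> set L'" for x y
      using less.prems(4) that by (auto simp: Cons)
    have two: "(2 :: 'f) \<noteq> 0"
      using less.prems(4)[of a a] by (auto simp: Cons simp flip: mult_2)
    have expand: "(-1) ^ i * (?t a (L' ! i) * pf ?t (del i L')) =
        pair_prod ?t L' * (?t a (L' ! i) / (\<Prod>y\<in>set L' - {L' ! i}. ?t (L' ! i) y))"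
      if i: "i < length L'" for i
    proof -
      let ?x = "L' ! i"
      have L': "L' = take i L' @ ?x # drop (Suc i) L'" by (rule id_take_nth_drop[OF i])
      have df: "distinct (del i L')" "set (del i L') = set L' - {?x}"
        unfolding distinct_del_conv_filter[OF d i] using d by auto
      have "pf ?t (del i L') = pair_prod ?t (del i L')"
        using less.prems df i by (intro less.IH) (auto simp: Cons inj_on_def)
      moreover have "pair_prod ?t L' = (-1) ^ i * ((\<Prod>y\<in>set L' - {?x}. ?t ?x y) * pair_prod ?t (del i L'))"
      proof -
        have "pair_prod ?t L' = pair_prod ?t (take i L' @ ?x # drop (Suc i) L')" using L' by simp
        also have "\<dots> = (-1) ^ i * ((\<Prod>y\<leftarrow>del i L'. ?t ?x y) * pair_prod ?t (del i L'))"
          unfolding pair_prod_move_front using i by (simp add: del_def)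
        finally show ?thesis
          using df by (metis prod.distinct_set_conv_list)
      qed
      moreover have "(\<Prod>y\<in>set L' - {?x}. ?t ?x y) \<noteq> 0"
      proof -
        have "z y \<noteq> z ?x" "z y + z ?x \<noteq> 0" if "y \<in> set L' - {?x}" for y
          using that i inj nz(1)[of y ?x] by (auto simp: inj_on_def)
        then show ?thesis by (simp add: schur_weight_def)
      qed
      moreover have "(-1) ^ i * (-1) ^ i = (1 :: 'f)" by (simp flip: power_mult_distrib)
      ultimately show ?thesis by (simp add: field_simps)
    qed
    have "pf ?t L = (\<Sum>i<length L'. (-1) ^ i * (?t a (L' ! i) * pf ?t (del i L')))"
      by (simp add: Cons pf.simps)
    also have "\<dots> = (\<Sum>i<length L'. pair_prod ?t L' * (?t a (L' ! i) / (\<Prod>y\<in>set L' - {L' ! i}. ?t (L' ! i) y)))"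
      by (intro sum.cong refl expand) simp
    also have "\<dots> = (\<Sum>x\<in>set L'. pair_prod ?t L' * (?t a x / (\<Prod>y\<in>set L' - {x}. ?t x y)))"
      using bij_betw_nth[OF d refl refl] by (rule sum.reindex_bij_betw)
    also have "\<dots> = pair_prod ?t L' * (\<Prod>x\<in>set L'. ?t a x)"
      unfolding sum_distrib_left[symmetric] schur_weight_def
      by (subst partial_fractions) (use inj nz two odd d in \<open>auto simp: distinct_card\<close>)
    also have "\<dots> = pair_prod ?t L"
      using d by (simp add: Cons prod.distinct_set_conv_list mult.commute)
    finally show ?thesis .
  qed simp
qed

section \<open>The Pfaffian as a sum over perfect matchings\<close>

text \<open>
  The permutations over which \<open>pfaffian\<close> sums. Such a permutation maps \<open>0\<close> to \<open>0\<close>, and if it maps \<open>1\<close>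
  to \<open>j + 1\<close>, the remaining values are those of a smaller permutation of the same kind, renumbered by
  the monotone function \<open>skip j\<close> that omits \<open>0\<close> and \<open>j + 1\<close>. This is \<open>add_pair j\<close>, and it turns the expansion
  along the first row into a recursion for the sum over permutations.
\<close>

definition matchings :: "nat \<Rightarrow> (nat \<Rightarrow> nat) set" where
  "matchings k = {\<sigma>. \<sigma> permutes {..<2 * k} \<and> (\<forall>i<k. \<sigma> (2 * i) < \<sigma> (2 * i + 1)) \<and>
     (\<forall>i j. i < j \<and> j < k \<longrightarrow> \<sigma> (2 * i) < \<sigma> (2 * j))}"

definition skip :: "nat \<Rightarrow> nat \<Rightarrow> nat" where
  "skip j a = (if a < j then Suc a else Suc (Suc a))"

definition add_pair :: "nat \<Rightarrow> (nat \<Rightarrow> nat) \<Rightarrow> nat \<Rightarrow> nat" where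
  "add_pair j \<tau> = permutation_insert 0 0 (permutation_insert 0 j \<tau>)"

lemma skip_less [simp]: "skip j a < skip j b \<longleftrightarrow> a < b"
  by (auto simp: skip_def)

lemma skip_pos [simp]: "0 < skip j a"
  by (simp add: skip_def)

lemma add_pair_simps [simp]:
  "add_pair j \<tau> 0 = 0" "add_pair j \<tau> (Suc 0) = Suc j" "add_pair j \<tau> (Suc (Suc m)) = skip j (\<tau> m)"
  by (auto simp: add_pair_def permutation_insert_expand skip_def)

lemma add_pair_permutes:
  assumes "\<tau> permutes {..<n}" "j < Suc n"
  shows "add_pair j \<tau> permutes {..<Suc (Suc n)}"
  unfolding add_pair_def lessThan_atLeast0
  using assms by (intro permutation_insert_permutes) (simp_all add: lessThan_atLeast0)

lemma sign_add_pair: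
  assumes "\<tau> permutes {..<n}" "j < Suc n"
  shows "of_int (sign (add_pair j \<tau>)) = ((-1) ^ j * of_int (sign \<tau>) :: 'a::comm_ring_1)"
proof -
  have \<tau>: "\<tau> permutes {0..<n}" using assms(1) by (simp add: lessThan_atLeast0)
  have "permutation_insert 0 j \<tau> permutes {0..<Suc n}"
    using \<tau> assms(2) by (intro permutation_insert_permutes) simp_all
  from signof_permutation_insert[OF this, of 0 0, where ?'a = 'a]
    signof_permutation_insert[OF \<tau> _ assms(2), of 0, where ?'a = 'a]
  show ?thesis by (simp add: add_pair_def)
qed

lemma matchings_0 [simp]: "matchings 0 = {id}"
  by (auto simp: matchings_def)

lemma add_pair_matching:
  assumes "\<tau> \<in> matchings k" "j < Suc (2 * k)"
  shows "add_pair j \<tau> \<in> matchings (Suc k)"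
proof -
  have lt: "add_pair j \<tau> (2 * i) < add_pair j \<tau> (2 * i + 1)" if "i < Suc k" for i
    using assms(1) that by (cases i) (auto simp: matchings_def)
  have "add_pair j \<tau> (2 * i) < add_pair j \<tau> (2 * i')" if "i < i'" "i' < Suc k" for i i'
    using assms(1) that by (cases i; cases i') (auto simp: matchings_def)
  with lt show ?thesis
    using add_pair_permutes[of \<tau> "2 * k" j] assms by (auto simp: matchings_def)
qed

text \<open>
  The preimage \<open>p\<close> of \<open>0\<close> can be neither odd, as then \<open>\<sigma> (p - 1) < \<sigma> p\<close>, nor even and positive, as then
  \<open>\<sigma> 0 < \<sigma> p\<close>.
\<close>

lemma matching_conv_add_pair:
  assumes \<sigma>: "\<sigma> \<in> matchings (Suc k)"
  obtains j \<tau> where "j < Suc (2 * k)" "\<tau> \<in> matchings k" "\<sigma> = add_pair j \<tau>"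
proof -
  have perm: "\<sigma> permutes {0..<Suc (Suc (2 * k))}"
    and lt: "\<And>i. i < Suc k \<Longrightarrow> \<sigma> (2 * i) < \<sigma> (2 * i + 1)"
    and inc: "\<And>i j. i < j \<Longrightarrow> j < Suc k \<Longrightarrow> \<sigma> (2 * i) < \<sigma> (2 * j)"
    using \<sigma> by (auto simp: matchings_def lessThan_atLeast0)
  obtain p where p: "p \<in> {0..<Suc (Suc (2 * k))}" "\<sigma> p = 0"
    using permutes_image[OF perm] by (metis (no_types, lifting) atLeastLessThan_iff imageE le0 zero_less_Suc)
  have "\<sigma> 0 = 0"
  proof (cases "even p")
    case True
    then obtain i where "p = 2 * i" by (elim evenE)
    with inc[of 0 i] p show ?thesis by (cases "i = 0") auto
  next
    case False
    then obtain i where "p = 2 * i + 1" by (elim oddE)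
    with lt[of i] p show ?thesis by auto
  qed
  with perm obtain \<sigma>' where s': "\<sigma> = permutation_insert 0 0 \<sigma>'" "\<sigma>' permutes {0..<Suc (2 * k)}"
    using permutation_fix[of 0 "Suc (2 * k)" 0] by auto
  obtain j where j: "\<sigma>' 0 = j" "j < Suc (2 * k)"
    using permutes_in_image[OF s'(2), of 0] by simp
  then obtain \<tau> where t: "\<sigma>' = permutation_insert 0 j \<tau>" "\<tau> permutes {0..<2 * k}"
    using permutation_fix[of 0 "2 * k" j] s'(2) by auto
  have s: "\<sigma> = add_pair j \<tau>" by (simp add: s' t add_pair_def)
  have "\<tau> \<in> matchings k"
    using lt[of "Suc _", unfolded s] inc[of "Suc _" "Suc _", unfolded s] t(2)
    by (simp add: matchings_def lessThan_atLeast0)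
  then show ?thesis using that j(2) s by blast
qed

lemma add_pair_inject: "add_pair j \<tau> = add_pair j' \<tau>' \<longleftrightarrow> j = j' \<and> \<tau> = \<tau>'"
proof
  assume eq: "add_pair j \<tau> = add_pair j' \<tau>'"
  then have j: "j = j'" using add_pair_simps(2) by (metis nat.inject)
  have "\<tau> m = \<tau>' m" for m
    using add_pair_simps(3)[of j \<tau> m] add_pair_simps(3)[of j' \<tau>' m] eq j
    by (metis linorder_neqE_nat order_less_irrefl skip_less)
  with j show "j = j' \<and> \<tau> = \<tau>'" by auto
qed simp

lemma del_upt: "j < Suc n \<Longrightarrow> del j [Suc 0..<Suc (Suc n)] = map (skip j) [0..<n]"
  by (rule nth_equalityI) (auto simp: del_def skip_def nth_append min_def)

lemma sum_matchings_eq_pf: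
  "(\<Sum>\<sigma>\<in>matchings k. of_int (sign \<sigma>) * (\<Prod>i<k. W (\<sigma> (2 * i)) (\<sigma> (2 * i + 1)))) = pf W [0..<2 * k]"
proof (induction k arbitrary: W)
  case (Suc k)
  let ?term = "\<lambda>W k \<sigma>. of_int (sign \<sigma>) * (\<Prod>i<k. W (\<sigma> (2 * i)) (\<sigma> (2 * i + 1)))"
  have bij: "bij_betw (\<lambda>(j, \<tau>). add_pair j \<tau>) ({..<Suc (2 * k)} \<times> matchings k) (matchings (Suc k))"
    unfolding bij_betw_def
  proof
    show "inj_on (\<lambda>(j, \<tau>). add_pair j \<tau>) ({..<Suc (2 * k)} \<times> matchings k)"
      by (auto simp: inj_on_def add_pair_inject)
    show "(\<lambda>(j, \<tau>). add_pair j \<tau>) ` ({..<Suc (2 * k)} \<times> matchings k) = matchings (Suc k)"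
      by (force intro: add_pair_matching elim: matching_conv_add_pair)
  qed
  have "[0..<2 * Suc k] = 0 # [1..<Suc (Suc (2 * k))]" by (simp add: upt_conv_Cons)
  then have "pf W [0..<2 * Suc k]
      = (\<Sum>j<Suc (2 * k). (-1) ^ j * (W 0 ([1..<Suc (Suc (2 * k))] ! j) * pf W (del j [1..<Suc (Suc (2 * k))])))"
    by (simp only: pf.simps length_upt diff_Suc_1)
  also have "\<dots> = (\<Sum>j<Suc (2 * k). \<Sum>\<tau>\<in>matchings k. ?term W (Suc k) (add_pair j \<tau>))"
  proof (intro sum.cong refl)
    fix j assume "j \<in> {..<Suc (2 * k)}"
    then have j: "j < Suc (2 * k)" by simp
    have "?term W (Suc k) (add_pair j \<tau>) = (-1) ^ j * W 0 (Suc j) * ?term (\<lambda>x y. W (skip j x) (skip j y)) k \<tau>"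
      if "\<tau> \<in> matchings k" for \<tau>
      using that sign_add_pair[of \<tau> "2 * k" j, where ?'a = 'a] j
      unfolding prod.lessThan_Suc_shift by (simp add: matchings_def)
    then have "(\<Sum>\<tau>\<in>matchings k. ?term W (Suc k) (add_pair j \<tau>))
        = (-1) ^ j * W 0 (Suc j) * pf (\<lambda>x y. W (skip j x) (skip j y)) [0..<2 * k]"
      unfolding Suc.IH[symmetric] sum_distrib_left by (intro sum.cong) auto
    then show "(-1) ^ j * (W 0 ([1..<Suc (Suc (2 * k))] ! j) * pf W (del j [1..<Suc (Suc (2 * k))]))
        = (\<Sum>\<tau>\<in>matchings k. ?term W (Suc k) (add_pair j \<tau>))"
      using j by (simp add: del_upt pf_map mult.assoc del: upt_Suc)
  qed
  also have "\<dots> = (\<Sum>(j, \<tau>)\<in>{..<Suc (2 * k)} \<times> matchings k. ?term W (Suc k) (add_pair j \<tau>))"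
    by (rule sum.cartesian_product)
  also have "\<dots> = (\<Sum>\<sigma>\<in>matchings (Suc k). ?term W (Suc k) \<sigma>)"
    using sum.reindex_bij_betw[OF bij, of "?term W (Suc k)"] by (simp add: case_prod_unfold)
  finally show ?case ..
qed simp

theorem pfaffian_eq_pf: "pfaffian M = pf (\<lambda>i j. M $$ (i, j)) [0..<dim_row M]"
proof (cases "even (dim_row M)")
  case True
  then show ?thesis
    using sum_matchings_eq_pf[where k = "dim_row M div 2" and W = "\<lambda>i j. M $$ (i, j)"]
    by (simp add: pfaffian_def matchings_def)
qed (simp add: pfaffian_def pf_odd)

section \<open>Power series in several variables\<close>

lemma splittings_iff [simp]: "(a, b) \<in> splittings m \<longleftrightarrow> a + b = m"
  by (simp add: splittings_def)

lemma mfps_coeff_monom_mult: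
  fixes g :: "'a::comm_ring_1 mfps"
  shows "mfps_coeff (Abs_mfps (\<lambda>m. if m = e then c else 0) * g) (e + m) = c * mfps_coeff g m"
    and "(\<And>b. m' \<noteq> e + b) \<Longrightarrow> mfps_coeff (Abs_mfps (\<lambda>m. if m = e then c else 0) * g) m' = 0"
proof -
  have "mfps_coeff (Abs_mfps (\<lambda>m. if m = e then c else 0) * g) (e + m)
      = (\<Sum>p\<in>splittings (e + m). if p = (e, m) then c * mfps_coeff g m else 0)"
    unfolding mfps_coeff_mult by (intro sum.cong) (auto split: if_splits)
  then show "mfps_coeff (Abs_mfps (\<lambda>m. if m = e then c else 0) * g) (e + m) = c * mfps_coeff g m"
    by simp
  assume *: "\<And>b. m' \<noteq> e + b"
  have "(case p of (a, b) \<Rightarrow> mfps_coeff (Abs_mfps (\<lambda>m. if m = e then c else 0)) a * mfps_coeff g b) = 0"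
    if "p \<in> splittings m'" for p
    using * that by (cases p) auto
  then show "mfps_coeff (Abs_mfps (\<lambda>m. if m = e then c else 0) * g) m' = 0"
    unfolding mfps_coeff_mult by (intro sum.neutral) blast
qed

lemma mfps_coeff_const_mult [simp]: "mfps_coeff (mfps_const c * g) m = c * mfps_coeff g m"
  using mfps_coeff_monom_mult(1)[of 0 c g m] by (simp add: mfps_const_def)

lemma single_add_diff: "0 < expo m i \<Longrightarrow> Poly_Mapping.single i 1 + (m - Poly_Mapping.single i 1) = (m :: monomial)"
  by (rule poly_mapping_eqI) (auto simp: lookup_add lookup_minus lookup_single when_def)

lemma mfps_coeff_var_mult:
  "mfps_coeff (mfps_var i * g) m = (if expo m i = 0 then 0 else mfps_coeff g (m - Poly_Mapping.single i 1))"
proof (cases "expo m i = 0")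
  case True
  then have "m \<noteq> Poly_Mapping.single i 1 + b" for b by (auto simp: lookup_add)
  from mfps_coeff_monom_mult(2)[of m "Poly_Mapping.single i 1" 1 g, OF this] True
  show ?thesis by (simp add: mfps_var_def)
next
  case False
  then show ?thesis
    using mfps_coeff_monom_mult(1)[of "Poly_Mapping.single i 1" 1 g "m - Poly_Mapping.single i 1"]
    by (simp add: mfps_var_def single_add_diff del: One_nat_def)
qed

lemma mfps_coeff_const: "mfps_coeff (mfps_const c) m = (if m = 0 then c else 0)"
  and mfps_coeff_var: "mfps_coeff (mfps_var i) m = (if m = Poly_Mapping.single i 1 then 1 else 0)"
  by (simp_all add: mfps_const_def mfps_var_def)

lemma single_inject: "Poly_Mapping.single i (1::nat) = Poly_Mapping.single j 1 \<longleftrightarrow> i = (j :: nat)"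
proof
  assume "Poly_Mapping.single i (1::nat) = Poly_Mapping.single j 1"
  then have "expo (Poly_Mapping.single i 1) i = expo (Poly_Mapping.single j 1) i" by (simp only:)
  then show "i = j" by (simp add: lookup_single when_def split: if_splits)
qed simp

lemma vars_subset_singleton: "vars m \<subseteq> {i} \<Longrightarrow> (m :: monomial) = Poly_Mapping.single i (expo m i)"
  by (intro poly_mapping_eqI) (auto simp: lookup_single when_def in_keys_iff)

lemma mfps_var_inject [simp]: "mfps_var i = (mfps_var j :: 'a::comm_ring_1 mfps) \<longleftrightarrow> i = j"
proof
  assume "mfps_var i = (mfps_var j :: 'a mfps)"
  then have "mfps_coeff (mfps_var i :: 'a mfps) (Poly_Mapping.single i 1) = mfps_coeff (mfps_var j) (Poly_Mapping.single i 1)"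
    by simp
  then show "i = j" by (simp add: mfps_coeff_var single_inject[unfolded One_nat_def] split: if_splits)
qed simp

lemma mfps_var_add_nonzero [simp]: "mfps_var i + mfps_var j \<noteq> (0 :: 'a::{comm_ring_1,ring_char_0} mfps)"
proof
  assume "mfps_var i + mfps_var j = (0 :: 'a mfps)"
  then have "mfps_coeff (mfps_var i + mfps_var j :: 'a mfps) (Poly_Mapping.single i 1) = 0"
    by (simp only: mfps_coeff_0)
  then show False by (simp add: mfps_coeff_var split: if_splits)
qed

subsection \<open>Monomial substitutions\<close>

text \<open>
  An additive map of monomials with finite fibres acts on power series: it collects the coefficients of each
  fibre. The finiteness lets the sums be rearranged, and so this is a ring homomorphism. The instance needed below is
  the substitution of one variable for another.
\<close>

locale monomial_map =
  fixes \<kappa> :: "monomial \<Rightarrow> monomial"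
  assumes add: "\<kappa> (a + b) = \<kappa> a + \<kappa> b"
    and fibre: "finite {m'. \<kappa> m' = m}"
begin

definition push :: "'a::comm_ring_1 mfps \<Rightarrow> 'a mfps" where
  "push g = Abs_mfps (\<lambda>m. \<Sum>m' | \<kappa> m' = m. mfps_coeff g m')"

lemma coeff_push: "mfps_coeff (push g) m = (\<Sum>m' | \<kappa> m' = m. mfps_coeff g m')"
  by (simp add: push_def)

lemma zero: "\<kappa> 0 = 0"
  using add[of 0 0] by simp

sublocale push: comm_ring_hom push
proof
  fix f g :: "'a mfps"
  show "push 0 = (0 :: 'a mfps)"
    by (rule mfps_eqI) (simp add: coeff_push)
  show "push (f + g) = push f + push g"
    by (rule mfps_eqI) (simp add: coeff_push sum.distrib)
  have "(\<Sum>m' | \<kappa> m' = m. if m' = 0 then 1 else 0) = (if m = 0 then 1 else 0 :: 'a)" for m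
    using fibre by (simp add: sum.delta zero)
  then show "push 1 = (1 :: 'a mfps)"
    by (intro mfps_eqI) (simp add: coeff_push mfps_coeff_1)
  show "push (f * g) = push f * push g"
  proof (rule mfps_eqI)
    fix m
    let ?c = "\<lambda>(a, b). mfps_coeff f a * mfps_coeff g b"
    let ?P = "{p. \<kappa> (fst p) + \<kappa> (snd p) = m}"
    have "mfps_coeff (push (f * g)) m = (\<Sum>m' | \<kappa> m' = m. \<Sum>p\<in>splittings m'. ?c p)"
      by (simp add: coeff_push mfps_coeff_mult)
    also have "\<dots> = (\<Sum>(m', p)\<in>Sigma {m'. \<kappa> m' = m} splittings. ?c p)"
      by (rule sum.Sigma) (use fibre in auto)
    also have "\<dots> = (\<Sum>p\<in>?P. ?c p)"
      by (rule sum.reindex_bij_witness[of _ "\<lambda>p. (fst p + snd p, p)" snd]) (auto simp: add splittings_def)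
    also have "\<dots> = (\<Sum>(q, p)\<in>Sigma (splittings m) (\<lambda>(a, b). {a'. \<kappa> a' = a} \<times> {b'. \<kappa> b' = b}). ?c p)"
      by (rule sum.reindex_bij_witness[of _ snd "\<lambda>p. ((\<kappa> (fst p), \<kappa> (snd p)), p)"]) (auto simp: splittings_def)
    also have "\<dots> = (\<Sum>q\<in>splittings m. \<Sum>p\<in>(case q of (a, b) \<Rightarrow> {a'. \<kappa> a' = a} \<times> {b'. \<kappa> b' = b}). ?c p)"
      by (rule sum.Sigma[symmetric]) (use fibre in auto)
    also have "\<dots> = mfps_coeff (push f * push g) m"
      unfolding mfps_coeff_mult coeff_push
      by (intro sum.cong refl) (auto simp: sum_product sum.cartesian_product)
    finally show "mfps_coeff (push (f * g)) m = mfps_coeff (push f * push g) m" .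
  qed
qed

lemma push_fps_at_var:
  assumes "\<And>k. \<kappa> (Poly_Mapping.single i k) = Poly_Mapping.single j k"
  shows "push (fps_at_var g i) = fps_at_var g j"
proof (rule mfps_eqI)
  fix m
  show "mfps_coeff (push (fps_at_var g i)) m = mfps_coeff (fps_at_var g j) m"
  proof (cases "vars m \<subseteq> {j}")
    case True
    then have m: "m = Poly_Mapping.single j (expo m j)" by (rule vars_subset_singleton)
    have "mfps_coeff (push (fps_at_var g i)) m = (\<Sum>m' | \<kappa> m' = m. if m' = Poly_Mapping.single i (expo m j) then fps_nth g (expo m j) else 0)"
      unfolding coeff_push
    proof (intro sum.cong refl)
      fix m' assume "m' \<in> {m'. \<kappa> m' = m}"
      then have "\<kappa> m' = m" by simp
      show "mfps_coeff (fps_at_var g i) m' = (if m' = Poly_Mapping.single i (expo m j) then fps_nth g (expo m j) else 0)"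
      proof (cases "vars m' \<subseteq> {i}")
        case True
        then have m': "m' = Poly_Mapping.single i (expo m' i)" by (rule vars_subset_singleton)
        then have "m = Poly_Mapping.single j (expo m' i)"
          using assms[of "expo m' i"] \<open>\<kappa> m' = m\<close> by metis
        then have "expo m j = expo m' i" by simp
        with True m' show ?thesis by (simp add: fps_at_var_def)
      next
        case False
        then have "m' \<noteq> Poly_Mapping.single i (expo m j)" by (auto split: if_splits)
        with False show ?thesis by (simp add: fps_at_var_def)
      qed
    qed
    also have "\<dots> = fps_nth g (expo m j)"
    proof -
      have "Poly_Mapping.single i (expo m j) \<in> {m'. \<kappa> m' = m}"
        by (simp only: mem_Collect_eq assms) (rule m[symmetric])
      then show ?thesis using fibre by simp
    qed
    finally show ?thesis using True by (simp add: fps_at_var_def)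
  next
    case False
    have "mfps_coeff (fps_at_var g i) m' = 0" if "\<kappa> m' = m" for m'
    proof -
      have "\<not> vars m' \<subseteq> {i}"
      proof
        assume "vars m' \<subseteq> {i}"
        then have "m' = Poly_Mapping.single i (expo m' i)" by (rule vars_subset_singleton)
        then have "m = Poly_Mapping.single j (expo m' i)" using assms[of "expo m' i"] that by metis
        then have "vars m \<subseteq> {j}" by simp
        then show False using False by simp
      qed
      then show ?thesis by (simp add: fps_at_var_def)
    qed
    then show ?thesis using False by (simp add: coeff_push fps_at_var_def)
  qed
qed

end

lemma fps_at_var_X [simp]: "fps_at_var fps_X i = mfps_var i"
proof (rule mfps_eqI)
  fix m
  have "vars m \<subseteq> {i} \<and> expo m i = 1 \<longleftrightarrow> m = Poly_Mapping.single i 1"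
  proof
    assume "vars m \<subseteq> {i} \<and> expo m i = 1"
    then show "m = Poly_Mapping.single i 1"
      by (intro poly_mapping_eqI) (auto simp: lookup_single when_def in_keys_iff)
  qed auto
  then show "mfps_coeff (fps_at_var fps_X i) m = mfps_coeff (mfps_var i :: 'a mfps) m"
    by (auto simp: fps_at_var_def mfps_coeff_var fps_X_def)
qed

subsection \<open>Setting two variables equal\<close>

definition merge :: "nat \<Rightarrow> nat \<Rightarrow> monomial \<Rightarrow> monomial" where
  "merge c d m = m + Poly_Mapping.single c (expo m d) - Poly_Mapping.single d (expo m d)"

lemma expo_merge:
  "c \<noteq> d \<Longrightarrow> expo (merge c d m) k = (if k = d then 0 else if k = c then expo m c + expo m d else expo m k)"
  by (simp add: merge_def lookup_add lookup_minus lookup_single when_def)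

text \<open>
  The monomials that become \<open>m\<close> when \<open>x\<^sub>d\<close> is replaced by \<open>x\<^sub>c\<close> arise from \<open>m\<close> by turning some factors \<open>x\<^sub>c\<close> into \<open>x\<^sub>d\<close>.
\<close>

lemma merge_fibre:
  assumes "c \<noteq> d"
  shows "{m'. merge c d m' = m} = (if expo m d = 0
    then (\<lambda>i. m + Poly_Mapping.single d i - Poly_Mapping.single c i) ` {..expo m c} else {})"
proof (cases "expo m d = 0")
  case True
  have "m' \<in> (\<lambda>i. m + Poly_Mapping.single d i - Poly_Mapping.single c i) ` {..expo m c}"
    if "merge c d m' = m" for m'
  proof (rule image_eqI)
    show "expo m' d \<in> {..expo m c}" using expo_merge[OF assms, of m' c] that assms by auto
    show "m' = m + Poly_Mapping.single d (expo m' d) - Poly_Mapping.single c (expo m' d)"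
      unfolding that[symmetric] using assms
      by (intro poly_mapping_eqI) (simp add: lookup_add lookup_minus expo_merge lookup_single when_def)
  qed
  moreover have "merge c d (m + Poly_Mapping.single d i - Poly_Mapping.single c i) = m"
    if "i \<le> expo m c" for i
    using assms that True
    by (intro poly_mapping_eqI) (simp add: lookup_add lookup_minus expo_merge lookup_single when_def)
  ultimately show ?thesis using True by auto
next
  case False
  then show ?thesis using expo_merge[OF assms, of _ d] by auto
qed

lemma monomial_map_merge:
  assumes "c \<noteq> d"
  shows "monomial_map (merge c d)"
proof
  show "merge c d (a + b) = merge c d a + merge c d b" for a b
    using assms by (intro poly_mapping_eqI) (simp add: lookup_add expo_merge)
  show "finite {m'. merge c d m' = m}" for m
    unfolding merge_fibre[OF assms] by simp
qed

lemma merge_single: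
  "c \<noteq> d \<Longrightarrow> merge c d (Poly_Mapping.single k i) = Poly_Mapping.single (if k = d then c else k) i"
  by (intro poly_mapping_eqI) (auto simp: expo_merge lookup_single when_def)

text \<open>
  The quotient by \<open>x\<^sub>d - x\<^sub>c\<close> of a power series that vanishes for \<open>x\<^sub>d = x\<^sub>c\<close>. The explicit formula shows that the
  quotient of a polynomial is again a polynomial (\<open>merge_quot_finite_support\<close>). Multiplied by \<open>x\<^sub>d\<close>
  and by \<open>x\<^sub>c\<close>, the quotient has as coefficients sums of the same terms over \<open>i \<ge> 0\<close> and over \<open>i \<ge> 1\<close>, which
  differ by the term \<open>mfps_coeff g m\<close>. If \<open>x\<^sub>d\<close> does not occur in \<open>m\<close>, the product with \<open>x\<^sub>d\<close> contributes
  nothing; then the sum over \<open>i \<ge> 0\<close> is a coefficient of the series after the substitution, and so it is zero.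
\<close>

definition merge_quot :: "nat \<Rightarrow> nat \<Rightarrow> 'a::comm_ring_1 mfps \<Rightarrow> 'a mfps" where
  "merge_quot c d g = Abs_mfps (\<lambda>m. \<Sum>i\<le>expo m c.
     mfps_coeff g (m + Poly_Mapping.single d (Suc i) - Poly_Mapping.single c i))"

lemma merge_quot:
  assumes cd: "c \<noteq> d" and g: "monomial_map.push (merge c d) g = 0"
  shows "g = (mfps_var d - mfps_var c) * merge_quot c d g"
proof (rule mfps_eqI)
  fix m
  interpret monomial_map "merge c d" by (rule monomial_map_merge[OF cd])
  let ?h = "merge_quot c d g"
  let ?t = "\<lambda>i. mfps_coeff g (m + Poly_Mapping.single d i - Poly_Mapping.single c i)"
  have c: "mfps_coeff (mfps_var c * ?h) m = (\<Sum>i<expo m c. ?t (Suc i))"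
  proof (cases "expo m c")
    case (Suc k)
    have "mfps_coeff (mfps_var c * ?h) m = mfps_coeff ?h (m - Poly_Mapping.single c 1)"
      using Suc by (simp add: mfps_coeff_var_mult)
    also have "\<dots> = (\<Sum>i\<le>k. mfps_coeff g (m - Poly_Mapping.single c 1 + Poly_Mapping.single d (Suc i) - Poly_Mapping.single c i))"
      by (simp add: merge_quot_def lookup_minus Suc)
    also have "\<dots> = (\<Sum>i\<le>k. ?t (Suc i))"
    proof (intro sum.cong refl arg_cong[of _ _ "mfps_coeff g"])
      fix i assume "i \<in> {..k}"
      then show "m - Poly_Mapping.single c 1 + Poly_Mapping.single d (Suc i) - Poly_Mapping.single c i
          = m + Poly_Mapping.single d (Suc i) - Poly_Mapping.single c (Suc i)"
        using cd Suc by (intro poly_mapping_eqI) (auto simp: lookup_add lookup_minus lookup_single when_def)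
    qed
    finally show ?thesis by (simp add: Suc lessThan_Suc_atMost)
  qed (simp add: mfps_coeff_var_mult)
  show "mfps_coeff g m = mfps_coeff ((mfps_var d - mfps_var c) * ?h) m"
  proof (cases "expo m d = 0")
    case True
    have inj: "inj_on (\<lambda>i. m + Poly_Mapping.single d i - Poly_Mapping.single c i) {..expo m c}"
    proof (rule inj_onI)
      fix i j assume eq: "m + Poly_Mapping.single d i - Poly_Mapping.single c i = m + Poly_Mapping.single d j - Poly_Mapping.single c j"
      show "i = j"
        using arg_cong[OF eq, of "\<lambda>m. expo m d"] cd by (simp add: lookup_add lookup_minus lookup_single when_def)
    qed
    have "0 = mfps_coeff (push g) m" by (simp add: g)
    also have "\<dots> = (\<Sum>i\<le>expo m c. ?t i)"
      unfolding coeff_push merge_fibre[OF cd] using True inj by (simp add: sum.reindex)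
    also have "\<dots> = ?t 0 + (\<Sum>i<expo m c. ?t (Suc i))"
      by (simp only: lessThan_Suc_atMost[symmetric] sum.lessThan_Suc_shift)
    finally have "mfps_coeff g m = - (\<Sum>i<expo m c. ?t (Suc i))"
      by (simp add: eq_neg_iff_add_eq_0)
    then show ?thesis using c True by (simp add: left_diff_distrib mfps_coeff_var_mult[of d])
  next
    case False
    have "mfps_coeff (mfps_var d * ?h) m = mfps_coeff ?h (m - Poly_Mapping.single d 1)"
      using False by (simp add: mfps_coeff_var_mult)
    also have "\<dots> = (\<Sum>i\<le>expo m c. mfps_coeff g (m - Poly_Mapping.single d 1 + Poly_Mapping.single d (Suc i) - Poly_Mapping.single c i))"
      using cd by (simp add: merge_quot_def lookup_minus lookup_single when_def)
    also have "\<dots> = (\<Sum>i\<le>expo m c. ?t i)"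
    proof (intro sum.cong refl arg_cong[of _ _ "mfps_coeff g"])
      fix i
      show "m - Poly_Mapping.single d 1 + Poly_Mapping.single d (Suc i) - Poly_Mapping.single c i
          = m + Poly_Mapping.single d i - Poly_Mapping.single c i"
        using cd False by (intro poly_mapping_eqI) (auto simp: lookup_add lookup_minus lookup_single when_def)
    qed
    also have "\<dots> = ?t 0 + (\<Sum>i<expo m c. ?t (Suc i))"
      by (simp only: lessThan_Suc_atMost[symmetric] sum.lessThan_Suc_shift)
    finally show ?thesis using c by (simp add: left_diff_distrib)
  qed
qed

lemma merge_quot_finite_support:
  assumes cd: "c \<noteq> d" and g: "finite {m. mfps_coeff g m \<noteq> 0}"
  shows "finite {m. mfps_coeff (merge_quot c d g) m \<noteq> 0}"
proof (rule finite_subset)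
  let ?f = "\<lambda>(m, i). m + Poly_Mapping.single c i - Poly_Mapping.single d (Suc i)"
  let ?S = "Sigma {m. mfps_coeff g m \<noteq> 0} (\<lambda>m. {..<expo m d})"
  show "finite (?f ` ?S)" using g by auto
  show "{m. mfps_coeff (merge_quot c d g) m \<noteq> 0} \<subseteq> ?f ` ?S"
  proof
    fix m assume "m \<in> {m. mfps_coeff (merge_quot c d g) m \<noteq> 0}"
    then have "(\<Sum>i\<le>expo m c. mfps_coeff g (m + Poly_Mapping.single d (Suc i) - Poly_Mapping.single c i)) \<noteq> 0"
      by (simp add: merge_quot_def)
    then obtain i where i: "i \<le> expo m c" "mfps_coeff g (m + Poly_Mapping.single d (Suc i) - Poly_Mapping.single c i) \<noteq> 0"
      by (auto elim: sum.not_neutral_contains_not_neutral)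
    have "m = ?f (m + Poly_Mapping.single d (Suc i) - Poly_Mapping.single c i, i)"
      using cd i(1) by (auto intro!: poly_mapping_eqI simp: lookup_add lookup_minus lookup_single when_def)
    moreover have "(m + Poly_Mapping.single d (Suc i) - Poly_Mapping.single c i, i) \<in> ?S"
      using cd i(2) by (simp add: lookup_add lookup_minus lookup_single when_def)
    ultimately show "m \<in> ?f ` ?S" by blast
  qed
qed

subsection \<open>Polynomials as power series\<close>

text \<open>
  The integrality of the \<open>P\<close>-functions is proved for power series. Polynomials are treated at the same time
  by viewing them as the power series of finite support.
\<close>

definition mfps_of_mpoly :: "'a::comm_ring_1 mpoly \<Rightarrow> 'a mfps" where
  "mfps_of_mpoly p = Abs_mfps (Poly_Mapping.lookup p)"

lemma mfps_coeff_of_mpoly [simp]: "mfps_coeff (mfps_of_mpoly p) = Poly_Mapping.lookup p"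
  by (simp add: mfps_of_mpoly_def)

interpretation mfps_of_mpoly: inj_comm_ring_hom "mfps_of_mpoly :: 'a::comm_ring_1 mpoly \<Rightarrow> 'a mfps"
proof
  fix p q :: "'a mpoly"
  show "mfps_of_mpoly 0 = (0 :: 'a mfps)" "mfps_of_mpoly (p + q) = mfps_of_mpoly p + mfps_of_mpoly q"
    by (rule mfps_eqI, simp add: lookup_add)+
  show "mfps_of_mpoly 1 = (1 :: 'a mfps)"
    by (rule mfps_eqI) (auto simp: mfps_coeff_1 lookup_one when_def)
  show "mfps_of_mpoly (p * q) = mfps_of_mpoly p * mfps_of_mpoly q"
  proof (rule mfps_eqI)
    fix m
    let ?t = "\<lambda>(a, b). Poly_Mapping.lookup p a * Poly_Mapping.lookup q b when m = a + b"
    have "Poly_Mapping.lookup (p * q) m = Sum_any ?t"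
      unfolding times_poly_mapping.rep_eq by (rule prod_fun_unfold_prod) simp_all
    also have "\<dots> = sum ?t (splittings m)"
      by (rule Sum_any.expand_superset[OF finite_splittings]) (auto simp: splittings_def)
    also have "\<dots> = mfps_coeff (mfps_of_mpoly p * mfps_of_mpoly q) m"
      unfolding mfps_coeff_mult by (rule sum.cong) (auto simp: splittings_def)
    finally show "mfps_coeff (mfps_of_mpoly (p * q)) m = mfps_coeff (mfps_of_mpoly p * mfps_of_mpoly q) m"
      by simp
  qed
  show "p = 0" if "mfps_of_mpoly p = 0"
  proof (rule poly_mapping_eqI)
    fix m
    show "Poly_Mapping.lookup p m = Poly_Mapping.lookup 0 m"
      using arg_cong[OF that, of "\<lambda>g. mfps_coeff g m"] by simp
  qed
qed

lemma range_mfps_of_mpoly: "range mfps_of_mpoly = {g. finite {m. mfps_coeff g m \<noteq> 0}}"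
proof
  show "{g :: 'a mfps. finite {m. mfps_coeff g m \<noteq> 0}} \<subseteq> range mfps_of_mpoly"
  proof
    fix g :: "'a mfps" assume "g \<in> {g. finite {m. mfps_coeff g m \<noteq> 0}}"
    then have "g = mfps_of_mpoly (Abs_poly_mapping (mfps_coeff g))"
      by (intro mfps_eqI) simp
    then show "g \<in> range mfps_of_mpoly" by (rule range_eqI)
  qed
qed auto

lemma mfps_of_mpoly_var [simp]: "mfps_of_mpoly (mpoly_var i) = mfps_var i"
  by (rule mfps_eqI) (auto simp: mpoly_var_def mfps_coeff_var lookup_single when_def)

lemma mfps_of_mpoly_const [simp]: "mfps_of_mpoly (mpoly_const c) = mfps_const c"
  by (rule mfps_eqI) (auto simp: mpoly_const_def mfps_coeff_const lookup_single when_def)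

lemma mpoly_const_0 [simp]: "mpoly_const 0 = 0"
  by (simp add: mpoly_const_def)

lemma vars_diff_single: "0 < expo m i \<Longrightarrow> vars (m - Poly_Mapping.single i (Suc 0)) \<subseteq> {i} \<longleftrightarrow> vars m \<subseteq> {i}"
  by (auto simp: subset_iff in_keys_iff lookup_minus lookup_single when_def split: if_splits)

lemma fps_at_var_poly: "fps_at_var (fps_of_poly p) i = mfps_of_mpoly (poly_at_var p i)"
proof (induction p)
  case 0
  then show ?case by (simp add: poly_at_var_def) (rule mfps_eqI, simp add: fps_at_var_def)
next
  case (pCons a p)
  have "mfps_of_mpoly (poly_at_var (pCons a p) i) = mfps_const a + mfps_var i * fps_at_var (fps_of_poly p) i"
    using pCons by (simp add: poly_at_var_def map_poly_pCons mfps_of_mpoly.hom_add mfps_of_mpoly.hom_mult)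
  also have "\<dots> = fps_at_var (fps_of_poly (pCons a p)) i"
  proof (rule mfps_eqI)
    fix m
    have "vars m \<subseteq> {i} \<and> expo m i = 0 \<longleftrightarrow> m = 0"
      by (auto simp: subset_iff in_keys_iff intro!: poly_mapping_eqI)
    then show "mfps_coeff (mfps_const a + mfps_var i * fps_at_var (fps_of_poly p) i) m
        = mfps_coeff (fps_at_var (fps_of_poly (pCons a p)) i) m"
      by (auto simp: mfps_coeff_const mfps_coeff_var_mult fps_at_var_def vars_diff_single lookup_minus
          coeff_pCons split: nat.splits)
  qed
  finally show ?case ..
qed

section \<open>Integrality of the P-functions\<close>

lemma pair_prod_append_single:
  "pair_prod w (A @ [x]) = pair_prod w A * (\<Prod>y\<leftarrow>A. w y x)"
  by (induction A) (simp_all add: mult_ac)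

lemma pair_prod_upt: "pair_prod w [0..<n] = (\<Prod>(i, j) \<in> {(i, j). i < j \<and> j < n}. w i j)"
proof (induction n)
  case (Suc n)
  let ?T = "\<lambda>n. {(i, j). i < j \<and> j < (n::nat)}"
  have "?T n \<subseteq> {..<n} \<times> {..<n}" by auto
  then have fin: "finite (?T n)" by (rule finite_subset) simp
  have "?T (Suc n) = ?T n \<union> {..<n} \<times> {n}" by auto
  then have "(\<Prod>(i, j) \<in> ?T (Suc n). w i j) = (\<Prod>(i, j) \<in> ?T n. w i j) * (\<Prod>(i, j) \<in> {..<n} \<times> {n}. w i j)"
    using fin by (simp only:) (intro prod.union_disjoint, auto)
  also have "(\<Prod>(i, j) \<in> {..<n} \<times> {n}. w i j) = (\<Prod>i<n. w i n)"
    by (simp add: prod.cartesian_product[symmetric])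
  also have "\<dots> = (\<Prod>i\<leftarrow>[0..<n]. w i n)"
    by (simp add: prod.distinct_set_conv_list[symmetric] lessThan_atLeast0)
  finally show ?case using Suc.IH by (simp add: pair_prod_append_single)
qed simp

lemma P_frac_eq_pf:
  "P_frac n x F l =
     pf (block (schur_weight x) (\<lambda>i d. F d i) (\<lambda>_ _. 0)) (map Inl [0..<n] @ map Inr (star n l))
       / pair_prod (schur_weight x) [0..<n]"
proof -
  define \<alpha> where "\<alpha> = star n l"
  define r where "r = length \<alpha>"
  define V where "V = V_mat n F \<alpha>"
  define M where "M = four_block_mat (A_mat n x) V (- transpose_mat V) (0\<^sub>m r r)"
  let ?w = "block (schur_weight x) (\<lambda>i d. F d i) (\<lambda>_ _. 0)"
  let ?lab = "\<lambda>i. if i < n then Inl i else Inr (\<alpha> ! (i - n))"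
  have dim: "dim_row M = n + r"
    by (simp add: M_def A_mat_def)
  have entry: "M $$ (i, j) = ?w (?lab i) (?lab j)" if "i < n + r" "j < n + r" for i j
  proof -
    have "i - n < r" "j - n < r" if "\<not> i < n" "\<not> j < n" using \<open>i < n + r\<close> \<open>j < n + r\<close> that by auto
    then show ?thesis
      using that by (auto simp: M_def A_mat_def V_def V_mat_def schur_weight_def r_def)
  qed
  have labels: "map ?lab [0..<n + r] = map Inl [0..<n] @ map Inr \<alpha>"
  proof -
    have "map ?lab [0..<n] = map Inl [0..<n]"
      by (rule map_cong) auto
    moreover have "map ?lab [n..<n + r] = map (\<lambda>i. Inr (\<alpha> ! (i - n)) :: nat + nat) [n..<n + r]"
      by (rule map_cong) auto
    moreover have "map (\<lambda>i. Inr (\<alpha> ! (i - n)) :: nat + nat) [n..<n + r] = map Inr \<alpha>"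
      by (rule nth_equalityI) (auto simp: r_def)
    moreover have "[0..<n + r] = [0..<n] @ [n..<n + r]"
      by (rule upt_add_eq_append) simp
    ultimately show ?thesis by (simp only: map_append)
  qed
  have "pfaffian M = pf (\<lambda>i j. ?w (?lab i) (?lab j)) [0..<n + r]"
    unfolding pfaffian_eq_pf dim by (rule pf_cong, rule entry) auto
  also have "\<dots> = pf ?w (map Inl [0..<n] @ map Inr \<alpha>)"
    unfolding labels[symmetric] pf_map ..
  finally show ?thesis
    by (simp add: P_frac_def Let_def Delta_def pair_prod_upt schur_weight_def M_def V_def r_def \<alpha>_def)
qed

interpretation fract: inj_comm_ring_hom "to_fract :: 'a::idom \<Rightarrow> 'a fract"
  by unfold_locales auto

text \<open>
  The subrings to which the integrality argument applies. The two instances are the ring of all power series and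
  the ring of polynomials.
\<close>

locale merge_closed =
  fixes S :: "'a::field_char_0 mfps set"
  assumes zero: "0 \<in> S" and one: "1 \<in> S" and diff: "g \<in> S \<Longrightarrow> h \<in> S \<Longrightarrow> g - h \<in> S"
    and mult: "g \<in> S \<Longrightarrow> h \<in> S \<Longrightarrow> g * h \<in> S" and var: "mfps_var i \<in> S"
    and quot: "c \<noteq> d \<Longrightarrow> g \<in> S \<Longrightarrow> monomial_map.push (merge c d) g = 0 \<Longrightarrow> merge_quot c d g \<in> S"
begin

lemma uminus: "g \<in> S \<Longrightarrow> - g \<in> S"
  using diff[OF zero] by simp

lemma add: "g \<in> S \<Longrightarrow> h \<in> S \<Longrightarrow> g + h \<in> S"
  using diff[OF _ uminus] by fastforce

lemma sum: "(\<And>i. i \<in> I \<Longrightarrow> g i \<in> S) \<Longrightarrow> sum g I \<in> S"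
  by (induction I rule: infinite_finite_induct) (auto intro: zero add)

lemma prod_list: "(\<And>x. x \<in> set L \<Longrightarrow> g x \<in> S) \<Longrightarrow> (\<Prod>x\<leftarrow>L. g x) \<in> S"
  by (induction L) (auto intro: one mult)

lemma pair_prod_remove:
  assumes "\<And>a b. s a b \<in> S"
  shows "\<exists>c\<in>S. pair_prod s (A @ x # B) = c * pair_prod s (A @ B)"
proof (induction A)
  case Nil
  show ?case using assms by (intro bexI[of _ "\<Prod>y\<leftarrow>B. s x y"]) (auto intro: prod_list)
next
  case (Cons a A)
  then obtain c where "c \<in> S" "pair_prod s (A @ x # B) = c * pair_prod s (A @ B)" by blast
  then show ?case
    using assms by (intro bexI[of _ "s a x * c"]) (auto intro: mult simp: mult_ac)
qed

text \<open>
  Every matching uses each pair of labels at most once. So one factor \<open>s a b\<close> for each pair of labels clears the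
  denominators of the whole Pfaffian, although it is a sum of products of several entries.
\<close>

lemma clear_denominators:
  assumes s: "\<And>a b. s a b \<in> S"
    and w: "\<And>a b. a \<in> set L \<Longrightarrow> b \<in> set L \<Longrightarrow> \<exists>N\<in>S. to_fract N = to_fract (s a b) * w a b"
  shows "\<exists>g\<in>S. to_fract g = to_fract (pair_prod s L) * pf w L"
  using w
proof (induction L rule: list_length_induct)
  case (less L)
  show ?case
  proof (cases L)
    case Nil
    then show ?thesis by (auto intro: one)
  next
    case (Cons a L')
    have "\<exists>h\<in>S. to_fract h = to_fract (pair_prod s L) * ((-1) ^ i * (w a (L' ! i) * pf w (del i L')))"
      if i: "i < length L'" for i
    proof -
      define A x B where "A = take i L'" and "x = L' ! i" and "B = drop (Suc i) L'"
      have L': "L' = A @ x # B" unfolding A_def B_def x_def by (rule id_take_nth_drop[OF i])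
      have "\<exists>g\<in>S. to_fract g = to_fract (pair_prod s (A @ B)) * pf w (A @ B)"
        by (rule less.IH) (auto simp: Cons L' intro!: less.prems)
      then obtain g where g: "g \<in> S" "to_fract g = to_fract (pair_prod s (A @ B)) * pf w (A @ B)" by blast
      obtain N where N: "N \<in> S" "to_fract N = to_fract (s a x) * w a x"
        using less.prems[of a x] by (auto simp: Cons L')
      obtain c where c: "c \<in> S" "pair_prod s (A @ x # B) = c * pair_prod s (A @ B)"
        using pair_prod_remove[of s, OF s] by blast
      let ?q = "\<Prod>y\<leftarrow>A @ B. s a y"
      have p: "pair_prod s L = s a x * ?q * (c * pair_prod s (A @ B))"
        by (simp add: Cons L' c(2) mult_ac)
      have "to_fract ((-1) ^ i * (?q * c * N * g))
          = to_fract (pair_prod s L) * ((-1) ^ i * (w a x * pf w (A @ B)))"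
        unfolding p by (simp add: fract.hom_mult fract.hom_power N(2) g(2) mult_ac)
      moreover have "(-1) ^ i * (?q * c * N * g) \<in> S"
      proof -
        have "(-1) ^ i \<in> S" using one uminus[OF one] by (cases "even i") auto
        moreover have "?q \<in> S" by (intro prod_list s)
        ultimately show ?thesis using c(1) N(1) g(1) by (intro mult)
      qed
      ultimately show ?thesis
        by (intro bexI[of _ "(-1) ^ i * (?q * c * N * g)"]) (simp_all add: A_def B_def x_def del_def)
    qed
    then obtain h where h: "\<And>i. i < length L' \<Longrightarrow> h i \<in> S"
      "\<And>i. i < length L' \<Longrightarrow> to_fract (h i) = to_fract (pair_prod s L) * ((-1) ^ i * (w a (L' ! i) * pf w (del i L')))"
      by metis
    have "to_fract (\<Sum>i<length L'. h i) = to_fract (pair_prod s L) * pf w L"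
      unfolding fract.hom_sum by (simp add: h(2) Cons pf.simps sum_distrib_left)
    moreover have "(\<Sum>i<length L'. h i) \<in> S" by (intro sum) (simp add: h(1))
    ultimately show ?thesis by blast
  qed
qed

lemma push_merge_var:
  assumes "c \<noteq> d"
  shows "monomial_map.push (merge c d) (mfps_var k) = (mfps_var (if k = d then c else k) :: 'a mfps)"
proof -
  interpret monomial_map "merge c d" by (rule monomial_map_merge[OF assms])
  show ?thesis
    using push_fps_at_var[of k "if k = d then c else k" fps_X] merge_single[OF assms] by simp
qed

text \<open>
  The differences can be divided out one after the other, since substituting \<open>x\<^sub>c\<close> for \<open>x\<^sub>d\<close> annihilates none of
  the differences of other pairs, and the ring has no zero divisors.
\<close>

lemma divide_by_differences:
  assumes "finite T" "T \<subseteq> {(c, d). c < d}" "g \<in> S"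
    and "\<And>c d. (c, d) \<in> T \<Longrightarrow> monomial_map.push (merge c d) g = 0"
  shows "\<exists>h\<in>S. g = (\<Prod>(c, d)\<in>T. mfps_var d - mfps_var c) * h"
  using assms
proof (induction T)
  case empty
  then show ?case by auto
next
  case (insert p T)
  obtain c d where p: "p = (c, d)" by (cases p)
  have cd: "c < d" using insert.prems p by auto
  then have cd': "c \<noteq> d" by simp
  interpret monomial_map "merge c d" by (rule monomial_map_merge[OF cd'])
  obtain h where h: "h \<in> S" "g = (\<Prod>(c, d)\<in>T. mfps_var d - mfps_var c) * h"
    using insert.IH insert.prems by auto
  have "push (mfps_var b - mfps_var a) \<noteq> (0 :: 'a mfps)" if "(a, b) \<in> T" for a b
    using that insert.prems(1) insert.hyps(2) cd
    by (auto simp: push.hom_minus push_merge_var[OF cd'] p split: if_splits)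
  then have "push (\<Prod>(c, d)\<in>T. mfps_var d - mfps_var c) \<noteq> (0 :: 'a mfps)"
    using insert.hyps(1) by (auto simp: push.hom_prod)
  moreover have "push (\<Prod>(c, d)\<in>T. mfps_var d - mfps_var c) * push h = 0"
    using insert.prems(3)[of c d] h(2) by (simp add: p push.hom_mult)
  ultimately have h0: "push h = 0" by simp
  have "g = (\<Prod>(c, d)\<in>insert p T. mfps_var d - mfps_var c) * merge_quot c d h"
    using insert.hyps h(2) merge_quot[OF cd' h0] by (simp add: p mult_ac)
  then show ?case using quot[OF cd' h(1) h0] by blast
qed

text \<open>
  By \<open>clear_denominators\<close>, the product of all \<open>x\<^sub>i + x\<^sub>j\<close> with \<open>i < j\<close> times the Pfaffian is an element \<open>g\<close> of the ring, and
  \<open>g\<close> has to be divisible by all \<open>x\<^sub>d - x\<^sub>c\<close> with \<open>c < d\<close>. The substitution of \<open>x\<^sub>c\<close> for \<open>x\<^sub>d\<close> is not defined on fractions, so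
  the whole matrix is first multiplied by a common denominator \<open>E\<close>. The resulting matrix \<open>G\<close> has two equal
  rows after the substitution, and its Pfaffian agrees with \<open>g\<close> up to factors that do not vanish under
  the substitution.
\<close>

theorem P_frac_integral:
  fixes F :: "nat \<Rightarrow> nat \<Rightarrow> 'a mfps"
  assumes FS: "\<And>k i. F k i \<in> S"
    and F: "\<And>c d k i. c \<noteq> d \<Longrightarrow> monomial_map.push (merge c d) (F k i) = F k (if i = d then c else i)"
  shows "\<exists>h\<in>S. to_fract h = P_frac n (\<lambda>i. to_fract (mfps_var i)) (\<lambda>k i. to_fract (F k i)) l"
proof -
  define x where "x = (\<lambda>i. to_fract (mfps_var i :: 'a mfps))"
  define w where "w = block (schur_weight x) (\<lambda>i d. to_fract (F d i)) (\<lambda>_ _. 0)"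
  define L where "L = (map Inl [0..<n] @ map Inr (star n l) :: (nat + nat) list)"
  define s where "s = block (\<lambda>i j. mfps_var i + mfps_var j) (\<lambda>_ _. 1) (\<lambda>_ _ :: nat. 1 :: 'a mfps)"
  define E where "E = (\<Prod>(i, j)\<in>{..<n} \<times> {..<n}. mfps_var i + mfps_var j :: 'a mfps)"
  define T where "T = {(i, j). i < j \<and> j < n}"
  have x: "x i + x j \<noteq> 0" for i j
    unfolding x_def fract.hom_add[symmetric] fract.hom_0_iff by (rule mfps_var_add_nonzero)
  have sS: "s a b \<in> S" for a b
    by (cases a; cases b) (auto simp: s_def intro: add var one uminus)
  have "T \<subseteq> {..<n} \<times> {..<n}" by (auto simp: T_def)
  then have finT: "finite T" by (rule finite_subset) simp

  have "\<exists>g\<in>S. to_fract g = to_fract (pair_prod s L) * pf w L"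
  proof (rule clear_denominators[OF sS])
    fix a b
    show "\<exists>N\<in>S. to_fract N = to_fract (s a b) * w a b"
    proof (cases a)
      case (Inl i)
      show ?thesis
      proof (cases b)
        case b: (Inl j)
        have "to_fract (mfps_var i + mfps_var j :: 'a mfps) = x j + x i"
          unfolding x_def fract.hom_add by (rule add.commute)
        then have "to_fract (mfps_var j - mfps_var i) = to_fract (s a b) * w a b"
          using x[of j i] by (simp add: Inl b s_def w_def schur_weight_def) (simp add: x_def)
        then show ?thesis using diff[OF var var] by metis
      next
        case (Inr k)
        then show ?thesis using FS[of k i] by (auto simp: Inl s_def w_def)
      qed
    next
      case (Inr k)
      then show ?thesis
        using FS zero by (cases b) (auto simp: s_def w_def fract.hom_uminus)
    qed
  qed
  then obtain g where g: "g \<in> S" "to_fract g = to_fract (pair_prod s L) * pf w L" by blast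

  \<comment> \<open>\<open>B\<close> is \<open>E\<close> times the block \<open>A(x)\<close>, filled up by zeros so as to be skew-symmetric for all labels.\<close>
  have "\<exists>N. if i < n \<and> j < n then N * (mfps_var i + mfps_var j) = E * (mfps_var j - mfps_var i) else N = 0" for i j
  proof (cases "i < n \<and> j < n")
    case True
    have "E = (mfps_var i + mfps_var j) * (\<Prod>(i, j)\<in>{..<n} \<times> {..<n} - {(i, j)}. mfps_var i + mfps_var j)"
      unfolding E_def using True by (subst prod.remove[of _ "(i, j)"]) auto
    then show ?thesis
      using True by (intro exI[of _ "(\<Prod>(i, j)\<in>{..<n} \<times> {..<n} - {(i, j)}. mfps_var i + mfps_var j) * (mfps_var j - mfps_var i)"])
        (simp add: mult_ac)
  qed auto
  note ex = this
  define B where "B i j = (SOME N. if i < n \<and> j < n then N * (mfps_var i + mfps_var j) = E * (mfps_var j - mfps_var i) else N = 0)" for i j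
  have B: "if i < n \<and> j < n then B i j * (mfps_var i + mfps_var j) = E * (mfps_var j - mfps_var i) else B i j = 0" for i j
    unfolding B_def by (rule someI_ex) (rule ex)
  have B_eq: "B i j * (mfps_var i + mfps_var j) = E * (mfps_var j - mfps_var i)" if "i < n" "j < n" for i j
    using B[of i j] that by simp
  have B_0: "B i j = 0" if "\<not> (i < n \<and> j < n)" for i j
    using B[of i j] that by simp
  have skewB: "B i j = - B j i" for i j
  proof (cases "i < n \<and> j < n")
    case True
    have "B j i * (mfps_var i + mfps_var j) = E * (mfps_var i - mfps_var j)"
      using B_eq[of j i] True by (simp add: add.commute)
    then have "(B i j + B j i) * (mfps_var i + mfps_var j) = E * (mfps_var j - mfps_var i) + E * (mfps_var i - mfps_var j)"
      using B_eq[of i j] True by (simp only: distrib_right)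
    then have "(B i j + B j i) * (mfps_var i + mfps_var j) = 0"
      by (simp add: right_diff_distrib)
    then show ?thesis by (simp add: eq_neg_iff_add_eq_0)
  qed (use B_0[of i j] B_0[of j i] in auto)
  have "B i i = 0" for i
  proof (cases "i < n")
    case True
    then have "B i i * (mfps_var i + mfps_var i) = 0" using B_eq[of i i] by simp
    then have "B i i = 0 \<or> mfps_var i + mfps_var i = (0 :: 'a mfps)" by (simp only: mult_eq_0_iff)
    then show ?thesis using mfps_var_add_nonzero[of i i] by blast
  qed (simp add: B_0)
  then have skewB: "skew B" by (intro skew.intro skewB)
  define G where "G = block B (\<lambda>i d. E * F d i) (\<lambda>_ _. 0)"
  have G: "to_fract (G a b) = to_fract E * w a b" if "a \<in> set L" "b \<in> set L" for a b
  proof -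
    have "to_fract (B i j) = to_fract E * schur_weight x i j" if "i < n" "j < n" for i j
    proof -
      have "to_fract (B i j) * (x i + x j) = to_fract E * (x j - x i)"
        using arg_cong[OF B_eq[OF that], of to_fract] by (simp add: x_def)
      then show ?thesis using x[of i j] x[of j i] by (simp add: schur_weight_def field_simps)
    qed
    then show ?thesis
      using that by (cases a; cases b) (auto simp: G_def w_def L_def)
  qed
  have "to_fract (pf G L) = pf (\<lambda>a b. to_fract (G a b)) L" by (rule fract.hom_pf)
  also have "\<dots> = pf (\<lambda>a b. to_fract E * w a b) L" by (rule pf_cong) (rule G)
  also have "\<dots> = to_fract E ^ (length L div 2) * pf w L"
    by (rule pf_scale) (simp add: L_def star_def)
  finally have "to_fract (pair_prod s L * pf G L) = to_fract (E ^ (length L div 2) * g)"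
    by (simp add: g(2) fract.hom_power mult_ac)
  then have cleared: "pair_prod s L * pf G L = E ^ (length L div 2) * g" by (simp only: to_fract_eq_iff)

  have g0: "monomial_map.push (merge c d) g = 0" if cd: "c < d" "d < n" for c d
  proof -
    have cd': "c \<noteq> d" using cd by simp
    interpret monomial_map "merge c d" by (rule monomial_map_merge[OF cd'])
    let ?v = "\<lambda>k. mfps_var (if k = d then c else k) :: 'a mfps"
    have v: "push (mfps_var k) = ?v k" for k by (rule push_merge_var[OF cd'])
    have "push (B c j) = push (B d j)" for j
    proof (cases "j < n")
      case True
      have "push (B c j) * (?v c + ?v j) = push (B d j) * (?v d + ?v j)"
        using arg_cong[OF B_eq[of c j], of push] arg_cong[OF B_eq[of d j], of push] cd True
        by (simp add: push.hom_mult push.hom_add push.hom_minus v)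
      then show ?thesis by simp
    qed (simp add: B_0)
    then have rows: "push (G (Inl c) z) = push (G (Inl d) z)" for z
      using cd' by (cases z) (simp_all add: G_def push.hom_mult F)
    have "skew (\<lambda>a b. push (G a b))"
    proof -
      interpret G: skew G unfolding G_def by (rule skew_block[OF skewB skew_zero])
      show ?thesis
      proof
        fix a b
        show "push (G a b) = - push (G b a)"
          unfolding push.hom_uminus[symmetric] by (subst G.skew) (rule refl)
      qed (simp add: G.diag)
    qed
    then have "pf (\<lambda>a b. push (G a b)) L = 0"
      by (rule skew.pf_equal_rows[of _ "Inl c" "Inl d", OF _ rows]) (use cd in \<open>auto simp: L_def\<close>)
    then have "push (E ^ (length L div 2)) * push g = 0"
      using arg_cong[OF cleared, of push] by (simp add: push.hom_mult push.hom_pf)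
    moreover have "push E \<noteq> 0"
      by (auto simp: E_def push.hom_prod push.hom_add v)
    ultimately show "push g = 0" by (simp add: push.hom_power)
  qed

  have "\<exists>h\<in>S. g = (\<Prod>(c, d)\<in>T. mfps_var d - mfps_var c) * h"
    using finT g(1) g0 by (intro divide_by_differences) (auto simp: T_def)
  then obtain h where h: "h \<in> S" "g = (\<Prod>(c, d)\<in>T. mfps_var d - mfps_var c) * h" by blast
  have "pair_prod s L = (\<Prod>(i, j)\<in>T. mfps_var i + mfps_var j)"
  proof -
    have const: "(\<Prod>k\<leftarrow>ks. 1) = (1 :: 'a mfps)" for ks :: "nat list" by (induction ks) simp_all
    have 1: "pair_prod s (map Inr ks) = 1" for ks by (induction ks) (simp_all add: s_def o_def const)
    have "pair_prod s (map Inl is @ map Inr ks) = pair_prod (\<lambda>i j. mfps_var i + mfps_var j) is" for "is" ks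
      by (induction "is") (simp_all add: 1, simp_all add: s_def o_def const)
    then show ?thesis by (simp add: L_def pair_prod_upt T_def)
  qed
  moreover define D Q where "D = (\<Prod>(c, d)\<in>T. mfps_var d - mfps_var c :: 'a mfps)"
    and "Q = (\<Prod>(i, j)\<in>T. mfps_var i + mfps_var j :: 'a mfps)"
  ultimately have 1: "to_fract D * to_fract h = to_fract Q * pf w L"
    using g(2) h(2) by (simp add: D_def Q_def)
  have 2: "pair_prod (schur_weight x) [0..<n] = to_fract D / to_fract Q"
    unfolding pair_prod_upt T_def[symmetric] D_def Q_def fract.hom_prod prod_dividef[symmetric]
    by (rule prod.cong) (auto simp: schur_weight_def x_def fract.hom_add fract.hom_minus add.commute)
  have "D \<noteq> 0" "Q \<noteq> 0"
    using finT by (auto simp: T_def D_def Q_def)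
  then have "to_fract D \<noteq> 0" "to_fract Q \<noteq> 0" by simp_all
  with 1 have "to_fract h = pf w L / pair_prod (schur_weight x) [0..<n]"
    unfolding 2 by (simp add: field_simps)
  then show ?thesis
    using h(1) by (auto simp: P_frac_eq_pf x_def w_def L_def)
qed

end

section \<open>Transport along ring homomorphisms\<close>

text \<open>
  The two families of \<open>P\<close>-functions live in different rings, both of which embed into the ring \<open>K[x][[y]]\<close>
  of the identity. The extension of an embedding to the fields of fractions maps the quotient \<open>P_frac\<close> to
  the one formed from the images of its entries.
\<close>

lemma fract_exhaust:
  obtains a b where "z = to_fract a / to_fract b" "b \<noteq> (0 :: 'a::idom)"
  by (cases z) (auto simp: Fract_conv_to_fract)

definition fract_map :: "('a::idom \<Rightarrow> 'b::idom) \<Rightarrow> 'a fract \<Rightarrow> 'b fract" where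
  "fract_map h z = (THE w. \<exists>a b. b \<noteq> 0 \<and> z = to_fract a / to_fract b \<and> w = to_fract (h a) / to_fract (h b))"

lemma fract_map_quotient:
  assumes "inj_comm_ring_hom h" "b \<noteq> 0"
  shows "fract_map h (to_fract a / to_fract b) = to_fract (h a) / to_fract (h b)"
  unfolding fract_map_def
proof (rule the_equality)
  interpret h: inj_comm_ring_hom h by fact
  show "\<exists>a' b'. b' \<noteq> 0 \<and> to_fract a / to_fract b = to_fract a' / to_fract b' \<and>
      to_fract (h a) / to_fract (h b) = to_fract (h a') / to_fract (h b')"
    using assms(2) by blast
  fix w
  assume "\<exists>a' b'. b' \<noteq> 0 \<and> to_fract a / to_fract b = to_fract a' / to_fract b' \<and> w = to_fract (h a') / to_fract (h b')"
  then obtain a' b' where *: "b' \<noteq> 0" "to_fract a / to_fract b = to_fract a' / to_fract b'"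
    "w = to_fract (h a') / to_fract (h b')" by blast
  have "to_fract (a * b') = to_fract (a' * b)"
    using *(1,2) assms(2) by (simp add: field_simps)
  then have "a * b' = a' * b" by (simp only: to_fract_eq_iff)
  then have "h a * h b' = h a' * h b" by (metis h.hom_mult)
  then have "to_fract (h a) * to_fract (h b') = to_fract (h a') * to_fract (h b)"
    by (simp only: to_fract_mult[symmetric])
  then show "w = to_fract (h a) / to_fract (h b)"
    using *(1,3) assms(2) by (simp add: frac_eq_eq)
qed

lemma fract_map_to_fract:
  assumes "inj_comm_ring_hom h"
  shows "fract_map h (to_fract a) = to_fract (h a)"
proof -
  interpret h: inj_comm_ring_hom h by fact
  show ?thesis using fract_map_quotient[OF assms, of 1 a] by simp
qed

lemma field_hom_fract_map:
  fixes h :: "'a::idom \<Rightarrow> 'b::idom"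
  assumes "inj_comm_ring_hom h"
  shows "field_hom (fract_map h)"
proof
  interpret h: inj_comm_ring_hom h by fact
  note q = fract_map_quotient[OF assms]
  fix z w :: "'a fract"
  show "fract_map h 0 = 0" "fract_map h 1 = 1"
    using fract_map_to_fract[OF assms, of 0] fract_map_to_fract[OF assms, of 1] by simp_all
  obtain a b c d where zw: "z = to_fract a / to_fract b" "b \<noteq> 0" "w = to_fract c / to_fract d" "d \<noteq> 0"
    by (metis fract_exhaust)
  have bd: "b * d \<noteq> 0" using zw by simp
  have "z + w = to_fract (a * d + c * b) / to_fract (b * d)" "z * w = to_fract (a * c) / to_fract (b * d)"
    using zw by (simp_all add: add_frac_eq)
  then have "fract_map h (z + w) = to_fract (h (a * d + c * b)) / to_fract (h (b * d))"
    "fract_map h (z * w) = to_fract (h (a * c)) / to_fract (h (b * d))"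
    by (simp_all only: q[OF bd])
  then show "fract_map h (z + w) = fract_map h z + fract_map h w" "fract_map h (z * w) = fract_map h z * fract_map h w"
    using zw(2,4) by (simp_all add: zw(1,3) q h.hom_add h.hom_mult add_frac_eq)
qed

lemma (in comm_ring_hom) hom_block:
  "hom (block A V B u v) = block (\<lambda>x y. hom (A x y)) (\<lambda>x k. hom (V x k)) (\<lambda>k l. hom (B k l)) u v"
  by (cases u; cases v) (simp_all add: hom_uminus)

lemma (in comm_ring_hom) hom_pair_prod: "hom (pair_prod w L) = pair_prod (\<lambda>x y. hom (w x y)) L"
  by (induction L) (simp_all add: hom_mult hom_prod_list o_def)

lemma (in field_hom) hom_divide: "hom (x / y) = hom x / hom y"
  by (simp add: divide_inverse hom_mult hom_inverse)

lemma (in field_hom) hom_P_frac: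
  "hom (P_frac n x F l) = P_frac n (\<lambda>i. hom (x i)) (\<lambda>d i. hom (F d i)) l"
proof -
  have [simp]: "hom (schur_weight x i j) = schur_weight (\<lambda>i. hom (x i)) i j" for i j
    by (simp add: schur_weight_def hom_divide hom_minus hom_add)
  show ?thesis
    by (simp add: P_frac_eq_pf hom_divide hom_pf hom_block hom_pair_prod)
qed

section \<open>The P-functions as elements of their rings\<close>

lemma push_merge_fps_at_var:
  assumes "c \<noteq> d"
  shows "monomial_map.push (merge c d) (fps_at_var g i) = fps_at_var g (if i = d then c else i)"
proof -
  interpret monomial_map "merge c d" by (rule monomial_map_merge[OF assms])
  show ?thesis using push_fps_at_var[of i "if i = d then c else i" g] merge_single[OF assms, of i] by simp
qed

lemma merge_closed_UNIV: "merge_closed UNIV"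
  by unfold_locales auto

lemma merge_closed_polynomials: "merge_closed (range mfps_of_mpoly)"
proof
  fix g h :: "'a mfps" and i c d :: nat
  show "0 \<in> range (mfps_of_mpoly :: 'a mpoly \<Rightarrow> _)" "1 \<in> range (mfps_of_mpoly :: 'a mpoly \<Rightarrow> _)"
    by (metis rangeI mfps_of_mpoly.hom_zero, metis rangeI mfps_of_mpoly.hom_one)
  show "mfps_var i \<in> range (mfps_of_mpoly :: 'a mpoly \<Rightarrow> _)"
    by (metis rangeI mfps_of_mpoly_var)
  assume g: "g \<in> range mfps_of_mpoly"
  then show "g - h \<in> range mfps_of_mpoly" "g * h \<in> range mfps_of_mpoly" if "h \<in> range mfps_of_mpoly"
    using that by (auto simp flip: mfps_of_mpoly.hom_minus mfps_of_mpoly.hom_mult)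
  show "merge_quot c d g \<in> range mfps_of_mpoly" if "c \<noteq> d"
    using g that merge_quot_finite_support unfolding range_mfps_of_mpoly by blast
qed

lemma to_fract_dual_P_fun:
  "to_fract (dual_P_fun f n l) = P_frac n (\<lambda>i. to_fract (mfps_var i)) (\<lambda>d i. to_fract (fps_at_var (dual f d) i)) l"
proof -
  interpret merge_closed "UNIV :: 'a mfps set" by (rule merge_closed_UNIV)
  obtain h where "to_fract h = P_frac n (\<lambda>i. to_fract (mfps_var i)) (\<lambda>d i. to_fract (fps_at_var (dual f d) i)) l"
    using P_frac_integral[of "\<lambda>d i. fps_at_var (dual f d) i" n l, OF UNIV_I push_merge_fps_at_var] by blast
  then show ?thesis unfolding dual_P_fun_def by (metis of_fract_to_fract)
qed

lemma to_fract_P_fun: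
  "to_fract (P_fun f n l) = P_frac n (\<lambda>i. to_fract (mpoly_var i)) (\<lambda>d i. to_fract (poly_at_var (f d) i)) l"
    (is "_ = ?P")
proof -
  let ?h = "mfps_of_mpoly :: 'a mpoly \<Rightarrow> 'a mfps"
  interpret merge_closed "range ?h" by (rule merge_closed_polynomials)
  have inj: "inj_comm_ring_hom ?h" by (rule mfps_of_mpoly.inj_comm_ring_hom_axioms)
  interpret H: field_hom "fract_map ?h" by (rule field_hom_fract_map[OF inj])
  have "\<exists>g\<in>range ?h. to_fract g = P_frac n (\<lambda>i. to_fract (mfps_var i)) (\<lambda>d i. to_fract (?h (poly_at_var (f d) i))) l"
    using push_merge_fps_at_var[where g = "fps_of_poly (f _)"]
    by (intro P_frac_integral) (simp_all add: fps_at_var_poly)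
  then obtain p where "to_fract (?h p) = P_frac n (\<lambda>i. to_fract (mfps_var i)) (\<lambda>d i. to_fract (?h (poly_at_var (f d) i))) l"
    by blast
  also have "\<dots> = fract_map ?h ?P"
    by (simp add: H.hom_P_frac fract_map_to_fract[OF inj])
  finally have "fract_map ?h (to_fract p) = fract_map ?h ?P"
    by (simp add: fract_map_to_fract[OF inj])
  then have "to_fract p = ?P" by simp
  then show ?thesis unfolding P_fun_def by (metis of_fract_to_fract)
qed

lemma mfps_coeff_map [simp]: "mfps_coeff (mfps_map h g) m = h (mfps_coeff g m)"
  by (simp add: mfps_map_def)

lemma inj_hom_mfps_map:
  assumes "inj_comm_ring_hom h"
  shows "inj_comm_ring_hom (mfps_map h)"
proof
  interpret h: inj_comm_ring_hom h by fact
  fix f g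
  show "mfps_map h 0 = 0" "mfps_map h (f + g) = mfps_map h f + mfps_map h g" "mfps_map h 1 = 1"
    by (rule mfps_eqI, simp add: h.hom_add mfps_coeff_1)+
  show "mfps_map h (f * g) = mfps_map h f * mfps_map h g"
    by (rule mfps_eqI) (simp add: mfps_coeff_mult h.hom_sum h.hom_mult split_beta)
  show "f = 0" if "mfps_map h f = 0"
    using that by (auto simp: mfps_eq_iff h.hom_0_iff)
qed

lemma inj_hom_mpoly_const: "inj_comm_ring_hom (mpoly_const :: 'a::comm_ring_1 \<Rightarrow> 'a mpoly)"
proof
  fix a b :: 'a
  show "mpoly_const 0 = (0 :: 'a mpoly)" "mpoly_const 1 = (1 :: 'a mpoly)" "mpoly_const (a + b) = mpoly_const a + mpoly_const b"
    "mpoly_const (a * b) = mpoly_const a * mpoly_const b"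
    by (simp_all add: mpoly_const_def single_add mult_single)
  show "a = 0" if "mpoly_const a = (0 :: 'a mpoly)"
    using that unfolding mpoly_const_def by (metis lookup_single_eq lookup_zero)
qed

lemma inj_hom_mfps_const: "inj_comm_ring_hom (mfps_const :: 'a::comm_ring_1 \<Rightarrow> 'a mfps)"
proof
  fix a b :: 'a
  show "mfps_const 0 = (0 :: 'a mfps)" "mfps_const 1 = (1 :: 'a mfps)" "mfps_const (a + b) = mfps_const a + mfps_const b"
    "mfps_const (a * b) = mfps_const a * mfps_const b"
    by (rule mfps_eqI, simp add: mfps_coeff_const mfps_coeff_1)+
  show "a = 0" if "mfps_const a = (0 :: 'a mfps)"
    using arg_cong[OF that, of "\<lambda>g. mfps_coeff g 0"] by (simp add: mfps_coeff_const)
qed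

lemma mfps_map_var: "h 0 = 0 \<Longrightarrow> h 1 = 1 \<Longrightarrow> mfps_map h (mfps_var i) = mfps_var i"
  by (rule mfps_eqI) (simp add: mfps_coeff_var)

lemma mpoly_const_1 [simp]: "mpoly_const 1 = 1"
  by (simp add: mpoly_const_def)

lemma to_fract_const_P_fun:
  "to_fract (mfps_const (P_fun f n l)) = P_frac n (\<lambda>i. to_fract (mfps_const (mpoly_var i)))
     (\<lambda>d i. to_fract (mfps_const (poly_at_var (f d) i))) l"
proof -
  note inj = inj_hom_mfps_const[where 'a = "'a mpoly"]
  interpret field_hom "fract_map (mfps_const :: 'a mpoly \<Rightarrow> _)" by (rule field_hom_fract_map[OF inj])
  show ?thesis
    using arg_cong[OF to_fract_P_fun[of f n l], of "fract_map mfps_const"]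
    by (simp add: hom_P_frac fract_map_to_fract[OF inj])
qed

lemma to_fract_map_dual_P_fun:
  "to_fract (mfps_map mpoly_const (dual_P_fun f n l)) = P_frac n (\<lambda>i. to_fract (mfps_var i))
     (\<lambda>d i. to_fract (mfps_map mpoly_const (fps_at_var (dual f d) i))) l"
proof -
  note inj = inj_hom_mfps_map[OF inj_hom_mpoly_const[where 'a = "'a"]]
  interpret field_hom "fract_map (mfps_map (mpoly_const :: 'a \<Rightarrow> _))" by (rule field_hom_fract_map[OF inj])
  show ?thesis
    using arg_cong[OF to_fract_dual_P_fun[of f n l], of "fract_map (mfps_map mpoly_const)"]
    by (simp add: hom_P_frac fract_map_to_fract[OF inj] mfps_map_var)
qed

section \<open>The order of a power series\<close>

text \<open>
  The lowest homogeneous parts of two power series have a nonzero product, so orders add up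
  under multiplication (\<open>ord_mult_exact\<close>). Therefore the order extends to a valuation on the field of fractions; \<open>val_ge M z\<close>
  says that the valuation of \<open>z\<close> is at least \<open>M\<close>.
\<close>

definition mdeg :: "monomial \<Rightarrow> nat" where
  "mdeg m = (\<Sum>k\<in>vars m. expo m k)"

lemma mdeg_superset: "finite K \<Longrightarrow> vars m \<subseteq> K \<Longrightarrow> mdeg m = (\<Sum>k\<in>K. expo m k)"
  unfolding mdeg_def by (intro sum.mono_neutral_left) (auto simp: in_keys_iff)

lemma mdeg_add: "mdeg (a + b) = mdeg a + mdeg b"
proof -
  let ?K = "vars a \<union> vars b"
  have "vars (a + b) \<subseteq> ?K" by (auto simp: in_keys_iff lookup_add)
  then show ?thesis
    using mdeg_superset[of ?K a] mdeg_superset[of ?K b] mdeg_superset[of ?K "a + b"]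
    by (simp add: lookup_add sum.distrib)
qed

lemma mdeg_single [simp]: "mdeg (Poly_Mapping.single i k) = k"
  by (simp add: mdeg_def)

lemma mdeg_0 [simp]: "mdeg 0 = 0"
  by (simp add: mdeg_def)

definition ord_ge :: "nat \<Rightarrow> 'a::comm_ring_1 mfps \<Rightarrow> bool" where
  "ord_ge k g \<longleftrightarrow> (\<forall>m. mdeg m < k \<longrightarrow> mfps_coeff g m = 0)"

lemma ord_ge_zero [simp]: "ord_ge k 0"
  and ord_ge_0 [simp]: "ord_ge 0 g"
  and ord_ge_add: "ord_ge k g \<Longrightarrow> ord_ge k h \<Longrightarrow> ord_ge k (g + h)"
  and ord_ge_diff: "ord_ge k g \<Longrightarrow> ord_ge k h \<Longrightarrow> ord_ge k (g - h)"
  and ord_ge_mono: "ord_ge k g \<Longrightarrow> j \<le> k \<Longrightarrow> ord_ge j g"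
  by (auto simp: ord_ge_def)

lemma ord_ge_mult:
  assumes "ord_ge k g" "ord_ge l h"
  shows "ord_ge (k + l) (g * h)"
  unfolding ord_ge_def mfps_coeff_mult
proof (intro allI impI sum.neutral ballI)
  fix m p assume m: "mdeg m < k + l" and "p \<in> splittings m"
  then obtain a b where p: "p = (a, b)" "a + b = m" by (cases p) auto
  then have "mdeg a < k \<or> mdeg b < l" using m mdeg_add[of a b] by auto
  then show "(case p of (a, b) \<Rightarrow> mfps_coeff g a * mfps_coeff h b) = 0"
    using assms p by (auto simp: ord_ge_def)
qed

lemma ord_mult_exact:
  fixes g h :: "'a::idom mfps"
  assumes g: "ord_ge k g" "\<not> ord_ge (Suc k) g" and h: "ord_ge l h" "\<not> ord_ge (Suc l) h"
  shows "\<not> ord_ge (Suc (k + l)) (g * h)"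
proof
  assume gh: "ord_ge (Suc (k + l)) (g * h)"
  define form where "form d f = Abs_mfps (\<lambda>m. if mdeg m = d then mfps_coeff f m else 0)" for d and f :: "'a mfps"
  have nz: "form d f \<noteq> 0" if "ord_ge d f" "\<not> ord_ge (Suc d) f" for d f
    using that by (auto simp: form_def mfps_eq_iff ord_ge_def less_Suc_eq)
  have "mfps_coeff (form k g * form l h) m = 0" for m
  proof (cases "mdeg m = k + l")
    case True
    have "mfps_coeff (form k g * form l h) m = mfps_coeff (g * h) m"
      unfolding mfps_coeff_mult
    proof (intro sum.cong refl)
      fix p assume "p \<in> splittings m"
      then obtain a b where p: "p = (a, b)" "a + b = m" by (cases p) auto
      then have "mdeg a + mdeg b = k + l" using True mdeg_add[of a b] by simp
      then consider "mdeg a = k" "mdeg b = l" | "mdeg a < k" | "mdeg b < l"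
        by linarith
      then show "(case p of (a, b) \<Rightarrow> mfps_coeff (form k g) a * mfps_coeff (form l h) b)
          = (case p of (a, b) \<Rightarrow> mfps_coeff g a * mfps_coeff h b)"
        using g(1) h(1) p(1) by cases (auto simp: form_def ord_ge_def)
    qed
    then show ?thesis using gh True by (simp add: ord_ge_def)
  next
    case False
    show ?thesis
      unfolding mfps_coeff_mult
    proof (intro sum.neutral ballI)
      fix p assume "p \<in> splittings m"
      then show "(case p of (a, b) \<Rightarrow> mfps_coeff (form k g) a * mfps_coeff (form l h) b) = 0"
        using False mdeg_add by (cases p) (auto simp: form_def)
    qed
  qed
  then have "form k g * form l h = 0" by (simp add: mfps_eq_iff)
  then show False using nz[OF g] nz[OF h] by simp
qed

definition val_ge :: "nat \<Rightarrow> 'a::idom mfps fract \<Rightarrow> bool" where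
  "val_ge M z \<longleftrightarrow> (\<exists>a b k. z = to_fract a / to_fract b \<and> ord_ge k b \<and> \<not> ord_ge (Suc k) b \<and> ord_ge (M + k) a)"

lemma val_geI:
  "z = to_fract a / to_fract b \<Longrightarrow> ord_ge k b \<Longrightarrow> \<not> ord_ge (Suc k) b \<Longrightarrow> ord_ge (M + k) a \<Longrightarrow> val_ge M z"
  unfolding val_ge_def by blast

lemma not_ord_ge_nonzero: "\<not> ord_ge k b \<Longrightarrow> b \<noteq> 0"
  by auto

lemma not_ord_ge_1: "\<not> ord_ge (Suc 0) (1 :: 'a::idom mfps)"
  by (auto simp: ord_ge_def mfps_coeff_1 intro!: exI[of _ 0])

lemma val_ge_to_fract [simp]: "val_ge M (to_fract a) \<longleftrightarrow> ord_ge M a"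
proof
  assume "ord_ge M a"
  then show "val_ge M (to_fract a)"
    by (intro val_geI[of _ a 1 0]) (simp_all add: not_ord_ge_1)
next
  assume "val_ge M (to_fract a)"
  then obtain c b k where *: "to_fract a = to_fract c / to_fract b" "ord_ge k b" "\<not> ord_ge (Suc k) b" "ord_ge (M + k) c"
    unfolding val_ge_def by blast
  have "to_fract (a * b) = to_fract c" using *(1) not_ord_ge_nonzero[OF *(3)] by simp
  then have ab: "a * b = c" by (simp only: to_fract_eq_iff)
  show "ord_ge M a"
  proof (rule ccontr)
    assume "\<not> ord_ge M a"
    define j where "j = (LEAST j. \<not> ord_ge j a)"
    have "\<not> ord_ge j a" "j \<le> M"
      unfolding j_def using \<open>\<not> ord_ge M a\<close> by (metis LeastI, metis Least_le)
    moreover then obtain i where i: "j = Suc i" by (cases j) auto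
    moreover have "ord_ge i a" using not_less_Least[of i "\<lambda>j. \<not> ord_ge j a"] i j_def by auto
    ultimately have "\<not> ord_ge (Suc (i + k)) (a * b)" "Suc (i + k) \<le> M + k"
      using ord_mult_exact[of i a k b] *(2,3) by auto
    then show False using *(4) ord_ge_mono unfolding ab by blast
  qed
qed

lemma val_ge_mult:
  assumes "val_ge M z" "val_ge M' z'"
  shows "val_ge (M + M') (z * z')"
proof -
  obtain a b k where 1: "z = to_fract a / to_fract b" "ord_ge k b" "\<not> ord_ge (Suc k) b" "ord_ge (M + k) a"
    using assms(1) unfolding val_ge_def by blast
  obtain a' b' k' where 2: "z' = to_fract a' / to_fract b'" "ord_ge k' b'" "\<not> ord_ge (Suc k') b'" "ord_ge (M' + k') a'"
    using assms(2) unfolding val_ge_def by blast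
  show ?thesis
  proof (rule val_geI)
    show "z * z' = to_fract (a * a') / to_fract (b * b')" by (simp add: 1(1) 2(1))
    show "ord_ge (k + k') (b * b')" using 1 2 by (intro ord_ge_mult)
    show "\<not> ord_ge (Suc (k + k')) (b * b')" using 1 2 by (intro ord_mult_exact)
    show "ord_ge (M + M' + (k + k')) (a * a')"
      using ord_ge_mult[OF 1(4) 2(4)] by (simp add: algebra_simps)
  qed
qed

lemma val_ge_add:
  assumes "val_ge M z" "val_ge M z'"
  shows "val_ge M (z + z')"
proof -
  obtain a b k where 1: "z = to_fract a / to_fract b" "ord_ge k b" "\<not> ord_ge (Suc k) b" "ord_ge (M + k) a"
    using assms(1) unfolding val_ge_def by blast
  obtain a' b' k' where 2: "z' = to_fract a' / to_fract b'" "ord_ge k' b'" "\<not> ord_ge (Suc k') b'" "ord_ge (M + k') a'"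
    using assms(2) unfolding val_ge_def by blast
  show ?thesis
  proof (rule val_geI)
    show "z + z' = to_fract (a * b' + a' * b) / to_fract (b * b')"
      using not_ord_ge_nonzero[OF 1(3)] not_ord_ge_nonzero[OF 2(3)] by (simp add: 1(1) 2(1) add_frac_eq)
    show "ord_ge (k + k') (b * b')" using 1 2 by (intro ord_ge_mult)
    show "\<not> ord_ge (Suc (k + k')) (b * b')" using 1 2 by (intro ord_mult_exact)
    show "ord_ge (M + (k + k')) (a * b' + a' * b)"
      using ord_ge_mult[OF 1(4) 2(2)] ord_ge_mult[OF 2(4) 1(2)] by (intro ord_ge_add) (simp_all add: ac_simps)
  qed
qed

lemma val_ge_zero [simp]: "val_ge M 0"
  using val_ge_to_fract[of M 0] by simp

lemma val_ge_one [simp]: "val_ge 0 1"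
  using val_ge_to_fract[of 0 1] by simp

lemma val_ge_uminus: "val_ge M z \<Longrightarrow> val_ge M (- z)"
  using val_ge_mult[of 0 "- 1" M z] val_ge_to_fract[of 0 "- 1"] by simp

lemma val_ge_sum: "(\<And>i. i \<in> I \<Longrightarrow> val_ge M (g i)) \<Longrightarrow> val_ge M (sum g I)"
  by (induction I rule: infinite_finite_induct) (auto intro: val_ge_add)

lemma val_ge_sign: "val_ge M z \<Longrightarrow> val_ge M ((-1) ^ i * z)"
  by (cases "even i") (auto intro: val_ge_uminus)

lemma val_ge_0_mult: "val_ge 0 z \<Longrightarrow> val_ge 0 z' \<Longrightarrow> val_ge 0 (z * z')"
  using val_ge_mult[of 0 z 0 z'] by simp

lemma val_ge_prod_list: "(\<And>x. x \<in> set L \<Longrightarrow> val_ge 0 (g x)) \<Longrightarrow> val_ge 0 (\<Prod>x\<leftarrow>L. g x)"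
  by (induction L) (auto intro: val_ge_0_mult)

lemma set_del: "x \<in> set (del i L) \<Longrightarrow> x \<in> set L"
  by (auto simp: del_def dest: in_set_takeD in_set_dropD)

lemma val_ge_pf:
  assumes "\<And>a b. a \<in> set L \<Longrightarrow> b \<in> set L \<Longrightarrow> val_ge 0 (w a b)"
  shows "val_ge 0 (pf w L)"
  using assms
proof (induction L rule: list_length_induct)
  case (less L)
  show ?case
  proof (cases L)
    case (Cons a L')
    have "val_ge 0 (w a (L' ! i) * pf w (del i L'))" if "i < length L'" for i
      using that by (intro val_ge_0_mult less.IH less.prems) (auto simp: Cons dest: set_del)
    then show ?thesis
      unfolding Cons pf.simps by (intro val_ge_sum val_ge_sign) auto
  qed simp
qed

lemma val_ge_pf_diff:
  assumes "\<And>a b. a \<in> set L \<Longrightarrow> b \<in> set L \<Longrightarrow> val_ge 0 (w a b)"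
    and "\<And>a b. a \<in> set L \<Longrightarrow> b \<in> set L \<Longrightarrow> val_ge 0 (w' a b)"
    and "\<And>a b. a \<in> set L \<Longrightarrow> b \<in> set L \<Longrightarrow> val_ge M (w a b - w' a b)"
  shows "val_ge M (pf w L - pf w' L)"
  using assms
proof (induction L rule: list_length_induct)
  case (less L)
  show ?case
  proof (cases L)
    case (Cons a L')
    have "val_ge M (w a (L' ! i) * pf w (del i L') - w' a (L' ! i) * pf w' (del i L'))" if i: "i < length L'" for i
    proof -
      have "w a (L' ! i) * pf w (del i L') - w' a (L' ! i) * pf w' (del i L')
          = (w a (L' ! i) - w' a (L' ! i)) * pf w (del i L') + w' a (L' ! i) * (pf w (del i L') - pf w' (del i L'))"
        by (simp add: algebra_simps)
      moreover have "val_ge (M + 0) ((w a (L' ! i) - w' a (L' ! i)) * pf w (del i L'))"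
        using i by (intro val_ge_mult val_ge_pf less.prems) (auto simp: Cons dest: set_del)
      moreover have "val_ge (0 + M) (w' a (L' ! i) * (pf w (del i L') - pf w' (del i L')))"
        using i by (intro val_ge_mult less.IH less.prems) (auto simp: Cons dest: set_del)
      ultimately show ?thesis using val_ge_add by simp
    qed
    then show ?thesis
      unfolding Cons pf.simps sum_subtractf[symmetric] right_diff_distrib[symmetric]
      by (intro val_ge_sum val_ge_sign) auto
  qed simp
qed

lemma pf_zero_row:
  assumes "k \<in> set L" "\<And>a. w a k = 0" "\<And>a. w k a = 0"
  shows "pf w L = 0"
  using assms(1)
proof (induction L rule: list_length_induct)
  case (less L)
  then obtain a L' where L: "L = a # L'" by (cases L) auto
  have "alt_sum (\<lambda>x M. w a x * pf w M) L' = alt_sum (\<lambda>x M. 0) L'"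
  proof (rule alt_sum_cong)
    fix A x B assume L': "L' = A @ x # B"
    show "w a x * pf w (A @ B) = 0"
    proof (cases "a = k \<or> x = k")
      case False
      then have "pf w (A @ B) = 0" using less.prems by (intro less.IH) (auto simp: L L')
      then show ?thesis by simp
    qed (use assms in auto)
  qed
  then show ?case by (simp add: L pf_Cons)
qed

section \<open>The Cauchy kernel as a Schur Pfaffian\<close>

lemma pair_prod_append:
  "pair_prod w (A @ B) = pair_prod w A * (\<Prod>a\<leftarrow>A. \<Prod>b\<leftarrow>B. w a b) * pair_prod w B"
  by (induction A) (simp_all add: mult_ac)

lemma pair_prod_map: "pair_prod w (map g L) = pair_prod (\<lambda>x y. w (g x) (g y)) L"
  by (induction L) (simp_all add: o_def)

lemma pair_prod_rev: "pair_prod w (rev L) = pair_prod (\<lambda>x y. w y x) L"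
  by (induction L) (simp_all add: pair_prod_append_single mult.commute rev_map[symmetric] prod_list.rev)

text \<open>
  The Schur Pfaffian for the \<open>2n\<close> values \<open>x i\<close> and \<open>z j = -1 / y j\<close>. The passage from \<open>y\<close> to \<open>z\<close> transposes the second
  diagonal block, and the reversed list of labels compensates for this in the product over pairs.
\<close>

lemma pf_kernel:
  fixes x y :: "nat \<Rightarrow> 'f::field"
  assumes inj: "inj x" "inj y"
    and nz: "\<And>i j. x i + x j \<noteq> 0" "\<And>i j. y i + y j \<noteq> 0"
      "\<And>i j. 1 - x i * y j \<noteq> 0" "\<And>i j. 1 + x i * y j \<noteq> 0"
  shows "pf (block (schur_weight x) (\<lambda>i j. (1 + x i * y j) / (1 - x i * y j)) (\<lambda>j j'. schur_weight y j' j))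
      (map Inl [0..<n] @ map Inr (rev [0..<n]))
    = pair_prod (schur_weight x) [0..<n] * pair_prod (schur_weight y) [0..<n]
      * (\<Prod>i<n. \<Prod>j<n. (1 + x i * y j) / (1 - x i * y j))" (is "pf ?w ?L = _")
proof -
  define z where "z = case_sum x (\<lambda>j. - 1 / y j)"
  interpret skew "schur_weight z" by (rule skew_schur_weight)
  have two: "(2 :: 'f) \<noteq> 0" using nz(1)[of 0 0] by (auto simp flip: mult_2)
  have y: "y j \<noteq> 0" for j using nz(2)[of j j] by auto
  have ii: "schur_weight z (Inl i) (Inl j) = schur_weight x i j" for i j
    by (simp add: z_def schur_weight_def)
  have ij: "schur_weight z (Inl i) (Inr j) = (1 + x i * y j) / (1 - x i * y j)" for i j
  proof -
    have "- 1 / y j - x i = - (1 + x i * y j) / y j" "- 1 / y j + x i = - (1 - x i * y j) / y j"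
      using y[of j] by (simp_all add: field_simps)
    then have "schur_weight z (Inl i) (Inr j) = (- (1 + x i * y j) / y j) / (- (1 - x i * y j) / y j)"
      by (simp only: z_def schur_weight_def sum.case)
    moreover have "(- a / y j) / (- b / y j) = a / b" for a b using y[of j] by simp
    ultimately show ?thesis by (simp only:)
  qed
  have jj: "schur_weight z (Inr j) (Inr j') = schur_weight y j' j" for j j'
  proof -
    have "- 1 / y j' - (- 1 / y j) = (y j' - y j) / (y j * y j')" "- 1 / y j' + (- 1 / y j) = - (y j + y j') / (y j * y j')"
      using y[of j] y[of j'] by (simp_all add: field_simps)
    moreover have "(y j' - y j) / - (y j + y j') = (y j - y j') / (y j + y j')"
      by (metis minus_diff_eq minus_divide_left minus_divide_right)
    ultimately show ?thesis using y[of j] y[of j'] by (simp add: z_def schur_weight_def)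
  qed
  have w: "?w u v = schur_weight z u v" for u v
    using skew[of "Inr _" "Inl _"] by (cases u; cases v) (simp_all add: ii ij jj)
  have "pf ?w ?L = pf (schur_weight z) ?L" unfolding w ..
  also have "\<dots> = pair_prod (schur_weight z) ?L"
  proof (rule schur_pfaffian)
    have ne: "x i \<noteq> - 1 / y j" for i j using nz(4)[of i j] y[of j] by (auto simp: field_simps)
    have "inj z"
    proof (rule injI)
      fix u v assume "z u = z v"
      then show "u = v"
        using ne ne[symmetric] by (cases u; cases v) (auto simp: z_def inj_eq[OF inj(1)] inj_eq[OF inj(2)])
    qed
    then show "inj_on z (set ?L)" by (rule inj_on_subset) simp
    show "z u + z v \<noteq> 0" for u v
    proof -
      have "x i + - 1 / y j \<noteq> 0" for i j using nz(3)[of i j] y[of j] by (auto simp: field_simps)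
      moreover have "- 1 / y i + - 1 / y j \<noteq> 0" for i j
      proof -
        have "- 1 / y i + - 1 / y j = - (y i + y j) / (y i * y j)"
          using y[of i] y[of j] by (simp add: field_simps)
        then show ?thesis
          using nz(2)[of i j] y[of i] y[of j]
          by (simp only: divide_eq_0_iff neg_equal_0_iff_equal mult_eq_0_iff) simp
      qed
      ultimately show ?thesis
        using nz(1) by (cases u; cases v) (auto simp: z_def add.commute)
    qed
    show "distinct ?L" by (auto simp: distinct_map)
  qed simp
  also have "\<dots> = pair_prod (schur_weight x) [0..<n] * (\<Prod>i\<leftarrow>[0..<n]. \<Prod>j\<leftarrow>[0..<n]. (1 + x i * y j) / (1 - x i * y j))
      * pair_prod (schur_weight y) [0..<n]"
    by (simp add: pair_prod_append pair_prod_map pair_prod_rev ii ij jj o_def rev_map[symmetric] prod_list.rev)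
  also have "(\<Prod>i\<leftarrow>[0..<n]. \<Prod>j\<leftarrow>[0..<n]. (1 + x i * y j) / (1 - x i * y j)) = (\<Prod>i<n. \<Prod>j<n. (1 + x i * y j) / (1 - x i * y j))"
    by (simp add: prod.distinct_set_conv_list[symmetric] lessThan_atLeast0)
  finally show ?thesis by (simp add: mult_ac)
qed

section \<open>Strict partitions and finite sets\<close>

lemma strict_partition_eq_filter:
  assumes "strict_partition l" "set l \<subseteq> {..N}"
  shows "filter (\<lambda>k. k \<in> set l) (rev [0..<Suc N]) = l"
proof -
  let ?m = "filter (\<lambda>k. k \<in> set l) [0..<Suc N]"
  have "sorted_wrt (<) (rev l)" using assms(1) by (simp add: strict_partition_def sorted_wrt_rev)
  moreover have "sorted_wrt (<) ?m" by (intro sorted_wrt_filter sorted_wrt_upt)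
  moreover have "set ?m = set (rev l)" using assms(2) by (auto simp del: upt_Suc)
  ultimately have "?m = rev l" unfolding strict_sorted_iff by (blast intro: sorted_distinct_set_unique)
  then show ?thesis by (simp only: rev_filter[symmetric] rev_rev_ident)
qed

lemma finite_strict_partitions: "finite {l. strict_partition l \<and> set l \<subseteq> {..N}}"
proof (rule finite_subset)
  show "{l. strict_partition l \<and> set l \<subseteq> {..N}} \<subseteq> (\<lambda>J. filter (\<lambda>k. k \<in> J) (rev [0..<Suc N])) ` Pow {..N}"
  proof
    fix l assume "l \<in> {l. strict_partition l \<and> set l \<subseteq> {..N}}"
    then have l: "strict_partition l" "set l \<subseteq> {..N}" by simp_all
    show "l \<in> (\<lambda>J. filter (\<lambda>k. k \<in> J) (rev [0..<Suc N])) ` Pow {..N}"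
      using l(2) by (intro image_eqI[of _ _ "set l"] strict_partition_eq_filter[OF l, symmetric]) simp
  qed
qed simp

text \<open>
  Exactly one of \<open>J - {0}\<close> and \<open>J \<union> {0}\<close> has the parity of \<open>n\<close>; thus the strict partitions, with \<open>0\<close> appended
  when \<open>star\<close> requires it, correspond to the sets of this parity.
\<close>

lemma sum_star_strict_partitions:
  assumes t: "\<And>\<alpha>. odd (n + length \<alpha>) \<Longrightarrow> t \<alpha> = (0 :: 'a::comm_monoid_add)"
  shows "(\<Sum>J\<in>Pow {..N}. t (filter (\<lambda>k. k \<in> J) (rev [0..<Suc N])))
    = (\<Sum>l | strict_partition l \<and> set l \<subseteq> {..N}. t (star n l))"
proof -
  define K where "K = rev [0..<Suc N]"
  define K' where "K' = rev [1..<Suc N]"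
  let ?E = "{J \<in> Pow {..N}. even (n + card J)}"
  let ?part = "\<lambda>J. filter (\<lambda>k. k \<in> J - {0}) K"
  have K: "K = K' @ [0]" "0 \<notin> set K'" "set K = {..N}" "distinct K"
    using upt_conv_Cons[of 0 "Suc N"] by (auto simp: K_def K'_def simp del: upt_Suc)
  have sorted: "sorted_wrt (>) K" unfolding K_def sorted_wrt_rev by (rule sorted_wrt_upt)
  have len: "length (filter (\<lambda>k. k \<in> J) K) = card J" if "J \<subseteq> {..N}" for J
  proof -
    have "card J = card (set (filter (\<lambda>k. k \<in> J) K))"
      using that K(3) by (intro arg_cong[of _ _ card]) auto
    also have "\<dots> = length (filter (\<lambda>k. k \<in> J) K)"
      by (intro distinct_card distinct_filter K(4))
    finally show ?thesis ..
  qed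
  have star: "star n (?part J) = filter (\<lambda>k. k \<in> J) K" if J: "J \<in> ?E" for J
  proof -
    have "filter (\<lambda>k. k \<in> J) K' = filter (\<lambda>k. k \<in> J - {0}) K'"
      using K(2) by (intro filter_cong) (auto intro!: gr0I)
    then have eq: "filter (\<lambda>k. k \<in> J) K = ?part J @ (if 0 \<in> J then [0] else [])"
      by (simp add: K(1))
    have "even (n + length (filter (\<lambda>k. k \<in> J) K))"
      using J len[of J] by simp
    then have e: "even (n + length (?part J)) \<longleftrightarrow> 0 \<notin> J"
      unfolding eq by (cases "0 \<in> J") simp_all
    have "star n (?part J) = ?part J @ (if 0 \<in> J then [0] else [])"
      by (cases "0 \<in> J") (simp_all only: star_def e if_True if_False simp_thms append_Nil2)
    with eq show ?thesis by (simp only:)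
  qed
  have part: "?part (set (star n l)) = l" "set (star n l) \<in> ?E"
    if l: "strict_partition l" "set l \<subseteq> {..N}" for l
  proof -
    have "sorted_wrt (<) (rev l)" using l(1) by (simp add: strict_partition_def sorted_wrt_rev)
    then have l0: "0 \<notin> set l" "distinct l"
      using l(1) by (simp_all add: strict_partition_def strict_sorted_iff)
    have 1: "set (star n l) - {0} = set l" using l0(1) by (auto simp: star_def)
    have 2: "distinct (star n l)" "even (n + length (star n l))" "set (star n l) \<subseteq> {..N}"
      using l0 l(2) by (auto simp: star_def)
    show "?part (set (star n l)) = l"
      unfolding 1 K_def by (rule strict_partition_eq_filter[OF l])
    show "set (star n l) \<in> ?E"
      using 2 by (simp add: distinct_card)
  qed
  have "(\<Sum>J\<in>Pow {..N}. t (filter (\<lambda>k. k \<in> J) K)) = (\<Sum>J\<in>?E. t (filter (\<lambda>k. k \<in> J) K))"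
    by (intro sum.mono_neutral_right) (auto intro!: t simp: len)
  also have "\<dots> = (\<Sum>l | strict_partition l \<and> set l \<subseteq> {..N}. t (star n l))"
  proof (rule sum.reindex_bij_witness[of _ "\<lambda>l. set (star n l)" ?part])
    fix J assume J: "J \<in> ?E"
    have "set (filter (\<lambda>k. k \<in> J) K) = J" using J K(3) by auto
    then show "set (star n (?part J)) = J" unfolding star[OF J] .
    have "sorted_wrt (>) (?part J)" by (intro sorted_wrt_filter sorted)
    then show "?part J \<in> {l. strict_partition l \<and> set l \<subseteq> {..N}}"
      using K(3) by (auto simp: strict_partition_def)
    show "t (star n (?part J)) = t (filter (\<lambda>k. k \<in> J) K)" unfolding star[OF J] ..
  qed (use part in auto)
  finally show ?thesis unfolding K_def .
qed

section \<open>The Cauchy identity\<close>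

lemma lookup_poly_at_var:
  "Poly_Mapping.lookup (poly_at_var p i) m = (if vars m \<subseteq> {i} then coeff p (expo m i) else 0)"
  using arg_cong[OF fps_at_var_poly[of p i], of "\<lambda>g. mfps_coeff g m"] 
  by (cases "vars m \<subseteq> {i}") (simp_all add: fps_at_var_def)

lemma poly_at_var_sum_smult:
  "poly_at_var (\<Sum>k\<in>A. Polynomial.smult (c k) (p k)) i = (\<Sum>k\<in>A. mpoly_const (c k) * poly_at_var (p k) i)"
proof -
  have "mfps_of_mpoly (poly_at_var (\<Sum>k\<in>A. Polynomial.smult (c k) (p k)) i)
      = mfps_of_mpoly (\<Sum>k\<in>A. mpoly_const (c k) * poly_at_var (p k) i)"
    by (rule mfps_eqI)
       (simp add: lookup_poly_at_var coeff_sum mfps_of_mpoly.hom_sum mfps_of_mpoly.hom_mult mfps_coeff_sum del: mfps_coeff_of_mpoly,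
        simp add: lookup_poly_at_var coeff_sum)
  then show ?thesis by simp
qed

lemma poly_at_var_monom: "poly_at_var (monom a d) i = mpoly_const a * mpoly_var i ^ d"
  by (simp add: poly_at_var_def map_poly_monom poly_monom)

lemma mpoly_var_add_nonzero: "mpoly_var i + mpoly_var j \<noteq> (0 :: 'a::{comm_ring_1,ring_char_0} mpoly)"
  using mfps_var_add_nonzero[of i j, where 'a = 'a]
  by (metis mfps_of_mpoly.hom_add mfps_of_mpoly.hom_zero mfps_of_mpoly_var)

lemma mpoly_var_inject: "mpoly_var i = (mpoly_var j :: 'a::comm_ring_1 mpoly) \<longleftrightarrow> i = j"
  by (metis mfps_of_mpoly_var mfps_var_inject)

lemma single_eq_single_iff: "Poly_Mapping.single j a = Poly_Mapping.single j b \<longleftrightarrow> a = b"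
  by (metis lookup_single_eq)

lemma single_nonzero: "Poly_Mapping.single j (Suc a) \<noteq> 0" "0 \<noteq> Poly_Mapping.single j (Suc a)"
  by (metis lookup_single_eq lookup_zero nat.distinct(1))+

text \<open>
  From here on everything takes place in the field of fractions of \<open>K[x][[y]]\<close>; \<open>x\<close>, \<open>y\<close>, \<open>X\<close> and \<open>Y\<close> are the images there of the
  variables and of the entries of the matrices \<open>V\<close>.
\<close>

locale dual_cauchy =
  fixes f :: "nat \<Rightarrow> 'k::field_char_0 poly" and n :: nat
  assumes adm: "admissible f"
begin

definition x :: "nat \<Rightarrow> 'k mpoly mfps fract" where "x i = to_fract (mfps_const (mpoly_var i))"
definition y :: "nat \<Rightarrow> 'k mpoly mfps fract" where "y j = to_fract (mfps_var j)"
definition X :: "nat \<Rightarrow> nat \<Rightarrow> 'k mpoly mfps fract" where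
  "X d i = to_fract (mfps_const (poly_at_var (f d) i))"
definition Y :: "nat \<Rightarrow> nat \<Rightarrow> 'k mpoly mfps fract" where
  "Y d j = to_fract (mfps_map mpoly_const (fps_at_var (dual f d) j))"
definition kernel :: "nat \<Rightarrow> nat \<Rightarrow> 'k mpoly mfps" where
  "kernel i j = fps_at_var (Abs_fps (\<lambda>d. mpoly_const (if d = 0 then 1 else 2) * mpoly_var i ^ d)) j"

lemma kernel_mult: "kernel i j * (1 - mfps_const (mpoly_var i) * mfps_var j) = 1 + mfps_const (mpoly_var i) * mfps_var j"
proof (rule mfps_eqI)
  fix m
  let ?x = "mpoly_var i :: 'k mpoly"
  interpret mc: inj_comm_ring_hom "mpoly_const :: 'k \<Rightarrow> 'k mpoly" by (rule inj_hom_mpoly_const)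
  have two: "mpoly_const 2 = (2 :: 'k mpoly)" using mc.hom_add[of 1 1] by simp
  have "kernel i j * (1 - mfps_const ?x * mfps_var j) = kernel i j - mfps_const ?x * (mfps_var j * kernel i j)"
    by (simp add: algebra_simps)
  then have l: "mfps_coeff (kernel i j * (1 - mfps_const ?x * mfps_var j)) m
      = mfps_coeff (kernel i j) m - ?x * (if expo m j = 0 then 0 else mfps_coeff (kernel i j) (m - Poly_Mapping.single j 1))"
    by (simp add: mfps_coeff_var_mult)
  have r: "mfps_coeff (1 + mfps_const ?x * mfps_var j) m
      = (if m = 0 then 1 else 0) + ?x * (if m = Poly_Mapping.single j 1 then 1 else 0)"
    by (simp add: mfps_coeff_1 mfps_coeff_var)
  show "mfps_coeff (kernel i j * (1 - mfps_const ?x * mfps_var j)) m = mfps_coeff (1 + mfps_const ?x * mfps_var j) m"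
  proof (cases "vars m \<subseteq> {j}")
    case True
    define d where "d = expo m j"
    have m: "m = Poly_Mapping.single j d" unfolding d_def using True by (rule vars_subset_singleton)
    consider "d = 0" | "d = 1" | e where "d = Suc (Suc e)"
      by (metis One_nat_def not0_implies_Suc)
    then show ?thesis
      unfolding l r unfolding m
      by cases (simp_all add: kernel_def fps_at_var_def lookup_minus two single_eq_single_iff single_nonzero flip: single_diff)
  next
    case False
    then have "m \<noteq> 0" "m \<noteq> Poly_Mapping.single j 1" by auto
    then show ?thesis
      unfolding l r using False vars_diff_single[of m j] by (auto simp: kernel_def fps_at_var_def)
  qed
qed

lemma one_pm_nonzero:
  "1 - mfps_const (mpoly_var i) * mfps_var j \<noteq> (0 :: 'k mpoly mfps)"
  "1 + mfps_const (mpoly_var i) * mfps_var j \<noteq> (0 :: 'k mpoly mfps)"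
proof -
  have "mfps_coeff (1 - mfps_const (mpoly_var i) * mfps_var j :: 'k mpoly mfps) 0 \<noteq> 0"
    "mfps_coeff (1 + mfps_const (mpoly_var i) * mfps_var j :: 'k mpoly mfps) 0 \<noteq> 0"
    by (auto simp: mfps_coeff_1 mfps_coeff_var single_nonzero)
  then show "1 - mfps_const (mpoly_var i) * mfps_var j \<noteq> (0 :: 'k mpoly mfps)"
    "1 + mfps_const (mpoly_var i) * mfps_var j \<noteq> (0 :: 'k mpoly mfps)" by force+
qed

lemma exact_div_kernel:
  "exact_div (1 + mfps_const (mpoly_var i) * mfps_var j) (1 - mfps_const (mpoly_var i) * mfps_var j) = kernel i j"
  by (rule exact_div_eqI) (simp_all only: one_pm_nonzero kernel_mult not_False_eq_True)

lemma to_fract_kernel: "to_fract (kernel i j) = (1 + x i * y j) / (1 - x i * y j)"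
proof -
  have "to_fract (kernel i j) * (1 - x i * y j) = 1 + x i * y j"
    using arg_cong[OF kernel_mult[of i j], of to_fract] by (simp add: x_def y_def)
  moreover have "1 - x i * y j \<noteq> 0"
  proof -
    have "to_fract (1 - mfps_const (mpoly_var i) * mfps_var j :: 'k mpoly mfps) \<noteq> 0"
      unfolding to_fract_eq_0_iff by (rule one_pm_nonzero)
    then show ?thesis by (simp add: x_def y_def)
  qed
  ultimately show ?thesis by (simp add: field_simps)
qed

lemma dual_coeff:
  "(\<Sum>k\<le>d. Polynomial.smult (fps_nth (dual f k) d) (f k)) = monom (if d = 0 then 1 else 2) d"
  "d < k \<Longrightarrow> fps_nth (dual f k) d = 0"
proof -
  have "is_dual f (dual f)" using adm by (rule is_dual_dual)
  then have *: "\<And>d. subdegree (dual f d) = d"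
    "\<And>d. (\<Sum>k\<le>d. Polynomial.smult (fps_nth (dual f k) d) (f k)) = monom (if d = 0 then 1 else 2) d"
    unfolding is_dual_iff by blast+
  show "(\<Sum>k\<le>d. Polynomial.smult (fps_nth (dual f k) d) (f k)) = monom (if d = 0 then 1 else 2) d" by (rule *(2))
  show "d < k \<Longrightarrow> fps_nth (dual f k) d = 0" using *(1)[of k] by (intro nth_less_subdegree_zero) simp
qed

lemma vars_singleton_mdeg: "vars m \<subseteq> {j} \<Longrightarrow> expo m j = mdeg m"
  by (metis mdeg_single vars_subset_singleton)

text \<open>
  Up to degree \<open>N\<close> in \<open>y\<^sub>j\<close> the sum that defines the dual needs only its terms with \<open>k \<le> N\<close>.
\<close>

lemma kernel_truncation:
  "ord_ge (Suc N) ((\<Sum>k\<le>N. mfps_const (poly_at_var (f k) i) * mfps_map mpoly_const (fps_at_var (dual f k) j)) - kernel i j)"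
  unfolding ord_ge_def
proof (intro allI impI)
  fix m assume m: "mdeg m < Suc N"
  show "mfps_coeff ((\<Sum>k\<le>N. mfps_const (poly_at_var (f k) i) * mfps_map mpoly_const (fps_at_var (dual f k) j)) - kernel i j) m = 0"
  proof (cases "vars m \<subseteq> {j}")
    case True
    define d where "d = mdeg m"
    have d: "expo m j = d" "d \<le> N" using vars_singleton_mdeg[OF True] m by (simp_all add: d_def)
    have "(\<Sum>k\<le>N. poly_at_var (f k) i * mpoly_const (fps_nth (dual f k) d))
        = (\<Sum>k\<le>d. poly_at_var (f k) i * mpoly_const (fps_nth (dual f k) d))"
      using d(2) by (intro sum.mono_neutral_right) (auto simp: dual_coeff(2))
    also have "\<dots> = poly_at_var (\<Sum>k\<le>d. Polynomial.smult (fps_nth (dual f k) d) (f k)) i"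
      by (simp add: poly_at_var_sum_smult mult.commute)
    also have "\<dots> = mpoly_const (if d = 0 then 1 else 2) * mpoly_var i ^ d"
      unfolding dual_coeff(1) by (rule poly_at_var_monom)
    finally show ?thesis
      using True d(1) by (simp add: mfps_coeff_sum fps_at_var_def kernel_def)
  qed (simp add: mfps_coeff_sum fps_at_var_def kernel_def)
qed

lemma val_Y: "val_ge d (Y d j)"
  unfolding Y_def val_ge_to_fract ord_ge_def
  by (auto simp: fps_at_var_def vars_singleton_mdeg dual_coeff(2))

lemma x_props: "x i + x j \<noteq> 0" "x i = x j \<longleftrightarrow> i = j" "val_ge 0 (schur_weight x i j)"
    "i \<noteq> j \<Longrightarrow> val_ge 0 (inverse (schur_weight x i j))"
proof -
  interpret c: inj_comm_ring_hom "mfps_const :: 'k mpoly \<Rightarrow> _" by (rule inj_hom_mfps_const)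
  have add: "x i + x j = to_fract (mfps_const (mpoly_var i + mpoly_var j))"
    and diff: "x i - x j = to_fract (mfps_const (mpoly_var i - mpoly_var j))" for i j
    by (simp_all add: x_def c.hom_add c.hom_minus)
  have ord: "\<not> ord_ge (Suc 0) (mfps_const c)" if "c \<noteq> 0" for c :: "'k mpoly"
    using that by (auto simp: ord_ge_def mfps_coeff_const intro!: exI[of _ 0])
  show "x i + x j \<noteq> 0"
    unfolding add to_fract_eq_0_iff c.hom_0_iff by (rule mpoly_var_add_nonzero)
  show "x i = x j \<longleftrightarrow> i = j"
    by (simp add: x_def mpoly_var_inject)
  show "val_ge 0 (schur_weight x i j)"
    unfolding schur_weight_def add diff
    by (rule val_geI[OF refl, of 0]) (simp_all add: ord mpoly_var_add_nonzero)
  show "val_ge 0 (inverse (schur_weight x i j))" if "i \<noteq> j"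
    unfolding schur_weight_def add diff inverse_divide
    by (rule val_geI[OF refl, of 0]) (use that in \<open>simp_all add: ord mpoly_var_inject\<close>)
qed

lemma y_props: "y i + y j \<noteq> 0" "y i = y j \<longleftrightarrow> i = j" "val_ge 0 (schur_weight y i j)"
    "i \<noteq> j \<Longrightarrow> val_ge 0 (inverse (schur_weight y i j))"
proof -
  have add: "y i + y j = to_fract (mfps_var i + mfps_var j)"
    and diff: "y i - y j = to_fract (mfps_var i - mfps_var j)" for i j
    by (simp_all add: y_def)
  have ord1: "ord_ge (Suc 0) (mfps_var i :: 'k mpoly mfps)" for i
    by (auto simp: ord_ge_def mfps_coeff_var)
  have nadd: "\<not> ord_ge (Suc (Suc 0)) (mfps_var i + mfps_var j :: 'k mpoly mfps)" for i j
    by (auto simp: ord_ge_def mfps_coeff_var intro!: exI[of _ "Poly_Mapping.single i 1"])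
  have ndiff: "\<not> ord_ge (Suc (Suc 0)) (mfps_var i - mfps_var j :: 'k mpoly mfps)" if "i \<noteq> j" for i j
    using that by (auto simp: ord_ge_def mfps_coeff_var single_inject[unfolded One_nat_def] intro!: exI[of _ "Poly_Mapping.single i 1"])
  show "y i + y j \<noteq> 0"
    unfolding add to_fract_eq_0_iff by (rule mfps_var_add_nonzero)
  show "y i = y j \<longleftrightarrow> i = j"
    by (simp add: y_def)
  show "val_ge 0 (schur_weight y i j)"
    unfolding schur_weight_def add diff
    by (rule val_geI[OF refl, of "Suc 0"]) (simp_all add: ord_ge_add ord_ge_diff ord1 nadd)
  show "val_ge 0 (inverse (schur_weight y i j))" if "i \<noteq> j"
    unfolding schur_weight_def add diff inverse_divide
    by (rule val_geI[OF refl, of "Suc 0"]) (use that in \<open>simp_all add: ord_ge_add ord_ge_diff ord1 ndiff\<close>)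
qed

lemma val_inverse_pair_prod:
  assumes "\<And>i j. i \<noteq> j \<Longrightarrow> val_ge 0 (inverse (w i j))" "distinct L"
  shows "val_ge 0 (inverse (pair_prod w L))"
  using assms(2)
proof (induction L)
  case (Cons a L)
  have "inverse (\<Prod>b\<leftarrow>L. w a b) = (\<Prod>b\<leftarrow>L. inverse (w a b))"
    by (induction L) simp_all
  then have "val_ge 0 (inverse (\<Prod>b\<leftarrow>L. w a b))"
    using Cons.prems by (auto intro!: val_ge_prod_list assms(1))
  then show ?case using Cons by (auto intro: val_ge_0_mult)
qed simp

abbreviation "pfx \<alpha> \<equiv> pf (block (schur_weight x) (\<lambda>i d. X d i) (\<lambda>_ _. 0)) (map Inl [0..<n] @ map Inr \<alpha>)"
abbreviation "pfy \<alpha> \<equiv> pf (block (schur_weight y) (\<lambda>i d. Y d i) (\<lambda>_ _. 0)) (map Inl [0..<n] @ map Inr \<alpha>)"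
abbreviation "Dx \<equiv> pair_prod (schur_weight x) [0..<n]"
abbreviation "Dy \<equiv> pair_prod (schur_weight y) [0..<n]"

lemma val_block:
  assumes "\<And>i j. val_ge 0 (A i j)" "\<And>i d. val_ge 0 (V i d)" "\<And>k l. val_ge 0 (B k l)"
  shows "val_ge 0 (block A V B u v)"
  using assms by (cases u; cases v) (auto intro: val_ge_uminus)

lemma val_X: "val_ge 0 (X d i)" by (simp add: X_def)

lemma val_Y0: "val_ge 0 (Y d i)" by (simp add: Y_def)

definition summand :: "nat list \<Rightarrow> 'k mpoly mfps" where
  "summand l = mfps_const (P_fun f n l) * mfps_map mpoly_const (dual_P_fun f n l)"

lemma to_fract_summand: "to_fract (summand l) = pfx (star n l) * pfy (star n l) / (Dx * Dy)"
  unfolding summand_def to_fract_mult to_fract_const_P_fun to_fract_map_dual_P_fun P_frac_eq_pf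
    x_def[symmetric, abs_def] y_def[symmetric, abs_def] X_def[symmetric, abs_def] Y_def[symmetric, abs_def]
  by simp

lemma val_inverse_D: "val_ge 0 (inverse (Dx * Dy))"
  by (simp add: val_ge_0_mult val_inverse_pair_prod x_props y_props)

text \<open>
  Replacing the dual series of index \<open>k\<close> by zero changes the Pfaffian only by terms of valuation at
  least \<open>k\<close>, and it produces a zero row.
\<close>

lemma summand_order:
  assumes "k \<in> set (star n l)"
  shows "ord_ge k (summand l)"
proof -
  let ?w = "block (schur_weight y) (\<lambda>i d. Y d i) (\<lambda>_ _. 0)"
  let ?w' = "block (schur_weight y) (\<lambda>i d. if d = k then 0 else Y d i) (\<lambda>_ _. 0)"
  let ?L = "map Inl [0..<n] @ map Inr (star n l)"
  have "val_ge k (?w u v - ?w' u v)" for u v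
    using val_Y[of k] by (cases u; cases v) (auto intro: val_ge_uminus)
  then have "val_ge k (pf ?w ?L - pf ?w' ?L)"
    by (intro val_ge_pf_diff val_block) (simp_all add: y_props val_Y0)
  moreover have "pf ?w' ?L = 0"
  proof (rule pf_zero_row[of "Inr k"])
    show "?w' u (Inr k) = 0" "?w' (Inr k) u = 0" for u by (cases u; simp)+
  qed (use assms in auto)
  ultimately have y: "val_ge k (pfy (star n l))" by simp
  have x: "val_ge 0 (pfx (star n l))"
    by (intro val_ge_pf val_block) (simp_all add: x_props val_X)
  have "val_ge (0 + (k + 0)) (pfx (star n l) * (pfy (star n l) * inverse (Dx * Dy)))"
    by (intro val_ge_mult x y val_inverse_D)
  then have "val_ge k (to_fract (summand l))"
    unfolding to_fract_summand by (simp add: divide_inverse mult.assoc)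
  then show ?thesis by simp
qed

text \<open>
  By \<open>pf_cauchy_binet\<close> the partial sum is a Pfaffian whose entries agree with those in \<open>pf_kernel\<close> up to valuation
  greater than \<open>N\<close>. All entries and \<open>1 / (\<Delta>(x) \<Delta>(y))\<close> have nonnegative valuation, so the quotients
  agree to the same precision.
\<close>

lemma partial_sum_order:
  "ord_ge (Suc N) ((\<Sum>l | strict_partition l \<and> set l \<subseteq> {..N}. summand l) - (\<Prod>i<n. \<Prod>j<n. kernel i j))"
proof -
  let ?K = "rev [0..<Suc N]"
  let ?L = "map Inl [0..<n] @ map Inr (rev [0..<n]) :: (nat + nat) list"
  let ?wN = "block (schur_weight x) (\<lambda>i j. \<Sum>k\<le>N. X k i * Y k j) (\<lambda>j j'. schur_weight y j' j)"
  let ?w = "block (schur_weight x) (\<lambda>i j. (1 + x i * y j) / (1 - x i * y j)) (\<lambda>j j'. schur_weight y j' j)"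
  have K: "set ?K = {..N}" "distinct ?K" by (auto simp del: upt_Suc)
  have D: "Dx * Dy \<noteq> 0"
  proof -
    have "pair_prod (schur_weight z) L \<noteq> 0"
      if "\<And>i j. z i + z j \<noteq> 0" "\<And>i j. z i = z j \<longleftrightarrow> i = j" "distinct L" for z :: "nat \<Rightarrow> 'k mpoly mfps fract" and L
      using that(3) by (induction L) (auto simp: that(1,2) schur_weight_def)
    then show ?thesis using x_props y_props by simp
  qed
  have "to_fract (\<Sum>l | strict_partition l \<and> set l \<subseteq> {..N}. summand l)
      = (\<Sum>l | strict_partition l \<and> set l \<subseteq> {..N}. pfx (star n l) * pfy (star n l)) / (Dx * Dy)"
    by (simp add: to_fract_summand sum_divide_distrib)
  also have "(\<Sum>l | strict_partition l \<and> set l \<subseteq> {..N}. pfx (star n l) * pfy (star n l))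
      = (\<Sum>J\<in>Pow {..N}. pfx (filter (\<lambda>k. k \<in> J) ?K) * pfy (filter (\<lambda>k. k \<in> J) ?K))"
    by (rule sum_star_strict_partitions[symmetric]) (simp add: pf_odd)
  also have "\<dots> = pf ?wN ?L"
    by (rule pf_cauchy_binet[OF skew_schur_weight K(2), unfolded K(1)])
  finally have lhs: "to_fract (\<Sum>l | strict_partition l \<and> set l \<subseteq> {..N}. summand l) = pf ?wN ?L / (Dx * Dy)" .
  have nz: "1 - x i * y j \<noteq> 0" "1 + x i * y j \<noteq> 0" for i j
  proof -
    have "to_fract (1 - mfps_const (mpoly_var i) * mfps_var j :: 'k mpoly mfps) \<noteq> 0"
      "to_fract (1 + mfps_const (mpoly_var i) * mfps_var j :: 'k mpoly mfps) \<noteq> 0"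
      unfolding to_fract_eq_0_iff by (rule one_pm_nonzero)+
    then show "1 - x i * y j \<noteq> 0" "1 + x i * y j \<noteq> 0" by (simp_all add: x_def y_def)
  qed
  have "pf ?w ?L = Dx * Dy * (\<Prod>i<n. \<Prod>j<n. (1 + x i * y j) / (1 - x i * y j))"
    by (rule pf_kernel) (simp_all only: inj_def x_props y_props nz simp_thms)
  then have rhs: "to_fract (\<Prod>i<n. \<Prod>j<n. kernel i j) = pf ?w ?L / (Dx * Dy)"
    using D by (simp add: fract.hom_prod to_fract_kernel)
  have V: "val_ge (Suc N) ((\<Sum>k\<le>N. X k i * Y k j) - (1 + x i * y j) / (1 - x i * y j))" for i j
  proof -
    have "(\<Sum>k\<le>N. X k i * Y k j) - (1 + x i * y j) / (1 - x i * y j) = to_fract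
        ((\<Sum>k\<le>N. mfps_const (poly_at_var (f k) i) * mfps_map mpoly_const (fps_at_var (dual f k) j)) - kernel i j)"
      by (simp add: X_def Y_def to_fract_kernel)
    then show ?thesis using kernel_truncation[of N i j] by (simp only: val_ge_to_fract)
  qed
  have vwN: "val_ge 0 (?wN u v)" for u v
    by (intro val_block val_ge_sum val_ge_0_mult) (simp_all add: x_props y_props val_X val_Y0)
  have vw: "val_ge 0 (?w u v)" for u v
    by (intro val_block) (simp_all add: x_props y_props flip: to_fract_kernel)
  have "val_ge (Suc N) (?wN u v - ?w u v)" for u v
  proof (cases u; cases v)
    fix i j assume "u = Inr j" "v = Inl i"
    then show ?thesis using val_ge_uminus[OF V[of i j]] by simp
  qed (use V in simp_all)
  then have "val_ge (Suc N) (pf ?wN ?L - pf ?w ?L)"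
    by (intro val_ge_pf_diff vwN vw)
  then have "val_ge (Suc N + 0) ((pf ?wN ?L - pf ?w ?L) * inverse (Dx * Dy))"
    by (intro val_ge_mult val_inverse_D)
  then have "val_ge (Suc N) (to_fract ((\<Sum>l | strict_partition l \<and> set l \<subseteq> {..N}. summand l) - (\<Prod>i<n. \<Prod>j<n. kernel i j)))"
    unfolding to_fract_diff lhs rhs by (simp add: divide_inverse left_diff_distrib)
  then show ?thesis by (simp only: val_ge_to_fract)
qed

lemma has_sum_summand: "(summand has_sum (\<Prod>i<n. \<Prod>j<n. kernel i j)) {l. strict_partition l}"
  unfolding has_sum_mfps_iff
proof (intro allI)
  fix m
  let ?A = "{l \<in> {l. strict_partition l}. mfps_coeff (summand l) m \<noteq> 0}"
  let ?B = "{l. strict_partition l \<and> set l \<subseteq> {..mdeg m}}"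
  have sub: "?A \<subseteq> ?B"
  proof safe
    fix l k assume l: "mfps_coeff (summand l) m \<noteq> 0" "k \<in> set l"
    have "k \<in> set (star n l)" using l(2) by (simp add: star_def)
    then have "ord_ge k (summand l)" by (rule summand_order)
    then show "k \<le> mdeg m" using l(1) unfolding ord_ge_def by (meson not_le)
  qed
  have fin: "finite ?B" by (rule finite_strict_partitions)
  have "(\<Sum>l\<in>?A. mfps_coeff (summand l) m) = (\<Sum>l\<in>?B. mfps_coeff (summand l) m)"
    using sub fin by (intro sum.mono_neutral_left) auto
  also have "\<dots> = mfps_coeff (\<Prod>i<n. \<Prod>j<n. kernel i j) m"
    using partial_sum_order[of "mdeg m"] unfolding ord_ge_def by (simp add: mfps_coeff_sum)
  finally show "finite ?A \<and> (\<Sum>l | l \<in> {l. strict_partition l} \<and> mfps_coeff (summand l) m \<noteq> 0. mfps_coeff (summand l) m)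
      = mfps_coeff (\<Prod>i<n. \<Prod>j<n. kernel i j) m"
    using finite_subset[OF sub fin] by simp
qed

end

theorem theorem3p5:
  fixes f :: "nat \<Rightarrow> 'k::field_char_0 poly" and n :: nat
  assumes "admissible f"
  shows "((\<lambda>l. mfps_const (P_fun f n l) * mfps_map mpoly_const (dual_P_fun f n l))
           has_sum
           (\<Prod>i<n. \<Prod>j<n. exact_div (1 + mfps_const (mpoly_var i) * mfps_var j)
                                (1 - mfps_const (mpoly_var i) * mfps_var j)))
         {l. strict_partition l}"
proof -
  interpret dual_cauchy f n by unfold_locales fact
  show ?thesis
    using has_sum_summand unfolding exact_div_kernel summand_def[abs_def] .
qed

end
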